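(* Let $\lambda=(\lambda_n)$ be a frequency. Then $\mathcal{D}_{\infty,+}(\lambda)=\mathcal{H}_{\infty,+}(\lambda)$ if and only if Bohr's theorem holds for $\lambda$.
   Context: A frequency is a strictly increasing unbounded sequence $\lambda=(\lambda_n)_{n\ge 1}$ of non-negative real numbers. A $\lambda$-Dirichlet series is a formal series $D=\sum a_n e^{-\lambda_n s}$ with $a_n\in\mathbb{C}$. For $\sigma>0$ put $D_\sigma=\sum a_n e^{-\lambda_n\sigma}e^{-\lambda_n s}$. Write $[\mathrm{Re}>\sigma]=\{s\in\mathbb{C}:\mathrm{Re}\,s>\sigma\}$, and $\sigma_u(D)=\inf\{\sigma\in\mathbb{R}: D \text{ converges uniformly on } [\mathrm{Re}>\sigma]\}$. Bohr's theorem holds for $\lambda$ if $\sigma_u(D)\le 0$ for every $\lambda$-Dirichlet series $D$ that converges somewhere and whose limit function extends to a bounded holomorphic function on $[\mathrm{Re}>0]$. $\mathcal{D}_{\infty,+}(\lambda)$ is the space of all $\lambda$-Dirichlet series converging on $[\mathrm{Re}>0]$ to a function bounded on $[\mathrm{Re}>\sigma]$ for each $\sigma>0$, with the topology given by the norms $\sup_{\mathrm{Re}\,s>1/k}|D(s)|$, $k\in\mathbb{N}$. A $\lambda$-Dirichlet group is a pair $(G,\beta)$ with $G$ a compact abelian group and $\beta:(\mathbb{R},+)\to G$ a continuous homomorphism with dense range such that for each $n$ there is a (unique) character $h_{\lambda_n}\in\widehat G$ with $h_{\lambda_n}(\beta(t))=e^{-i\lambda_n t}$ for all $t\in\mathbb{R}$;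 such groups always exist (e.g. the Bohr compactification of $\mathbb{R}$). $H_\infty^\lambda(G)$ is the space of all $f\in L_\infty(G)$ (Haar measure) whose Fourier coefficients vanish at all characters outside $\{h_{\lambda_n}:n\in\mathbb{N}\}$. $\mathcal{H}_\infty(\lambda)$ is the Banach space of all $\lambda$-Dirichlet series $\sum a_n e^{-\lambda_n s}$ for which there is a (unique) $f\in H_\infty^\lambda(G)$ with $a_n=\widehat f(h_{\lambda_n})$ for all $n$, with norm $\|f\|_{L_\infty(G)}$ (this does not depend on the choice of $(G,\beta)$). $\mathcal{H}_{\infty,+}(\lambda)$ is the space of all $\lambda$-Dirichlet series $D$ with $D_\sigma\in\mathcal{H}_\infty(\lambda)$ for all $\sigma>0$, with the topology given by the norms $\|D_{1/k}\|_{\mathcal{H}_\infty(\lambda)}$, $k\in\mathbb{N}$. The canonical inclusion $\mathcal{D}_{\infty,+}(\lambda)\hookrightarrow\mathcal{H}_{\infty,+}(\lambda)$ is the identity on formal series and is continuous; equality means equality of these locally convex spaces of formal $\lambda$-Dirichlet series. *)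

theory Defs
  imports "HOL-Probability.Probability" "HOL-Complex_Analysis.Complex_Analysis"
begin

section \<open>Dirichlet series\<close>

text \<open>
  Frequencies and coefficient sequences are indexed from 0 instead of 1. A formal
  Dirichlet series over a frequency \<open>lam\<close> is identified with its coefficient sequence
  \<open>a :: nat \<Rightarrow> complex\<close>, so spaces of formal series are subsets of \<open>nat \<Rightarrow> complex\<close>.
\<close>

definition frequency :: "(nat \<Rightarrow> real) \<Rightarrow> bool" where
  "frequency lam \<longleftrightarrow> strict_mono lam \<and> (\<forall>n. 0 \<le> lam n) \<and> \<not> bdd_above (range lam)"

definition dterm :: "(nat \<Rightarrow> real) \<Rightarrow> (nat \<Rightarrow> complex) \<Rightarrow> complex \<Rightarrow> nat \<Rightarrow> complex" where
  "dterm lam a s n = a n * exp (- (of_real (lam n) * s))"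

definition dconv :: "(nat \<Rightarrow> real) \<Rightarrow> (nat \<Rightarrow> complex) \<Rightarrow> complex \<Rightarrow> bool" where
  "dconv lam a s \<longleftrightarrow> summable (dterm lam a s)"

definition dlim :: "(nat \<Rightarrow> real) \<Rightarrow> (nat \<Rightarrow> complex) \<Rightarrow> complex \<Rightarrow> complex" where
  "dlim lam a s = (\<Sum>n. dterm lam a s n)"

definition dshift :: "(nat \<Rightarrow> real) \<Rightarrow> real \<Rightarrow> (nat \<Rightarrow> complex) \<Rightarrow> nat \<Rightarrow> complex" where
  "dshift lam \<sigma> a = (\<lambda>n. a n * of_real (exp (- (lam n * \<sigma>))))"

abbreviation halfplane :: "real \<Rightarrow> complex set" where
  "halfplane \<sigma> \<equiv> {s. \<sigma> < Re s}"

text \<open>The infimum is taken in the extended reals, so that the empty set gives \<open>\<infinity>\<close>.\<close>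

definition sigma_u :: "(nat \<Rightarrow> real) \<Rightarrow> (nat \<Rightarrow> complex) \<Rightarrow> ereal" where
  "sigma_u lam a = Inf (ereal ` {\<sigma>. uniformly_convergent_on (halfplane \<sigma>)
                                    (\<lambda>N s. \<Sum>n<N. dterm lam a s n)})"

text \<open>
  The function \<open>F\<close> below extends the limit function of the series: it agrees with the sum
  at every point of the right half-plane at which the series converges.
\<close>

definition bohr_theorem_holds :: "(nat \<Rightarrow> real) \<Rightarrow> bool" where
  "bohr_theorem_holds lam \<longleftrightarrow>
     (\<forall>a. (\<exists>s. dconv lam a s) \<and>
          (\<exists>F. F holomorphic_on halfplane 0 \<and> bounded (F ` halfplane 0) \<and>
               (\<forall>s\<in>halfplane 0. dconv lam a s \<longrightarrow> F s = dlim lam a s))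
        \<longrightarrow> sigma_u lam a \<le> 0)"


section \<open>Spaces of series as topological spaces\<close>

text \<open>
  The topology on \<open>V\<close> induced by a sequence of (semi)norms, with the seminorm balls as a
  subbase. Its topspace is \<open>V\<close>; the linear structure is the one of \<open>nat \<Rightarrow> complex\<close>. Hence
  two of these topologies are equal iff the underlying locally convex spaces of series
  coincide, both as sets and topologically.
\<close>

definition seminorm_topology ::
    "(nat \<Rightarrow> complex) set \<Rightarrow> (nat \<Rightarrow> (nat \<Rightarrow> complex) \<Rightarrow> real) \<Rightarrow> (nat \<Rightarrow> complex) topology" where
  "seminorm_topology V p =
     topology_generated_by {{b\<in>V. p k (\<lambda>n. b n - a n) < e} | a k e. a \<in> V \<and> 0 < e}"

lemma topspace_seminorm_topology:
  assumes "\<And>k. p k (\<lambda>n. 0) = 0"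
  shows "topspace (seminorm_topology V p) = V"
proof -
  have "a \<in> \<Union> {{b\<in>V. p k (\<lambda>n. b n - a n) < e} | a k e. a \<in> V \<and> 0 < e}" if "a \<in> V" for a
  proof -
    have "a \<in> {b\<in>V. p 0 (\<lambda>n. b n - a n) < 1}"
      using that assms[of 0] by simp
    then show ?thesis
      using that zero_less_one by blast
  qed
  then show ?thesis
    unfolding seminorm_topology_def topology_generated_by_topspace by auto
qed

definition Dinf_plus_set :: "(nat \<Rightarrow> real) \<Rightarrow> (nat \<Rightarrow> complex) set" where
  "Dinf_plus_set lam = {a. (\<forall>s\<in>halfplane 0. dconv lam a s) \<and>
                           (\<forall>\<sigma>>0. bounded (dlim lam a ` halfplane \<sigma>))}"

definition Dinf_plus_norm :: "(nat \<Rightarrow> real) \<Rightarrow> nat \<Rightarrow> (nat \<Rightarrow> complex) \<Rightarrow> real" where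
  "Dinf_plus_norm lam k a = (SUP s\<in>halfplane (1 / real (Suc k)). norm (dlim lam a s))"

definition Dinf_plus :: "(nat \<Rightarrow> real) \<Rightarrow> (nat \<Rightarrow> complex) topology" where
  "Dinf_plus lam = seminorm_topology (Dinf_plus_set lam) (Dinf_plus_norm lam)"


section \<open>Dirichlet groups\<close>

text \<open>
  Compact abelian groups are written additively, as Hausdorff topological groups given by
  a type; compactness is part of \<open>dirichlet_group\<close>.
\<close>

definition group_character :: "('g::topological_ab_group_add \<Rightarrow> complex) \<Rightarrow> bool" where
  "group_character h \<longleftrightarrow> continuous_on UNIV h \<and> (\<forall>x. norm (h x) = 1) \<and>
                         (\<forall>x y. h (x + y) = h x * h y)"

definition represents_freq ::
    "(real \<Rightarrow> 'g::topological_ab_group_add) \<Rightarrow> real \<Rightarrow> ('g \<Rightarrow> complex) \<Rightarrow> bool" where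
  "represents_freq \<beta> x h \<longleftrightarrow> group_character h \<and> (\<forall>t. h (\<beta> t) = exp (- (\<i> * of_real (x * t))))"

definition dirichlet_group ::
    "(nat \<Rightarrow> real) \<Rightarrow> (real \<Rightarrow> 'g::{topological_ab_group_add, t2_space}) \<Rightarrow> bool" where
  "dirichlet_group lam \<beta> \<longleftrightarrow>
     compact (UNIV :: 'g set) \<and>
     continuous_on UNIV \<beta> \<and> (\<forall>s t. \<beta> (s + t) = \<beta> s + \<beta> t) \<and> closure (range \<beta>) = UNIV \<and>
     (\<forall>n. \<exists>h. represents_freq \<beta> (lam n) h)"

text \<open>
  The character \<open>h\<^sub>x\<close>; it is unique if it exists because \<open>\<beta>\<close> has dense range.
\<close>

definition freq_character ::
    "(real \<Rightarrow> 'g::topological_ab_group_add) \<Rightarrow> real \<Rightarrow> 'g \<Rightarrow> complex" where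
  "freq_character \<beta> x = (THE h. represents_freq \<beta> x h)"

lemma freq_character_represents:
  fixes \<beta> :: "real \<Rightarrow> 'g::{topological_ab_group_add, t2_space}"
  assumes "dirichlet_group lam \<beta>"
  shows "represents_freq \<beta> (lam n) (freq_character \<beta> (lam n))"
proof -
  obtain h where h: "represents_freq \<beta> (lam n) h"
    using assms unfolding dirichlet_group_def by blast
  have "h' = h" if h': "represents_freq \<beta> (lam n) h'" for h'
  proof -
    have "closed {x. h' x = h x}"
      using h h' unfolding represents_freq_def group_character_def
      by (intro closed_Collect_eq) auto
    moreover have "range \<beta> \<subseteq> {x. h' x = h x}"
      using h h' unfolding represents_freq_def by auto
    ultimately have "closure (range \<beta>) \<subseteq> {x. h' x = h x}"
      by (rule closure_minimal[rotated])
    then show ?thesis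
      using assms unfolding dirichlet_group_def by auto
  qed
  with h show ?thesis
    unfolding freq_character_def by (rule theI)
qed

text \<open>
  The normalised Haar measure, as the (unique) translation invariant Radon probability
  measure on the Borel sets. The regularity condition is needed for uniqueness, because
  the group may fail to be metrizable (as the Bohr compactification does).
\<close>

definition haar_measure :: "'g::{topological_ab_group_add, t2_space} measure \<Rightarrow> bool" where
  "haar_measure \<mu> \<longleftrightarrow>
     sets \<mu> = sets borel \<and> prob_space \<mu> \<and>
     (\<forall>x. distr \<mu> \<mu> ((+) x) = \<mu>) \<and>
     (\<forall>A\<in>sets \<mu>. emeasure \<mu> A = (SUP K\<in>{K. compact K \<and> K \<subseteq> A}. emeasure \<mu> K))"

definition Linf :: "'g measure \<Rightarrow> ('g \<Rightarrow> complex) set" where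
  "Linf \<mu> = {f. f \<in> borel_measurable \<mu> \<and> esssup \<mu> (\<lambda>x. ereal (norm (f x))) < \<infinity>}"

definition Linf_norm :: "'g measure \<Rightarrow> ('g \<Rightarrow> complex) \<Rightarrow> real" where
  "Linf_norm \<mu> f = real_of_ereal (esssup \<mu> (\<lambda>x. ereal (norm (f x))))"

definition fourier_coeff :: "'g measure \<Rightarrow> ('g \<Rightarrow> complex) \<Rightarrow> ('g \<Rightarrow> complex) \<Rightarrow> complex" where
  "fourier_coeff \<mu> f h = (LINT x|\<mu>. f x * cnj (h x))"

definition Hinf_group ::
    "(nat \<Rightarrow> real) \<Rightarrow> (real \<Rightarrow> 'g::topological_ab_group_add) \<Rightarrow> 'g measure \<Rightarrow> ('g \<Rightarrow> complex) set"
  where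
  "Hinf_group lam \<beta> \<mu> =
     {f\<in>Linf \<mu>. \<forall>h. group_character h \<and> h \<notin> range (\<lambda>n. freq_character \<beta> (lam n))
                      \<longrightarrow> fourier_coeff \<mu> f h = 0}"

definition series_functions ::
    "(nat \<Rightarrow> real) \<Rightarrow> (real \<Rightarrow> 'g::topological_ab_group_add) \<Rightarrow> 'g measure
      \<Rightarrow> (nat \<Rightarrow> complex) \<Rightarrow> ('g \<Rightarrow> complex) set" where
  "series_functions lam \<beta> \<mu> a =
     {f\<in>Hinf_group lam \<beta> \<mu>. \<forall>n. a n = fourier_coeff \<mu> f (freq_character \<beta> (lam n))}"

definition Hinf_set ::
    "(nat \<Rightarrow> real) \<Rightarrow> (real \<Rightarrow> 'g::topological_ab_group_add) \<Rightarrow> 'g measure \<Rightarrow> (nat \<Rightarrow> complex) set"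
  where
  "Hinf_set lam \<beta> \<mu> = {a. series_functions lam \<beta> \<mu> a \<noteq> {}}"

text \<open>
  The functions in \<open>series_functions lam \<beta> \<mu> a\<close> have the same Fourier coefficients, so
  they are the representatives of a single element of \<open>L\<^sub>\<infinity>\<close>. They all have the same norm,
  and the infimum is over a singleton.
\<close>

definition Hinf_norm ::
    "(nat \<Rightarrow> real) \<Rightarrow> (real \<Rightarrow> 'g::topological_ab_group_add) \<Rightarrow> 'g measure
      \<Rightarrow> (nat \<Rightarrow> complex) \<Rightarrow> real" where
  "Hinf_norm lam \<beta> \<mu> a = (INF f\<in>series_functions lam \<beta> \<mu> a. Linf_norm \<mu> f)"

definition Hinf_plus_set ::
    "(nat \<Rightarrow> real) \<Rightarrow> (real \<Rightarrow> 'g::topological_ab_group_add) \<Rightarrow> 'g measure \<Rightarrow> (nat \<Rightarrow> complex) set"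
  where
  "Hinf_plus_set lam \<beta> \<mu> = {a. \<forall>\<sigma>>0. dshift lam \<sigma> a \<in> Hinf_set lam \<beta> \<mu>}"

definition Hinf_plus_norm ::
    "(nat \<Rightarrow> real) \<Rightarrow> (real \<Rightarrow> 'g::topological_ab_group_add) \<Rightarrow> 'g measure
      \<Rightarrow> nat \<Rightarrow> (nat \<Rightarrow> complex) \<Rightarrow> real" where
  "Hinf_plus_norm lam \<beta> \<mu> k a = Hinf_norm lam \<beta> \<mu> (dshift lam (1 / real (Suc k)) a)"

definition Hinf_plus ::
    "(nat \<Rightarrow> real) \<Rightarrow> (real \<Rightarrow> 'g::topological_ab_group_add) \<Rightarrow> 'g measure
      \<Rightarrow> (nat \<Rightarrow> complex) topology" where
  "Hinf_plus lam \<beta> \<mu> = seminorm_topology (Hinf_plus_set lam \<beta> \<mu>) (Hinf_plus_norm lam \<beta> \<mu>)"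

lemma topspace_Dinf_plus: "topspace (Dinf_plus lam) = Dinf_plus_set lam"
proof -
  have "Complex (c + 1) 0 \<in> halfplane c" for c
    by simp
  then have "halfplane c \<noteq> {}" for c
    by blast
  then show ?thesis
    unfolding Dinf_plus_def
    by (intro topspace_seminorm_topology) (simp add: Dinf_plus_norm_def dlim_def dterm_def)
qed

lemma topspace_Hinf_plus:
  assumes "haar_measure \<mu>"
  shows "topspace (Hinf_plus lam \<beta> \<mu>) = Hinf_plus_set lam \<beta> \<mu>"
proof -
  interpret prob_space \<mu>
    using assms by (simp add: haar_measure_def)
  have nz: "emeasure \<mu> (space \<mu>) \<noteq> 0"
    by (simp add: emeasure_space_1)
  have 0: "esssup \<mu> (\<lambda>x. ereal (norm (0::complex))) = 0"
    using esssup_const[OF nz] by (simp add: zero_ereal_def)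
  have zero: "(\<lambda>x. 0) \<in> series_functions lam \<beta> \<mu> (\<lambda>n. 0)"
    using 0 by (simp add: series_functions_def Hinf_group_def Linf_def fourier_coeff_def)
  have ge: "0 \<le> Linf_norm \<mu> f" for f
  proof -
    have "esssup \<mu> (\<lambda>x. 0::ereal) \<le> esssup \<mu> (\<lambda>x. ereal (norm (f x)))"
      by (rule esssup_mono) auto
    then show ?thesis
      using esssup_const[OF nz, of "0::ereal"] by (simp add: Linf_norm_def real_of_ereal_pos)
  qed
  have "Hinf_norm lam \<beta> \<mu> (\<lambda>n. 0) = 0"
  proof (rule antisym)
    have "Hinf_norm lam \<beta> \<mu> (\<lambda>n. 0) \<le> Linf_norm \<mu> (\<lambda>x. 0)"
      unfolding Hinf_norm_def by (rule cINF_lower[OF _ zero]) (rule bdd_belowI2[OF ge])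
    then show "Hinf_norm lam \<beta> \<mu> (\<lambda>n. 0) \<le> 0"
      using 0 by (simp add: Linf_norm_def)
    show "0 \<le> Hinf_norm lam \<beta> \<mu> (\<lambda>n. 0)"
      unfolding Hinf_norm_def by (rule cINF_greatest) (use zero ge in auto)
  qed
  then show ?thesis
    unfolding Hinf_plus_def
    by (intro topspace_seminorm_topology) (simp add: Hinf_plus_norm_def dshift_def)
qed

end

theory Submission
  imports Defs
begin

text \<open>
  Both properties are equivalent to a third one, \<open>partial_sums_bounded\<close>: for every
  \<open>\<sigma> > 0\<close> there is a constant \<open>C\<close> such that every partial sum at
  \<open>\<sigma>\<close> of a Dirichlet polynomial is at most \<open>C\<close> times the supremum
  of the polynomial on the imaginary axis.

  Suppose that this property fails. Since the first terms of a polynomial can be removed at a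
  fixed cost, there are polynomials of high frequency, bounded by \<open>1\<close>, with large
  partial sums at \<open>\<sigma>\<close>. Suitable multiples of them can be strung together to a
  single series (\<open>gliding_hump\<close>) that converges at \<open>\<sigma> + 1\<close> and
  diverges at \<open>\<sigma>\<close>, while its sums over complete blocks converge uniformly on
  the closed right half-plane. The uniform limit is a bounded holomorphic extension of the limit
  function, so Bohr's theorem fails; and it comes from a continuous function on the group, so the
  series lies in \<open>Hinf_plus_set\<close> but not in \<open>Dinf_plus_set\<close>.

  Suppose now that partial sums are bounded. A series is called approximable with bound
  \<open>M\<close> (\<open>poly_approx\<close>) if its coefficients are limits of the coefficients
  of Dirichlet polynomials that are bounded by \<open>M\<close> on the imaginary axis. Then the
  bounds on partial sums pass to the series, which therefore converges uniformly on every
  half-plane \<open>Re s > \<sigma>\<close> with \<open>\<sigma> > 0\<close>, to a function that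
  is bounded by the same \<open>M\<close>. Two kinds of series are approximable. If the series
  converges somewhere and its limit function extends to a holomorphic function bounded by
  \<open>M\<close>, then averages of the extension along vertical lines against a kernel with
  compactly supported Fourier transform are such polynomials
  (\<open>bounded_extension_imp_poly_approx\<close>). This gives Bohr's theorem. If the series
  consists of the Fourier coefficients of a function in \<open>L\<^sub>\<infinity>\<close> of the
  group, then its convolutions with non-negative trigonometric polynomials of mean
  \<open>1\<close> are such polynomials (\<open>series_function_imp_poly_approx\<close>). This
  gives the inclusion of \<open>Hinf_plus_set\<close> in \<open>Dinf_plus_set\<close> and one
  inequality between the norms. For the opposite inclusion and inequality, uniform convergence on
  \<open>Re s \<ge> \<sigma>\<close> turns the restriction of a limit function to the line
  \<open>Re s = \<sigma>\<close> into a continuous function on the group. Hence the spaces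
  coincide and all the norms agree.
\<close>

section \<open>Dirichlet polynomials and partial sums\<close>

text \<open>
  The same function serves as the \<open>N\<close>-th partial sum of a formal series and as a
  general Dirichlet polynomial, for which only the first \<open>N\<close> coefficients matter.
\<close>

definition dpoly :: "(nat \<Rightarrow> real) \<Rightarrow> (nat \<Rightarrow> complex) \<Rightarrow> nat \<Rightarrow> complex \<Rightarrow> complex" where
  "dpoly lam a N s = (\<Sum>n<N. dterm lam a s n)"

lemma frequency_mono: "frequency lam \<Longrightarrow> m \<le> n \<Longrightarrow> lam m \<le> lam n"
  by (simp add: frequency_def strict_mono_less_eq)

lemma frequency_nonneg: "frequency lam \<Longrightarrow> 0 \<le> lam n"
  by (simp add: frequency_def)

lemma frequency_at_top:
  assumes "frequency lam"
  shows "filterlim lam at_top sequentially"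
  unfolding filterlim_at_top eventually_sequentially
proof
  fix Z :: real
  obtain n where "Z \<le> lam n"
    using assms unfolding frequency_def bdd_above_def by (metis linear rangeE)
  then show "\<exists>N. \<forall>n\<ge>N. Z \<le> lam n"
    using frequency_mono[OF assms] by (meson order_trans)
qed

lemma exp_frequency_tendsto_0:
  assumes "frequency lam" "0 < d"
  shows "(\<lambda>n. exp (- (d * lam n))) \<longlonglongrightarrow> 0"
  using assms(2)
  by (intro filterlim_compose[OF exp_at_bot] filterlim_compose[OF filterlim_uminus_at_bot_at_top]
        filterlim_tendsto_pos_mult_at_top[OF tendsto_const _ frequency_at_top[OF assms(1)]])

lemma dterm_shift: "dterm lam (dshift lam \<sigma> a) s n = dterm lam a (s + of_real \<sigma>) n"
proof -
  have "exp (- (of_real (lam n) * (s + of_real \<sigma>)))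
      = exp (- (of_real (lam n) * s)) * of_real (exp (- (lam n * \<sigma>)))"
    by (simp add: exp_of_real[symmetric] exp_add[symmetric] algebra_simps)
  then show ?thesis by (simp add: dterm_def dshift_def)
qed

lemma dpoly_shift: "dpoly lam (dshift lam \<sigma> a) N s = dpoly lam a N (s + of_real \<sigma>)"
  unfolding dpoly_def dterm_shift ..

lemma dconv_shift: "dconv lam (dshift lam \<sigma> a) s \<longleftrightarrow> dconv lam a (s + of_real \<sigma>)"
proof -
  have "dterm lam (dshift lam \<sigma> a) s = dterm lam a (s + of_real \<sigma>)"
    by (rule ext) (rule dterm_shift)
  then show ?thesis by (simp only: dconv_def)
qed

lemma dlim_shift: "dlim lam (dshift lam \<sigma> a) s = dlim lam a (s + of_real \<sigma>)"
  unfolding dlim_def dterm_shift ..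

lemma dconv_imp_tendsto: "dconv lam a s \<Longrightarrow> (\<lambda>N. dpoly lam a N s) \<longlonglongrightarrow> dlim lam a s"
  unfolding dconv_def dpoly_def dlim_def by (rule summable_LIMSEQ)

lemma dconv_iff_convergent: "dconv lam a s \<longleftrightarrow> convergent (\<lambda>N. dpoly lam a N s)"
  unfolding dconv_def dpoly_def by (rule summable_iff_convergent)

lemma dpoly_diff_eq:
  "m \<le> N \<Longrightarrow> dpoly lam a N s - dpoly lam a m s = (\<Sum>n=m..<N. dterm lam a s n)"
  unfolding dpoly_def lessThan_atLeast0 by (rule sum_diff_nat_ivl) auto

lemma norm_dterm: "norm (dterm lam a s n) = norm (a n) * exp (- (lam n * Re s))"
  by (simp add: dterm_def norm_mult)

lemma dpoly_holomorphic: "(\<lambda>s. dpoly lam a N s) holomorphic_on A"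
  unfolding dpoly_def dterm_def by (intro holomorphic_intros)

lemma dpoly_continuous: "continuous_on A (\<lambda>s. dpoly lam a N s)"
  by (intro holomorphic_on_imp_continuous_on dpoly_holomorphic)

lemma norm_dpoly_le:
  assumes "frequency lam" "0 \<le> Re s"
  shows "norm (dpoly lam a N s) \<le> (\<Sum>n<N. norm (a n))"
  unfolding dpoly_def
proof (rule sum_norm_le)
  fix n
  have "exp (- (lam n * Re s)) \<le> 1"
    using frequency_nonneg[OF assms(1), of n] assms(2) by simp
  then show "norm (dterm lam a s n) \<le> norm (a n)"
    unfolding norm_dterm by (simp add: mult_left_le)
qed

section \<open>Abel summation\<close>

text \<open>
  Summation by parts, with the partial sums of \<open>c\<close> started at the same index
  \<open>m\<close>. This makes the bound usable for tails and for blocks of a series without any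
  loss.
\<close>

lemma abel_summation_bound:
  fixes c w :: "nat \<Rightarrow> complex"
  assumes "m \<le> N" and B: "\<And>k. k \<le> N \<Longrightarrow> norm (\<Sum>n=m..<k. c n) \<le> B"
  shows "norm (\<Sum>n=m..<N. c n * w n) \<le> B * (norm (w N) + (\<Sum>n=m..<N. norm (w n - w (Suc n))))"
proof -
  have *: "(\<Sum>n=m..<k. c n * w n)
      = (\<Sum>n=m..<k. c n) * w k + (\<Sum>n=m..<k. (\<Sum>i=m..<Suc n. c i) * (w n - w (Suc n)))" if "m \<le> k" for k
    using that by (induction k rule: dec_induct) (auto simp: algebra_simps)
  have "norm (\<Sum>n=m..<N. c n * w n) \<le> norm ((\<Sum>n=m..<N. c n) * w N)
      + norm (\<Sum>n=m..<N. (\<Sum>i=m..<Suc n. c i) * (w n - w (Suc n)))"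
    unfolding *[OF assms(1)] by (rule norm_triangle_ineq)
  also have "\<dots> \<le> B * norm (w N) + (\<Sum>n=m..<N. B * norm (w n - w (Suc n)))"
    unfolding norm_mult[of "\<Sum>n=m..<N. c n"]
    by (intro add_mono mult_right_mono B sum_norm_le) (auto simp: norm_mult simp del: sum.op_ivl_Suc intro!: mult_right_mono B)
  finally show ?thesis by (simp add: ring_distribs sum_distrib_left)
qed

text \<open>
  The derivative of \<open>x \<mapsto> exp (- x z)\<close> has modulus \<open>\<bar>z\<bar> exp (-
  x Re z)\<close>, which up to the factor \<open>\<bar>z\<bar> / Re z\<close> is the derivative of
  a real exponential. In this form the increments telescope when they are summed along a
  frequency.
\<close>

lemma exp_increment_bound:
  fixes z :: complex
  assumes "a \<le> b" "0 < Re z"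
  shows "norm (exp (- (of_real a * z)) - exp (- (of_real b * z)))
          \<le> norm z / Re z * (exp (- (a * Re z)) - exp (- (b * Re z)))"
proof (cases "a = b")
  case False
  have "norm (exp (- (of_real b * z)) - exp (- (of_real a * z)))
      \<le> (- (norm z / Re z * exp (- (b * Re z)))) - (- (norm z / Re z * exp (- (a * Re z))))"
  proof (rule differentiable_bound_general[of a b "\<lambda>x. exp (- (of_real x * z))" "\<lambda>x. - (norm z / Re z * exp (- (x * Re z)))"
          "\<lambda>x. - z * exp (- (of_real x * z))" "\<lambda>x. norm z * exp (- (x * Re z))"])
    fix x :: real
    have "((\<lambda>x. exp (- (x * z))) has_field_derivative - z * exp (- (of_real x * z))) (at (of_real x))"
      by (auto intro!: derivative_eq_intros)
    from has_vector_derivative_real_field[OF this]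
    show "((\<lambda>x. exp (- (of_real x * z))) has_vector_derivative - z * exp (- (of_real x * z))) (at x)" .
    show "((\<lambda>x. - (norm z / Re z * exp (- (x * Re z)))) has_vector_derivative norm z * exp (- (x * Re z))) (at x)"
      unfolding has_real_derivative_iff_has_vector_derivative[symmetric]
      using assms(2) by (auto intro!: derivative_eq_intros)
  qed (use assms False in \<open>auto intro!: continuous_intros simp: norm_mult\<close>)
  then show ?thesis by (simp add: norm_minus_commute algebra_simps)
qed auto

text \<open>
  Moving to the right from \<open>s1\<close> multiplies the terms by the weights \<open>exp (- lam
  n (s - s1))\<close>, whose total variation is controlled by the angle under which
  \<open>s\<close> is seen from \<open>s1\<close>. The factor \<open>exp (- lam m Re (s -
  s1))\<close> is what makes a block of high frequencies small once one moves to the right.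
\<close>

lemma dirichlet_abel_bound:
  assumes fr: "frequency lam" and "m \<le> N" and pos: "Re s1 < Re s"
    and B: "\<And>k. k \<le> N \<Longrightarrow> norm (\<Sum>n=m..<k. dterm lam a s1 n) \<le> B"
  shows "norm (\<Sum>n=m..<N. dterm lam a s n)
          \<le> B * (norm (s - s1) / Re (s - s1)) * exp (- (lam m * Re (s - s1)))"
proof -
  define z where "z = s - s1"
  have z: "0 < Re z" using pos by (simp add: z_def)
  define w where "w n = exp (- (of_real (lam n) * z))" for n
  have B0: "0 \<le> B" using B[of 0] by simp
  have "dterm lam a s n = dterm lam a s1 n * w n" for n
    by (simp add: dterm_def w_def z_def exp_add[symmetric] algebra_simps)
  then have "norm (\<Sum>n=m..<N. dterm lam a s n)
      \<le> B * (norm (w N) + (\<Sum>n=m..<N. norm (w n - w (Suc n))))"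
    using abel_summation_bound[OF assms(2) B, of w] by simp
  also have "\<dots> \<le> B * (norm z / Re z * exp (- (lam N * Re z))
      + (\<Sum>n=m..<N. norm z / Re z * (exp (- (lam n * Re z)) - exp (- (lam (Suc n) * Re z)))))"
  proof (intro mult_left_mono[OF _ B0] add_mono sum_mono)
    have "Re z \<le> norm z" by (rule complex_Re_le_cmod)
    then have "1 \<le> norm z / Re z" using z by simp
    then have "1 * exp (- (lam N * Re z)) \<le> norm z / Re z * exp (- (lam N * Re z))"
      by (rule mult_right_mono) simp
    then show "norm (w N) \<le> norm z / Re z * exp (- (lam N * Re z))"
      by (simp add: w_def)
    show "norm (w n - w (Suc n)) \<le> norm z / Re z * (exp (- (lam n * Re z)) - exp (- (lam (Suc n) * Re z)))" for n
      unfolding w_def by (rule exp_increment_bound[OF frequency_mono[OF fr] z]) simp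
  qed
  also have "(\<Sum>n=m..<N. norm z / Re z * (exp (- (lam n * Re z)) - exp (- (lam (Suc n) * Re z))))
      = norm z / Re z * (exp (- (lam m * Re z)) - exp (- (lam N * Re z)))"
    unfolding sum_distrib_left[symmetric] using sum_Suc_diff'[OF assms(2), of "\<lambda>n. - exp (- (lam n * Re z))"]
    by simp
  finally show ?thesis by (simp add: z_def[symmetric] algebra_simps)
qed

text \<open>
  For a translation by a real number the angular factor is \<open>1\<close>.
\<close>

lemma dirichlet_abel_bound_horizontal:
  assumes fr: "frequency lam" and "m \<le> N" and pos: "0 \<le> d"
    and B: "\<And>k. k \<le> N \<Longrightarrow> norm (\<Sum>n=m..<k. dterm lam a s n) \<le> B"
  shows "norm (\<Sum>n=m..<N. dterm lam a (s + of_real d) n) \<le> B * exp (- (lam m * d))"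
proof (cases "d = 0")
  case True then show ?thesis using B[of N] by simp
next
  case False
  then show ?thesis using dirichlet_abel_bound[of lam m N s "s + of_real d" a B] fr assms(2) B pos by simp
qed

text \<open>
  On a small disc to the right of a point of convergence the angular factor of the Abel bound is
  bounded, so convergence is locally uniform there.
\<close>

lemma dlim_holomorphic:
  assumes fr: "frequency lam" and conv: "dconv lam a s1"
  shows "dlim lam a holomorphic_on halfplane (Re s1)"
    and "\<And>s. Re s1 < Re s \<Longrightarrow> dconv lam a s"
proof -
  have cau: "\<exists>m. \<forall>N\<ge>m. norm (\<Sum>n=m..<N. dterm lam a s1 n) \<le> e" if "0 < e" for e
  proof -
    have "Cauchy (\<lambda>N. dpoly lam a N s1)"
      using conv unfolding dconv_iff_convergent by (rule convergent_Cauchy)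
    then obtain m where "\<forall>i\<ge>m. \<forall>j\<ge>m. norm (dpoly lam a i s1 - dpoly lam a j s1) < e"
      using \<open>0 < e\<close> unfolding Cauchy_iff by blast
    then show ?thesis by (intro exI[of _ m]) (auto simp: dpoly_diff_eq[symmetric] less_imp_le)
  qed
  have unif: "uniformly_convergent_on (cball x d) (\<lambda>N s. dpoly lam a N s)"
    if d: "0 < d" "Re s1 < Re x - d" for x d
    unfolding uniformly_convergent_eq_Cauchy uniformly_Cauchy_on_def
  proof (intro allI impI)
    fix e :: real assume e: "0 < e"
    define K where "K = (norm (x - s1) + d) / (Re x - d - Re s1)"
    have K: "0 < K" using d unfolding K_def by (intro divide_pos_pos add_nonneg_pos) auto
    obtain m where m: "\<And>N. m \<le> N \<Longrightarrow> norm (\<Sum>n=m..<N. dterm lam a s1 n) \<le> e / (4 * K)"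
      using cau[of "e / (4 * K)"] e K by auto
    have m': "norm (\<Sum>n=m..<N. dterm lam a s1 n) \<le> e / (4 * K)" for N
      using m[of N] e K by (cases "m \<le> N") (auto simp: not_le)
    have *: "norm (dpoly lam a N s - dpoly lam a m s) \<le> e / 4" if "m \<le> N" "s \<in> cball x d" for N s
    proof -
      have ns: "norm (s - x) \<le> d" using that(2) by (simp add: dist_norm norm_minus_commute)
      then have "\<bar>Re (s - x)\<bar> \<le> d" using abs_Re_le_cmod order_trans by blast
      then have re: "Re x - d - Re s1 \<le> Re (s - s1)" by simp
      have nn: "norm (s - s1) \<le> norm (x - s1) + d"
        using norm_triangle_ineq[of "s - x" "x - s1"] ns by simp
      have "norm (s - s1) / Re (s - s1) * exp (- (lam m * Re (s - s1))) \<le> K * 1"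
        unfolding K_def using re nn d frequency_nonneg[OF fr, of m]
        by (intro mult_mono frac_le) auto
      then have "e / (4 * K) * (norm (s - s1) / Re (s - s1) * exp (- (lam m * Re (s - s1)))) \<le> e / (4 * K) * (K * 1)"
        using e K by (intro mult_left_mono) auto
      moreover have "norm (\<Sum>n=m..<N. dterm lam a s n)
          \<le> e / (4 * K) * (norm (s - s1) / Re (s - s1)) * exp (- (lam m * Re (s - s1)))"
        by (rule dirichlet_abel_bound[OF fr that(1) _ m']) (use re d in auto)
      moreover have "e / (4 * K) * (K * 1) = e / 4" using K by simp
      ultimately show ?thesis unfolding dpoly_diff_eq[OF that(1)] mult.assoc by linarith
    qed
    show "\<exists>M. \<forall>s\<in>cball x d. \<forall>m\<ge>M. \<forall>n\<ge>M. dist (dpoly lam a m s) (dpoly lam a n s) < e"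
    proof (intro exI ballI allI impI)
      fix s i j assume s: "s \<in> cball x d" and ij: "m \<le> i" "m \<le> j"
      have "dist (dpoly lam a i s) (dpoly lam a j s)
          \<le> dist (dpoly lam a i s) (dpoly lam a m s) + dist (dpoly lam a j s) (dpoly lam a m s)"
        by (rule dist_triangle2)
      also have "\<dots> \<le> e / 4 + e / 4" using *[OF ij(1) s] *[OF ij(2) s] by (simp add: dist_norm)
      finally show "dist (dpoly lam a i s) (dpoly lam a j s) < e" using e by simp
    qed
  qed
  have ex: "\<exists>d>0. cball x d \<subseteq> halfplane (Re s1) \<and> uniformly_convergent_on (cball x d) (\<lambda>N s. dpoly lam a N s)"
    if x: "Re s1 < Re x" for x
  proof -
    define d where "d = (Re x - Re s1) / 2"
    have d: "0 < d" "Re s1 < Re x - d" using x by (auto simp: d_def field_simps)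
    have "Re s1 < Re s" if "s \<in> cball x d" for s
    proof -
      have "\<bar>Re (s - x)\<bar> \<le> d"
        using that abs_Re_le_cmod[of "s - x"] by (simp add: dist_norm norm_minus_commute)
      then show ?thesis using d by simp
    qed
    then show ?thesis using d unif[OF d] by blast
  qed
  show conv': "dconv lam a s" if s: "Re s1 < Re s" for s
  proof -
    obtain d where d: "0 < d" "uniformly_convergent_on (cball s d) (\<lambda>N s. dpoly lam a N s)"
      using ex[OF s] by blast
    then obtain l where "uniform_limit (cball s d) (\<lambda>N s. dpoly lam a N s) l sequentially"
      unfolding uniformly_convergent_on_def by blast
    then have "(\<lambda>N. dpoly lam a N s) \<longlonglongrightarrow> l s"
      using d by (intro tendsto_uniform_limitI) auto
    then show ?thesis unfolding dconv_iff_convergent convergent_def by blast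
  qed
  show "dlim lam a holomorphic_on halfplane (Re s1)"
  proof (rule holomorphic_uniform_sequence[where f = "\<lambda>N s. dpoly lam a N s"])
    show "open (halfplane (Re s1))" by (rule open_halfspace_Re_gt)
    fix x assume "x \<in> halfplane (Re s1)"
    then obtain d where d: "0 < d" "cball x d \<subseteq> halfplane (Re s1)"
        "uniformly_convergent_on (cball x d) (\<lambda>N s. dpoly lam a N s)" using ex by blast
    obtain l where l: "uniform_limit (cball x d) (\<lambda>N s. dpoly lam a N s) l sequentially"
      using d(3) unfolding uniformly_convergent_on_def by blast
    have "l s = dlim lam a s" if s: "s \<in> cball x d" for s
      using LIMSEQ_unique[OF tendsto_uniform_limitI[OF l s] dconv_imp_tendsto[OF conv']] s d(2) by blast
    then have "uniform_limit (cball x d) (\<lambda>N s. dpoly lam a N s) (dlim lam a) sequentially"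
      using l by (subst uniform_limit_cong'[where g = "\<lambda>N s. dpoly lam a N s" and i = l]) auto
    then show "\<exists>d>0. cball x d \<subseteq> halfplane (Re s1) \<and> uniform_limit (cball x d) (\<lambda>N s. dpoly lam a N s) (dlim lam a) sequentially"
      using d by blast
  qed (rule dpoly_holomorphic)
qed

section \<open>A Phragmen--Lindelof bound\<close>

text \<open>
  Dividing \<open>f\<close> by \<open>1 + \<epsilon> s\<close> makes it decay at infinity without
  increasing it on the imaginary axis. The maximum principle on a large half disc then applies,
  and \<open>\<epsilon>\<close> tends to \<open>0\<close>.
\<close>

lemma phragmen_lindelof_halfplane:
  assumes hol: "f holomorphic_on halfplane 0" and cont: "continuous_on {s. 0 \<le> Re s} f"
    and bdd: "\<And>s. 0 \<le> Re s \<Longrightarrow> norm (f s) \<le> B"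
    and M: "\<And>t. norm (f (\<i> * of_real t)) \<le> M"
    and s: "0 \<le> Re s"
  shows "norm (f s) \<le> M"
proof -
  have B0: "0 \<le> B" using order_trans[OF norm_ge_zero bdd[of 0]] by simp
  have key: "norm (f s) \<le> (M + e) * norm (1 + of_real e * s)" if e: "0 < e" for e
  proof -
    \<comment> \<open>At this radius the quotient is at most \<open>e\<close> on the circular part of the boundary.\<close>
    define R where "R = max (norm s) (B / e\<^sup>2) + 1"
    define S where "S = {z. 0 \<le> Re z} \<inter> cball 0 R"
    define g where "g z = f z / (1 + of_real e * z)" for z
    have R: "norm s < R" "B / e\<^sup>2 < R" "0 < R" unfolding R_def using norm_ge_zero[of s] by linarith+
    have den: "1 \<le> norm (1 + of_real e * z)" "e * norm z \<le> norm (1 + of_real e * z)" if "0 \<le> Re z" for z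
    proof -
      have "1 \<le> Re (1 + of_real e * z)" using that e by simp
      then show "1 \<le> norm (1 + of_real e * z)" using complex_Re_le_cmod order_trans by blast
      have "(norm (of_real e * z))\<^sup>2 \<le> (norm (1 + of_real e * z))\<^sup>2"
        unfolding cmod_power2 using that e by (simp add: power2_eq_square algebra_simps)
      then show "e * norm z \<le> norm (1 + of_real e * z)"
        using e by (simp add: norm_mult power2_le_iff_abs_le)
    qed
    have nz: "1 + of_real e * z \<noteq> 0" if "0 \<le> Re z" for z using den(1)[OF that] by auto
    have cS: "closed S" unfolding S_def by (intro closed_Int closed_halfspace_Re_ge closed_cball)
    have "norm (g s) \<le> M + e"
    proof (rule maximum_modulus_frontier[of g S])
      have "interior S \<subseteq> interior {z. 0 \<le> Re z}" unfolding S_def by (intro interior_mono) auto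
      also have "\<dots> = halfplane 0"
        using interior_halfspace_ge[of "1::complex" 0] by (simp add: inner_complex_def)
      finally have "interior S \<subseteq> halfplane 0" .
      then show "g holomorphic_on interior S" unfolding g_def
        by (intro holomorphic_intros holomorphic_on_subset[OF hol]) (use nz in force)+
      have "S \<subseteq> {z. 0 \<le> Re z}" by (auto simp: S_def)
      then show "continuous_on (closure S) g" unfolding g_def closure_closed[OF cS]
        by (intro continuous_intros continuous_on_subset[OF cont]) (use nz in force)+
      show "bounded S" unfolding S_def by (simp add: bounded_Int)
      show "s \<in> S" using R s by (simp add: S_def)
      fix z assume z: "z \<in> frontier S"
      then have zS: "z \<in> S" using cS frontier_subset_eq by blast
      have "z \<notin> halfplane 0 \<inter> ball 0 R"
      proof
        assume "z \<in> halfplane 0 \<inter> ball 0 R"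
        moreover have "halfplane 0 \<inter> ball 0 R \<subseteq> S" by (auto simp: S_def)
        ultimately have "z \<in> interior S"
          by (rule interiorI[OF open_Int[OF open_halfspace_Re_gt open_ball]])
        then show False using z by (simp add: frontier_def)
      qed
      then consider "Re z = 0" | "norm z = R" using zS by (force simp: S_def)
      then show "norm (g z) \<le> M + e"
      proof cases
        case 1
        then have "z = \<i> * of_real (Im z)" by (simp add: complex_eq_iff)
        then have "norm (f z) \<le> M" using M[of "Im z"] by simp
        moreover have "norm (g z) \<le> norm (f z)" using den(1)[of z] 1
          by (simp add: g_def norm_divide divide_le_eq mult_le_cancel_left1)
        ultimately show ?thesis using e by simp
      next
        case 2
        have z0: "0 \<le> Re z" using zS by (simp add: S_def)
        have "norm (g z) \<le> B / (e * R)"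
          unfolding g_def norm_divide using den(2)[OF z0] 2 e R B0 bdd[OF z0]
          by (intro frac_le) auto
        also have "\<dots> \<le> e" using R(2,3) e by (simp add: field_simps power2_eq_square)
        also have "\<dots> \<le> M + e" using order_trans[OF norm_ge_zero M[of 0]] by simp
        finally show ?thesis .
      qed
    qed
    then show ?thesis using nz[OF s] by (simp add: g_def norm_divide field_simps)
  qed
  have "((\<lambda>e. (M + e) * norm (1 + of_real e * s)) \<longlongrightarrow> (M + 0) * norm (1 + of_real 0 * s)) (at_right 0)"
    by (intro tendsto_intros)
  then have "((\<lambda>e. (M + e) * norm (1 + of_real e * s)) \<longlongrightarrow> M) (at_right 0)" by simp
  then show ?thesis
    by (rule tendsto_lowerbound) (auto intro!: eventually_at_right_less[THEN eventually_mono] key)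
qed

lemma dpoly_halfplane_bound:
  assumes "frequency lam" "\<And>t. norm (dpoly lam b L (\<i> * of_real t)) \<le> M" "0 \<le> Re s"
  shows "norm (dpoly lam b L s) \<le> M"
  by (rule phragmen_lindelof_halfplane[OF dpoly_holomorphic dpoly_continuous norm_dpoly_le[OF assms(1)] assms(2,3)])

section \<open>The Jackson kernel\<close>

text \<open>
  The kernel is the normalised fourth power of \<open>sin t / t\<close>. It is non-negative, it is
  the restriction of an entire function of exponential type, so that its Fourier transform has
  compact support, and it still decays fast enough to be integrable against functions of linear
  growth. By non-negativity averages do not increase bounds; partial sums of a Dirichlet series
  grow at most linearly along a vertical line to the right of a point of convergence, and compact
  support turns a series into a polynomial.
\<close>

definition csinc :: "complex \<Rightarrow> complex" where
  "csinc z = (if z = 0 then 1 else sin z / z)"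

definition sinc4 :: "real \<Rightarrow> real" where
  "sinc4 t = (sinc t) ^ 4"

definition jackson :: "real \<Rightarrow> real" where
  "jackson t = sinc4 t / (LINT x|lborel. sinc4 x)"

definition jackson_hat :: "real \<Rightarrow> complex" where
  "jackson_hat u = (LINT t|lborel. of_real (jackson t) * exp (- (\<i> * of_real (u * t))))"

lemma csinc_holomorphic: "csinc holomorphic_on A"
proof -
  have "csinc field_differentiable at z" for z
  proof (cases "z = 0")
    case True
    then show ?thesis
      using has_field_derivative_sin_z_over_z[of "UNIV :: complex set"]
      unfolding csinc_def[abs_def] field_differentiable_def by blast
  next
    case False
    have "(\<lambda>z. sin z / z) holomorphic_on - {0::complex}"
      by (intro holomorphic_intros) auto
    then have "csinc holomorphic_on - {0}"
      by (rule holomorphic_transform) (auto simp: csinc_def)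
    then show ?thesis
      using False by (intro holomorphic_on_imp_differentiable_at) auto
  qed
  then show ?thesis
    by (simp add: holomorphic_on_def field_differentiable_at_within)
qed

lemma csinc_of_real: "csinc (of_real t) = of_real (sinc t)"
  by (simp add: csinc_def sin_of_real)

lemma norm_csinc_le: "norm z * norm (csinc z) \<le> exp \<bar>Im z\<bar>"
  using cmod_sin_le_exp[of 1 z] by (auto simp: csinc_def norm_divide)

lemma sinc4_nonneg: "0 \<le> sinc4 t"
  by (simp add: sinc4_def)

lemma sinc4_measurable [measurable]: "sinc4 \<in> borel_measurable borel"
  unfolding sinc4_def[abs_def] by measurable

lemma sinc4_continuous: "continuous_on A sinc4"
  unfolding sinc4_def[abs_def] by (intro continuous_intros)

lemma sinc4_decay: "(1 + \<bar>t\<bar>) * sinc4 t \<le> 4 * inverse (1 + t\<^sup>2)"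
proof -
  have s1: "\<bar>sinc t\<bar> \<le> 1"
    using abs_sin_x_le_abs_x[of t] by (auto simp: field_simps)
  have pos: "0 < 1 + t\<^sup>2" using zero_le_power2[of t] by linarith
  show ?thesis
  proof (cases "\<bar>t\<bar> \<le> 1")
    case True
    then have t2: "t\<^sup>2 \<le> 1" by (simp add: abs_square_le_1)
    have "sinc4 t = \<bar>sinc t\<bar> ^ 4" by (simp add: sinc4_def power_even_abs)
    also have "\<dots> \<le> 1" using s1 by (intro power_le_one) auto
    finally have "(1 + \<bar>t\<bar>) * sinc4 t \<le> 2 * 1" using True sinc4_nonneg by (intro mult_mono) auto
    moreover have "2 \<le> 4 * inverse (1 + t\<^sup>2)" using t2 pos by (simp add: field_simps)
    ultimately show ?thesis by simp
  next
    case False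
    then have t1: "1 \<le> \<bar>t\<bar>" by simp
    then have "1 \<le> t\<^sup>2" using False abs_square_le_1 by (metis linorder_le_cases)
    have "\<bar>sin t\<bar> ^ 4 \<le> 1" by (intro power_le_one) auto
    then have s: "sinc4 t \<le> 1 / \<bar>t\<bar> ^ 4"
      using t1 by (auto simp: sinc4_def power_divide power_even_abs intro!: divide_right_mono)
    have "(1 + \<bar>t\<bar>) * sinc4 t \<le> (\<bar>t\<bar> + \<bar>t\<bar>) * (1 / \<bar>t\<bar> ^ 4)"
      using t1 s sinc4_nonneg by (intro mult_mono) auto
    also have "\<dots> = 2 / \<bar>t\<bar> ^ 3" using t1 by (simp add: field_simps power_Suc[symmetric] eval_nat_numeral)
    also have "\<dots> \<le> 2 / t\<^sup>2"
    proof -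
      have "\<bar>t\<bar>\<^sup>2 \<le> \<bar>t\<bar> ^ 3" using t1 by (intro power_increasing) auto
      then show ?thesis using t1 by (intro divide_left_mono) auto
    qed
    also have "\<dots> \<le> 4 / (1 + t\<^sup>2)"
      using \<open>1 \<le> t\<^sup>2\<close> pos frac_le[of 4 4 "1 + t\<^sup>2" "2 * t\<^sup>2"] by simp
    also have "\<dots> = 4 * inverse (1 + t\<^sup>2)" by (simp add: divide_inverse)
    finally show ?thesis .
  qed
qed

lemma sinc4_integrable_linear: "integrable lborel (\<lambda>t. (1 + \<bar>t\<bar>) * sinc4 t)"
proof (rule Bochner_Integration.integrable_bound)
  have "integrable lborel (\<lambda>t::real. inverse (1 + t\<^sup>2))"
    using integrable_inverse_1_plus_square by (simp add: set_integrable_def einterval_def)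
  then show "integrable lborel (\<lambda>t::real. 4 * inverse (1 + t\<^sup>2))" by simp
  show "AE t in lborel. norm ((1 + \<bar>t\<bar>) * sinc4 t) \<le> norm (4 * inverse (1 + t\<^sup>2))"
    using sinc4_decay sinc4_nonneg by (auto intro!: AE_I2 simp: abs_mult order_trans[OF _ abs_ge_self])
qed measurable

lemma sinc4_integrable: "integrable lborel sinc4"
proof (rule Bochner_Integration.integrable_bound[OF sinc4_integrable_linear])
  show "AE t in lborel. norm (sinc4 t) \<le> norm ((1 + \<bar>t\<bar>) * sinc4 t)"
  proof (rule AE_I2)
    fix t
    have "1 * \<bar>sinc4 t\<bar> \<le> (1 + \<bar>t\<bar>) * \<bar>sinc4 t\<bar>" by (intro mult_right_mono) auto
    then show "norm (sinc4 t) \<le> norm ((1 + \<bar>t\<bar>) * sinc4 t)" by (simp add: abs_mult)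
  qed
qed measurable

lemma sinc4_mass_pos: "0 < (LINT t|lborel. sinc4 t)"
proof -
  have "(LINT t|lborel. sinc4 t) \<noteq> 0"
  proof
    assume "(LINT t|lborel. sinc4 t) = 0"
    then have "AE t in lborel. sinc4 t = 0"
      using integral_nonneg_eq_0_iff_AE[OF sinc4_integrable] sinc4_nonneg by simp
    then have "AE t in lborel. t \<notin> {0<..<1::real}"
    proof eventually_elim
      case (elim t)
      then have "t \<noteq> 0" "sin t = 0" by (auto simp: sinc4_def split: if_splits)
      then show ?case using sin_gt_zero[of t] pi_gt3 by auto
    qed
    then have "emeasure lborel {0<..<1::real} = 0"
      by (subst (asm) AE_iff_measurable[of "{0<..<1}"]) auto
    then show False by simp
  qed
  then show ?thesis using integral_nonneg_AE[of sinc4 lborel] sinc4_nonneg by (simp add: less_le)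
qed

lemma jackson_nonneg: "0 \<le> jackson t"
  using sinc4_mass_pos by (simp add: jackson_def sinc4_nonneg)

lemma jackson_measurable [measurable]: "jackson \<in> borel_measurable borel"
  unfolding jackson_def[abs_def] by measurable

lemma jackson_continuous: "continuous_on A jackson"
  unfolding jackson_def[abs_def] using sinc4_mass_pos by (intro continuous_intros sinc4_continuous) auto

lemma jackson_integrable_linear: "integrable lborel (\<lambda>t. (1 + \<bar>t\<bar>) * jackson t)"
  unfolding jackson_def using sinc4_integrable_linear by simp

lemma jackson_integrable: "integrable lborel jackson"
  unfolding jackson_def[abs_def] using sinc4_integrable by simp

lemma jackson_integral: "(LINT t|lborel. jackson t) = 1"
  unfolding jackson_def[abs_def] using sinc4_mass_pos by simp

lemma jackson_integrable_mult:
  fixes f :: "real \<Rightarrow> complex"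
  assumes [measurable]: "f \<in> borel_measurable borel" and "\<And>t. norm (f t) \<le> C * (1 + \<bar>t\<bar>)"
  shows "integrable lborel (\<lambda>t. of_real (jackson t) * f t)"
proof (rule Bochner_Integration.integrable_bound)
  show "integrable lborel (\<lambda>t. C * ((1 + \<bar>t\<bar>) * jackson t))"
    by (intro integrable_mult_right jackson_integrable_linear)
  show "AE t in lborel. norm (of_real (jackson t) * f t) \<le> norm (C * ((1 + \<bar>t\<bar>) * jackson t))"
  proof (rule AE_I2)
    fix t
    have "norm (of_real (jackson t) * f t) \<le> jackson t * (C * (1 + \<bar>t\<bar>))"
      using assms(2) jackson_nonneg by (simp add: norm_mult mult_left_mono)
    then show "norm (of_real (jackson t) * f t) \<le> norm (C * ((1 + \<bar>t\<bar>) * jackson t))"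
      by (simp add: mult_ac)
  qed
qed measurable

lemma norm_jackson_integral_le:
  fixes f :: "real \<Rightarrow> complex"
  assumes [measurable]: "f \<in> borel_measurable borel" and M: "\<And>t. norm (f t) \<le> M"
  shows "norm (LINT t|lborel. of_real (jackson t) * f t) \<le> M"
proof -
  have "0 \<le> M" using order_trans[OF norm_ge_zero M[of 0]] .
  have "norm (LINT t|lborel. of_real (jackson t) * f t) \<le> (LINT t|lborel. M * jackson t)"
  proof (rule Bochner_Integration.integral_norm_bound_integral)
    have "M * 1 \<le> M * (1 + \<bar>t\<bar>)" for t using \<open>0 \<le> M\<close> by (intro mult_left_mono) auto
    then show "integrable lborel (\<lambda>t. of_real (jackson t) * f t)"
      using M by (intro jackson_integrable_mult[of _ M]) (auto intro: order_trans)
    show "norm (of_real (jackson t) * f t) \<le> M * jackson t" for t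
      using M[of t] jackson_nonneg[of t] by (simp add: norm_mult mult.commute[of M] mult_left_mono)
  qed (use jackson_integrable in auto)
  then show ?thesis by (simp add: jackson_integral)
qed

lemma jackson_hat_tendsto_1:
  assumes "u \<longlonglongrightarrow> 0"
  shows "(\<lambda>j. jackson_hat (u j)) \<longlonglongrightarrow> 1"
proof -
  have "(\<lambda>j. jackson_hat (u j)) \<longlonglongrightarrow> (LINT t|lborel. complex_of_real (jackson t))"
    unfolding jackson_hat_def
  proof (rule integral_dominated_convergence[where w = jackson])
    show "AE t in lborel. (\<lambda>j. of_real (jackson t) * exp (- (\<i> * of_real (u j * t)))) \<longlonglongrightarrow> complex_of_real (jackson t)"
    proof (rule AE_I2)
      fix t
      have "(\<lambda>j. of_real (jackson t) * exp (- (\<i> * of_real (u j * t))))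
          \<longlonglongrightarrow> complex_of_real (jackson t) * exp (- (\<i> * of_real (0 * t)))"
        by (intro tendsto_intros assms)
      then show "(\<lambda>j. of_real (jackson t) * exp (- (\<i> * of_real (u j * t)))) \<longlonglongrightarrow> complex_of_real (jackson t)"
        by simp
    qed
  qed (use jackson_integrable jackson_nonneg in \<open>auto simp: norm_mult\<close>)
  then show ?thesis by (simp add: jackson_integral)
qed

text \<open>
  For \<open>u \<ge> 4\<close> the factor \<open>exp (\<i> u z)\<close> beats the growth of
  \<open>(sin z)\<^sup>4\<close> in the upper half-plane, so the integrand is
  \<open>O(\<bar>z\<bar>\<^sup>-\<^sup>4)\<close> there and the contour can be closed by a large
  half circle.
\<close>

lemma sinc4_fourier_vanishes:
  assumes u: "4 \<le> u"
  shows "(LINT t|lborel. of_real (sinc4 t) * exp (\<i> * of_real (u * t))) = 0"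
proof -
  define f where "f z = csinc z ^ 4 * exp (\<i> * of_real u * z)" for z
  have hol: "f holomorphic_on A" for A
    unfolding f_def by (intro holomorphic_intros csinc_holomorphic)
  have f_real: "f (of_real t) = of_real (sinc4 t) * exp (\<i> * of_real (u * t))" for t
    by (simp add: f_def csinc_of_real sinc4_def mult.assoc)
  have bound: "norm (f z) \<le> 1 / norm z ^ 4" if "0 \<le> Im z" "z \<noteq> 0" for z
  proof -
    have "norm z ^ 4 * norm (f z) = (norm z * norm (csinc z)) ^ 4 * exp (- (u * Im z))"
      by (simp add: f_def norm_mult norm_power power_mult_distrib)
    also have "\<dots> \<le> exp \<bar>Im z\<bar> ^ 4 * exp (- (u * Im z))"
      by (intro mult_right_mono power_mono norm_csinc_le) auto
    also have "\<dots> = exp (4 * Im z - u * Im z)"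
      using that by (simp add: exp_of_nat_mult[symmetric] exp_add[symmetric])
    also have "\<dots> \<le> 1" using that u by (simp add: mult_right_mono)
    finally show ?thesis using that by (simp add: field_simps)
  qed
  have int: "integrable lborel (\<lambda>t. f (of_real t))"
  proof (rule Bochner_Integration.integrable_bound[OF sinc4_integrable])
    show "(\<lambda>t. f (of_real t)) \<in> borel_measurable lborel"
      unfolding f_real by measurable
    show "AE t in lborel. norm (f (of_real t)) \<le> norm (sinc4 t)"
      unfolding f_real by (simp add: norm_mult)
  qed
  have arc: "norm (LINT t:{- R..R}|lborel. f (of_real t)) \<le> pi / R ^ 3" if R: "0 < R" for R :: real
  proof -
    have cont: "continuous_on A f" for A by (rule holomorphic_on_imp_continuous_on[OF hol])
    define g where "g = linepath (of_real (- R)) (of_real R) +++ part_circlepath 0 R 0 pi"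
    have "(f has_contour_integral 0) g"
    proof (rule Cauchy_theorem_convex_simple[OF hol convex_UNIV])
      show "valid_path g" unfolding g_def using R by (intro valid_path_join) auto
      show "pathfinish g = pathstart g" unfolding g_def by (simp add: exp_pi_i')
    qed auto
    then have "contour_integral g f = 0" by (rule contour_integral_unique)
    moreover have c1: "f contour_integrable_on linepath (of_real (- R)) (of_real R)"
      by (rule contour_integrable_continuous_linepath[OF cont])
    moreover have c2: "f contour_integrable_on part_circlepath 0 R 0 pi"
      by (rule contour_integrable_continuous_part_circlepath[OF cont])
    ultimately have "contour_integral (linepath (of_real (- R)) (of_real R)) f
        = - contour_integral (part_circlepath 0 R 0 pi) f"
      unfolding g_def by (simp add: add_eq_0_iff2)
    moreover have "norm (contour_integral (part_circlepath 0 R 0 pi) f) \<le> 1 / R ^ 4 * R * \<bar>pi - 0\<bar>"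
    proof (rule contour_integral_bound_part_circlepath[OF c2])
      fix z assume "z \<in> path_image (part_circlepath 0 R 0 pi)"
      then obtain x where x: "0 \<le> x" "x \<le> pi" "z = of_real R * exp (\<i> * of_real x)"
        by (auto simp: path_image_part_circlepath)
      then have "norm z = R" "0 \<le> Im z"
        using R sin_ge_zero[of x] by (auto simp: norm_mult Im_exp)
      then show "norm (f z) \<le> 1 / R ^ 4" using bound[of z] R by auto
    qed (use R in auto)
    moreover have "1 / R ^ 4 * R * \<bar>pi - 0\<bar> = pi / R ^ 3"
      using R by (simp add: field_simps eval_nat_numeral)
    moreover have "contour_integral (linepath (of_real (- R)) (of_real R)) f
        = integral {- R..R} (\<lambda>t. f (of_real t))"
      using contour_integral_linepath_Reals_eq[of "of_real (- R)" "of_real R" f] R by simp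
    moreover have "set_integrable lborel {- R..R} (\<lambda>t. f (of_real t))"
      unfolding set_integrable_def by (intro integrable_mult_indicator int) auto
    ultimately show ?thesis
      unfolding set_borel_integral_eq_integral(2)[OF \<open>set_integrable _ _ _\<close>] by (metis norm_minus_cancel)
  qed
  have "(\<lambda>n. LINT t:{- real n..real n}|lborel. f (of_real t)) \<longlonglongrightarrow> (LINT t|lborel. f (of_real t))"
    unfolding set_lebesgue_integral_def
  proof (rule integral_dominated_convergence[where w = "\<lambda>t. norm (f (of_real t))"])
    show "AE t in lborel. (\<lambda>n. indicator {- real n..real n} t *\<^sub>R f (of_real t)) \<longlonglongrightarrow> f (of_real t)"
    proof (rule AE_I2)
      fix t :: real
      obtain k where "\<bar>t\<bar> \<le> real k" using real_arch_simple by blast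
      then have "\<forall>\<^sub>F n in sequentially. indicator {- real n..real n} t *\<^sub>R f (of_real t) = f (of_real t)"
        by (intro eventually_sequentiallyI[of k]) (auto simp: indicator_def)
      then show "(\<lambda>n. indicator {- real n..real n} t *\<^sub>R f (of_real t)) \<longlonglongrightarrow> f (of_real t)"
        by (rule tendsto_eventually)
    qed
  qed (use int in \<open>auto simp: indicator_def intro!: AE_I2\<close>)
  moreover have "(\<lambda>n. LINT t:{- real n..real n}|lborel. f (of_real t)) \<longlonglongrightarrow> 0"
  proof (rule Lim_null_comparison)
    show "\<forall>\<^sub>F n in sequentially. norm (LINT t:{- real n..real n}|lborel. f (of_real t)) \<le> pi / real n ^ 3"
      using arc by (intro eventually_sequentiallyI[of 1]) auto
    show "(\<lambda>n. pi / real n ^ 3) \<longlonglongrightarrow> 0" by real_asymp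
  qed
  ultimately have "(LINT t|lborel. f (of_real t)) = 0" by (rule LIMSEQ_unique)
  then show ?thesis unfolding f_real .
qed

lemma jackson_hat_vanishes:
  assumes "4 \<le> \<bar>u\<bar>"
  shows "jackson_hat u = 0"
proof -
  have sinc4_hat: "(LINT t|lborel. of_real (sinc4 t) * exp (- (\<i> * of_real (u * t)))) = 0"
  proof (cases "0 \<le> u")
    case False
    then show ?thesis using sinc4_fourier_vanishes[of "- u"] assms by simp
  next
    case True
    have "(LINT t|lborel. of_real (sinc4 t) * exp (- (\<i> * of_real (u * t))))
        = (LINT t|lborel. cnj (of_real (sinc4 t) * exp (\<i> * of_real (u * t))))"
      by (simp add: exp_cnj)
    also have "\<dots> = cnj (LINT t|lborel. of_real (sinc4 t) * exp (\<i> * of_real (u * t)))"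
      by (rule Bochner_Integration.integral_cnj)
    also have "\<dots> = 0" using sinc4_fourier_vanishes[of u] assms True by simp
    finally show ?thesis .
  qed
  then show ?thesis
    unfolding jackson_hat_def jackson_def by simp
qed

section \<open>Approximation by bounded Dirichlet polynomials\<close>

text \<open>
  A formal series is approximable with bound \<open>M\<close> if its coefficients are limits of
  those of Dirichlet polynomials that are bounded by \<open>M\<close> on the imaginary axis. This
  is the common ground of the two ways in which a series can be "bounded": by a bounded
  holomorphic extension, and by a bounded function on the group. The condition \<open>j \<le> L
  j\<close> ensures that the \<open>N\<close>-th partial sum of the approximating polynomial makes
  sense for large \<open>j\<close>; it can always be reached by padding with zero coefficients.
\<close>

definition poly_approx :: "(nat \<Rightarrow> real) \<Rightarrow> real \<Rightarrow> (nat \<Rightarrow> complex) \<Rightarrow> bool" where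
  "poly_approx lam M a \<longleftrightarrow>
     (\<exists>b L. (\<forall>j. j \<le> L j) \<and> (\<forall>j t. norm (dpoly lam (b j) (L j) (\<i> * of_real t)) \<le> M) \<and>
            (\<forall>n. (\<lambda>j. b j n) \<longlonglongrightarrow> a n))"

text \<open>
  Averaging along the imaginary direction acts on coefficients as a multiplier. The modulation by
  \<open>y\<close> allows to isolate a single coefficient.
\<close>

lemma jackson_dpoly_integral:
  "(LINT t|lborel. of_real (jackson t) * (dpoly lam a N (s + \<i> * of_real (x * t)) * exp (\<i> * of_real (y * t))))
    = dpoly lam (\<lambda>n. a n * jackson_hat (lam n * x - y)) N s"
proof -
  have "of_real (jackson t) * (dpoly lam a N (s + \<i> * of_real (x * t)) * exp (\<i> * of_real (y * t)))
      = (\<Sum>n<N. dterm lam a s n * (of_real (jackson t) * exp (- (\<i> * of_real ((lam n * x - y) * t)))))" for t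
    unfolding dpoly_def sum_distrib_left sum_distrib_right
    by (intro sum.cong) (auto simp: dterm_def exp_add[symmetric] algebra_simps)
  then have *: "(\<lambda>t. of_real (jackson t) * (dpoly lam a N (s + \<i> * of_real (x * t)) * exp (\<i> * of_real (y * t))))
      = (\<lambda>t. \<Sum>n<N. dterm lam a s n * (of_real (jackson t) * exp (- (\<i> * of_real ((lam n * x - y) * t)))))"
    by blast
  have "integrable lborel (\<lambda>t. of_real (jackson t) * exp (- (\<i> * of_real (u * t))))" for u
    by (rule jackson_integrable_mult[where C = 1]) auto
  then have "(LINT t|lborel. of_real (jackson t) * (dpoly lam a N (s + \<i> * of_real (x * t)) * exp (\<i> * of_real (y * t))))
      = (\<Sum>n<N. dterm lam a s n * jackson_hat (lam n * x - y))"
    unfolding jackson_hat_def * by (subst Bochner_Integration.integral_sum) (auto simp del: of_real_mult of_real_diff)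
  also have "\<dots> = dpoly lam (\<lambda>n. a n * jackson_hat (lam n * x - y)) N s"
    unfolding dpoly_def dterm_def by (intro sum.cong) (auto simp: mult_ac)
  finally show ?thesis .
qed

lemma jackson_hat_0: "jackson_hat 0 = 1"
  by (simp add: jackson_hat_def jackson_integral)

lemma dpoly_measurable [measurable]: "dpoly lam a N \<in> borel_measurable borel"
  by (intro borel_measurable_continuous_onI dpoly_continuous)

text \<open>
  If \<open>x\<close> is so large that the other frequencies, scaled by \<open>x\<close>, have
  distance at least \<open>4\<close> from \<open>lam n x\<close>, then the average of the
  polynomial against \<open>exp (\<i> lam n x t)\<close> is exactly the \<open>n\<close>-th
  coefficient.
\<close>

lemma dpoly_coeff_bound:
  assumes fr: "frequency lam" and M: "\<And>t. norm (dpoly lam b L (\<i> * of_real t)) \<le> M" and n: "n < L"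
  shows "norm (b n) \<le> M"
proof -
  define x where "x = (\<Sum>m\<in>{..<L} - {n}. 4 / \<bar>lam m - lam n\<bar>)"
  have x: "4 \<le> \<bar>lam m * x - lam n * x\<bar>" if m: "m < L" "m \<noteq> n" for m
  proof -
    have "lam m \<noteq> lam n"
      using fr m unfolding frequency_def by (metis strict_mono_eq)
    then have pos: "0 < \<bar>lam m - lam n\<bar>" by simp
    have "4 / \<bar>lam m - lam n\<bar> \<le> x"
      unfolding x_def using m by (intro member_le_sum) auto
    moreover have "0 \<le> x" unfolding x_def by (intro sum_nonneg) auto
    ultimately have "4 \<le> \<bar>lam m - lam n\<bar> * x" using pos by (simp add: field_simps)
    then show ?thesis using \<open>0 \<le> x\<close> by (simp add: abs_mult flip: left_diff_distrib)
  qed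
  have "dpoly lam (\<lambda>m. b m * jackson_hat (lam m * x - lam n * x)) L 0
      = (\<Sum>m<L. if m = n then b n else 0)"
    unfolding dpoly_def dterm_def
    by (intro sum.cong) (use x in \<open>auto simp: jackson_hat_0 jackson_hat_vanishes\<close>)
  also have "\<dots> = b n" using n by simp
  finally have "b n = (LINT t|lborel. of_real (jackson t)
      * (dpoly lam b L (0 + \<i> * of_real (x * t)) * exp (\<i> * of_real (lam n * x * t))))"
    unfolding jackson_dpoly_integral by simp
  also have "norm \<dots> \<le> M"
    by (rule norm_jackson_integral_le) (use M in \<open>auto simp: norm_mult simp del: of_real_mult\<close>)
  finally show ?thesis .
qed

text \<open>
  The integrals over compact intervals are holomorphic, and they converge uniformly because
  \<open>F\<close> is bounded and the kernel is integrable.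
\<close>

lemma jackson_mean_holomorphic:
  assumes hol: "F holomorphic_on halfplane 0" and M: "\<And>s. 0 < Re s \<Longrightarrow> norm (F s) \<le> M"
  shows "(\<lambda>s. LINT t|lborel. of_real (jackson t) * F (s + \<i> * of_real (x * t))) holomorphic_on halfplane 0"
    (is "?G holomorphic_on _")
proof -
  have cont: "continuous_on (halfplane 0) F" by (rule holomorphic_on_imp_continuous_on[OF hol])
  have opn: "open (halfplane 0)" by (rule open_halfspace_Re_gt)
  have cont_line: "continuous_on UNIV (\<lambda>t::real. F (s + \<i> * of_real (x * t)))" if "0 < Re s" for s
    by (rule continuous_on_compose2[OF cont]) (use that in \<open>auto intro!: continuous_intros\<close>)
  have int: "integrable lborel (\<lambda>t. of_real (jackson t) * F (s + \<i> * of_real (x * t)))" if s: "0 < Re s" for s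
  proof (rule jackson_integrable_mult[where C = M])
    show "(\<lambda>t. F (s + \<i> * of_real (x * t))) \<in> borel_measurable borel"
      by (rule borel_measurable_continuous_onI[OF cont_line[OF s]])
    show "norm (F (s + \<i> * of_real (x * t))) \<le> M * (1 + \<bar>t\<bar>)" for t
    proof -
      have "norm (F (s + \<i> * of_real (x * t))) \<le> M" using s by (intro M) simp
      moreover have "M * 1 \<le> M * (1 + \<bar>t\<bar>)"
        using order_trans[OF norm_ge_zero M[OF s]] by (intro mult_left_mono) auto
      ultimately show ?thesis by simp
    qed
  qed
  define g where "g n s = integral (cbox (- real n) (real n)) (\<lambda>t. of_real (jackson t) * F (s + \<i> * of_real (x * t)))" for n s
  have g_hol: "g n holomorphic_on halfplane 0" for n
    unfolding g_def
  proof (rule leibniz_rule_holomorphic[where fx = "\<lambda>s t. of_real (jackson t) * deriv F (s + \<i> * of_real (x * t))"])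
    show "((\<lambda>s. of_real (jackson t) * F (s + \<i> * of_real (x * t))) has_field_derivative
        of_real (jackson t) * deriv F (s + \<i> * of_real (x * t))) (at s within halfplane 0)"
      if "s \<in> halfplane 0" for s t
    proof -
      have "(F has_field_derivative deriv F (s + \<i> * of_real (x * t))) (at (s + \<i> * of_real (x * t)))"
        by (rule holomorphic_derivI[OF hol opn]) (use that in auto)
      then have "((\<lambda>s. F (s + \<i> * of_real (x * t))) has_field_derivative
          deriv F (s + \<i> * of_real (x * t)) * 1) (at s)"
        by (intro DERIV_chain2[where g = "\<lambda>s. s + \<i> * of_real (x * t)"]) (auto intro!: derivative_eq_intros)
      then show ?thesis
        using DERIV_cmult has_field_derivative_at_within by fastforce
    qed
    show "(\<lambda>t. of_real (jackson t) * F (s + \<i> * of_real (x * t))) integrable_on cbox (- real n) (real n)"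
      if "s \<in> halfplane 0" for s
    proof (rule integrable_continuous)
      show "continuous_on (cbox (- real n) (real n)) (\<lambda>t. of_real (jackson t) * F (s + \<i> * of_real (x * t)))"
        by (intro continuous_intros jackson_continuous continuous_on_subset[OF cont_line]) (use that in auto)
    qed
    have "continuous_on (halfplane 0) (deriv F)"
      by (intro holomorphic_on_imp_continuous_on holomorphic_deriv hol opn)
    then have "continuous_on (halfplane 0 \<times> cbox (- real n) (real n)) (\<lambda>z. deriv F (fst z + \<i> * of_real (x * snd z)))"
      by (rule continuous_on_compose2) (auto intro!: continuous_intros)
    then show "continuous_on (halfplane 0 \<times> cbox (- real n) (real n))
        (\<lambda>(s, t). of_real (jackson t) * deriv F (s + \<i> * of_real (x * t)))"
      unfolding case_prod_unfold
      by (intro continuous_intros continuous_on_compose2[OF jackson_continuous[of UNIV] continuous_on_snd[OF continuous_on_id]]) auto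
  qed (rule convex_halfspace_Re_gt)
  define tl where "tl n = (LINT t|lborel. indicator (- {- real n..real n}) t * jackson t)" for n
  have tl: "tl \<longlonglongrightarrow> 0"
  proof -
    have "tl \<longlonglongrightarrow> (LINT t|(lborel :: real measure). 0 :: real)"
      unfolding tl_def
    proof (rule integral_dominated_convergence[where w = jackson])
      show "AE t in lborel. (\<lambda>n. indicator (- {- real n..real n}) t * jackson t) \<longlonglongrightarrow> 0"
      proof (rule AE_I2)
        fix t :: real
        obtain k where "\<bar>t\<bar> \<le> real k" using real_arch_simple by blast
        then have "\<forall>\<^sub>F n in sequentially. indicator (- {- real n..real n}) t * jackson t = 0"
          by (intro eventually_sequentiallyI[of k]) (auto simp: indicator_def)
        then show "(\<lambda>n. indicator (- {- real n..real n}) t * jackson t) \<longlonglongrightarrow> 0"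
          by (rule tendsto_eventually)
      qed
    qed (use jackson_integrable jackson_nonneg in \<open>auto simp: indicator_def\<close>)
    then show ?thesis by simp
  qed
  have diff: "dist (g n s) (?G s) \<le> M * tl n" if s: "0 < Re s" for n s
  proof -
    let ?f = "\<lambda>t. of_real (jackson t) * F (s + \<i> * of_real (x * t))"
    have I: "integrable lborel (\<lambda>t. indicator A t *\<^sub>R ?f t)" if "A \<in> sets borel" for A
      using that by (intro integrable_mult_indicator int s) auto
    have "g n s = (LINT t|lborel. indicator {- real n..real n} t *\<^sub>R ?f t)"
      using set_borel_integral_eq_integral(2)[of "{- real n..real n}" ?f] I[of "{- real n..real n}"]
      unfolding g_def set_integrable_def set_lebesgue_integral_def by simp
    then have "?G s - g n s = (LINT t|lborel. ?f t - indicator {- real n..real n} t *\<^sub>R ?f t)"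
      by (simp only: Bochner_Integration.integral_diff[OF int[OF s] I[of "{- real n..real n}"]] borel_closed closed_atLeastAtMost)
    also have "\<dots> = (LINT t|lborel. indicator (- {- real n..real n}) t *\<^sub>R ?f t)"
      by (intro Bochner_Integration.integral_cong) (auto simp: indicator_def)
    also have "norm \<dots> \<le> (LINT t|lborel. M * (indicator (- {- real n..real n}) t * jackson t))"
    proof (rule Bochner_Integration.integral_norm_bound_integral[OF I])
      show "integrable lborel (\<lambda>t. M * (indicator (- {- real n..real n}) t * jackson t))"
        using integrable_mult_indicator[OF _ jackson_integrable, of "- {- real n..real n}"] by auto
      show "norm (indicator (- {- real n..real n}) t *\<^sub>R ?f t) \<le> M * (indicator (- {- real n..real n}) t * jackson t)" for t
        using M[of "s + \<i> * of_real (x * t)"] s jackson_nonneg[of t]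
        by (auto simp: indicator_def norm_mult mult.commute[of M] intro!: mult_left_mono)
    qed auto
    finally show ?thesis unfolding tl_def by (simp add: dist_norm norm_minus_commute)
  qed
  show ?thesis
  proof (rule holomorphic_uniform_sequence[OF opn g_hol])
    fix z assume "z \<in> halfplane 0"
    then obtain d where d: "0 < d" "cball z d \<subseteq> halfplane 0" using opn open_contains_cball by blast
    have "uniform_limit (cball z d) g ?G sequentially"
    proof (rule uniform_limitI)
      fix e :: real assume "0 < e"
      have "(\<lambda>n. M * tl n) \<longlonglongrightarrow> M * 0" by (intro tendsto_intros tl)
      then have "\<forall>\<^sub>F n in sequentially. M * tl n < e" using \<open>0 < e\<close> by (intro order_tendstoD) auto
      then show "\<forall>\<^sub>F n in sequentially. \<forall>s\<in>cball z d. dist (g n s) (?G s) < e"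
        by eventually_elim (use d(2) diff le_less_trans in blast)
    qed
    then show "\<exists>d>0. cball z d \<subseteq> halfplane 0 \<and> uniform_limit (cball z d) g ?G sequentially"
      using d by blast
  qed
qed

text \<open>
  Integration term by term. The series need not converge uniformly on vertical lines, but by the
  Abel bound its partial sums grow at most linearly, so dominated convergence applies. All terms
  with \<open>lam n x \<ge> 4\<close> integrate to \<open>0\<close>.
\<close>

lemma jackson_mean_eq_dpoly:
  assumes fr: "frequency lam" and conv: "dconv lam a s1" and x: "0 < x" and L: "\<And>n. L \<le> n \<Longrightarrow> 4 \<le> lam n * x"
    and s: "Re s1 < Re s"
  shows "(LINT t|lborel. of_real (jackson t) * dlim lam a (s + \<i> * of_real (x * t)))
      = dpoly lam (\<lambda>n. a n * jackson_hat (lam n * x)) L s"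
proof -
  let ?z = "\<lambda>t. s + \<i> * of_real (x * t)"
  obtain B where B: "\<And>N. norm (dpoly lam a N s1) \<le> B" "0 \<le> B"
    using convergent_imp_Bseq[OF conv[unfolded dconv_iff_convergent]] unfolding Bseq_def by (metis less_imp_le)
  define d where "d = Re s - Re s1"
  define C where "C = B / d * (norm (s - s1) + x)"
  have d: "0 < d" using s by (simp add: d_def)
  have growth: "norm (dpoly lam a N (?z t)) \<le> C * (1 + \<bar>t\<bar>)" for N t
  proof -
    have "norm (dpoly lam a N (?z t)) \<le> B * (norm (?z t - s1) / Re (?z t - s1)) * exp (- (lam 0 * Re (?z t - s1)))"
      using dirichlet_abel_bound[OF fr, of 0 N s1 "?z t" a B] B s
      by (auto simp: dpoly_def lessThan_atLeast0)
    also have "\<dots> \<le> B * (norm (?z t - s1) / Re (?z t - s1)) * 1"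
      using frequency_nonneg[OF fr, of 0] s B by (intro mult_left_mono) (auto intro!: mult_nonneg_nonneg)
    also have "\<dots> = B / d * norm (?z t - s1)" by (simp add: d_def)
    also have "\<dots> \<le> B / d * ((norm (s - s1) + x) * (1 + \<bar>t\<bar>))"
    proof (rule mult_left_mono)
      have "norm (?z t - s1) \<le> norm (s - s1) + norm (\<i> * of_real (x * t))"
        using norm_triangle_ineq[of "s - s1" "\<i> * of_real (x * t)"] by (simp add: algebra_simps)
      also have "norm (\<i> * of_real (x * t)) = x * \<bar>t\<bar>"
        using x by (simp add: norm_mult abs_mult)
      finally show "norm (?z t - s1) \<le> (norm (s - s1) + x) * (1 + \<bar>t\<bar>)"
        unfolding ring_distribs using x mult_nonneg_nonneg[OF norm_ge_zero[of "s - s1"] abs_ge_zero[of t]] by linarith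
    qed (use B d in auto)
    finally show ?thesis by (simp add: C_def)
  qed
  have lim: "(\<lambda>N. LINT t|lborel. of_real (jackson t) * dpoly lam a N (?z t))
      \<longlonglongrightarrow> (LINT t|lborel. of_real (jackson t) * dlim lam a (?z t))"
  proof (rule integral_dominated_convergence[where w = "\<lambda>t. C * ((1 + \<bar>t\<bar>) * jackson t)"])
    have c: "continuous_on (halfplane (Re s1)) (dlim lam a)"
      by (rule holomorphic_on_imp_continuous_on[OF dlim_holomorphic(1)[OF fr conv]])
    have "continuous_on UNIV (\<lambda>t. dlim lam a (?z t))"
      by (rule continuous_on_compose2[OF c]) (use s in \<open>auto intro!: continuous_intros\<close>)
    then have [measurable]: "(\<lambda>t. dlim lam a (?z t)) \<in> borel_measurable borel"
      by (rule borel_measurable_continuous_onI)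
    show "(\<lambda>t. of_real (jackson t) * dlim lam a (?z t)) \<in> borel_measurable lborel" by measurable
    show "integrable lborel (\<lambda>t. C * ((1 + \<bar>t\<bar>) * jackson t))"
      by (intro integrable_mult_right jackson_integrable_linear)
    show "AE t in lborel. (\<lambda>N. of_real (jackson t) * dpoly lam a N (?z t)) \<longlonglongrightarrow> of_real (jackson t) * dlim lam a (?z t)"
      using s by (intro AE_I2 tendsto_intros dconv_imp_tendsto dlim_holomorphic(2)[OF fr conv]) auto
    show "AE t in lborel. norm (of_real (jackson t) * dpoly lam a N (?z t)) \<le> C * ((1 + \<bar>t\<bar>) * jackson t)" for N
    proof (rule AE_I2)
      fix t
      have "norm (of_real (jackson t) * dpoly lam a N (?z t)) \<le> jackson t * (C * (1 + \<bar>t\<bar>))"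
        using growth jackson_nonneg[of t] by (simp add: norm_mult mult_left_mono)
      then show "norm (of_real (jackson t) * dpoly lam a N (?z t)) \<le> C * ((1 + \<bar>t\<bar>) * jackson t)"
        by (simp add: mult_ac)
    qed
  qed measurable
  have "(LINT t|lborel. of_real (jackson t) * dpoly lam a N (?z t))
      = dpoly lam (\<lambda>n. a n * jackson_hat (lam n * x)) L s" if N: "L \<le> N" for N
  proof -
    have "(LINT t|lborel. of_real (jackson t) * dpoly lam a N (?z t)) = dpoly lam (\<lambda>n. a n * jackson_hat (lam n * x)) N s"
      using jackson_dpoly_integral[of lam a N s x 0] by simp
    moreover have "dterm lam (\<lambda>n. a n * jackson_hat (lam n * x)) s n = 0" if "n \<in> {L..<N}" for n
      using that L[of n] by (simp add: dterm_def jackson_hat_vanishes)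
    ultimately show ?thesis
      using dpoly_diff_eq[OF N, of lam "\<lambda>n. a n * jackson_hat (lam n * x)" s] by simp
  qed
  then have "(\<lambda>N. LINT t|lborel. of_real (jackson t) * dpoly lam a N (?z t))
      \<longlonglongrightarrow> dpoly lam (\<lambda>n. a n * jackson_hat (lam n * x)) L s"
    by (intro tendsto_eventually eventually_sequentiallyI[of L])
  then show ?thesis using lim LIMSEQ_unique by blast
qed

text \<open>
  The averages of \<open>F\<close> are Dirichlet polynomials far to the right, where the series
  converges, hence by analytic continuation on the whole half-plane, where \<open>F\<close> is
  bounded by \<open>M\<close>. The scale \<open>x\<close> of the kernel tends to \<open>0\<close>.
\<close>

lemma bounded_extension_imp_poly_approx:
  assumes fr: "frequency lam" and conv: "dconv lam a s1"
    and hol: "F holomorphic_on halfplane 0" and M: "\<And>s. 0 < Re s \<Longrightarrow> norm (F s) \<le> M"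
    and F: "\<And>s. 0 < Re s \<Longrightarrow> dconv lam a s \<Longrightarrow> F s = dlim lam a s"
  shows "poly_approx lam M a"
proof -
  have key: "norm (dpoly lam (\<lambda>n. a n * jackson_hat (lam n * x)) L (\<i> * of_real t)) \<le> M"
    if x: "0 < x" and L: "\<And>n. L \<le> n \<Longrightarrow> 4 \<le> lam n * x" for x L t
  proof -
    let ?P = "dpoly lam (\<lambda>n. a n * jackson_hat (lam n * x)) L"
    let ?G = "\<lambda>s. LINT t|lborel. of_real (jackson t) * F (s + \<i> * of_real (x * t))"
    define c where "c = max 0 (Re s1)"
    have bound: "norm (?P s) \<le> M" if s: "0 < Re s" for s
    proof -
      have "?G s = ?P s"
      proof (rule analytic_continuation_open[of "halfplane c" "halfplane 0" ?G ?P])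
        show "open (halfplane c)" "open (halfplane 0)" by (rule open_halfspace_Re_gt)+
        have "of_real (c + 1) \<in> halfplane c" by simp
        then show "halfplane c \<noteq> {}" by blast
        show "connected (halfplane 0)" by (intro convex_connected convex_halfspace_Re_gt)
        show "halfplane c \<subseteq> halfplane 0" by (auto simp: c_def)
        show "?G holomorphic_on halfplane 0" by (rule jackson_mean_holomorphic[OF hol M])
        show "?G z = ?P z" if "z \<in> halfplane c" for z
        proof -
          have z: "0 < Re z" "Re s1 < Re z" using that by (auto simp: c_def)
          have "?G z = (LINT t|lborel. of_real (jackson t) * dlim lam a (z + \<i> * of_real (x * t)))"
            using z by (intro Bochner_Integration.integral_cong arg_cong2[where f = "(*)"] F dlim_holomorphic(2)[OF fr conv]) auto
          then show ?thesis using jackson_mean_eq_dpoly[OF fr conv x L z(2)] by simp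
        qed
      qed (use s dpoly_holomorphic in auto)
      moreover have "continuous_on UNIV (\<lambda>t. F (s + \<i> * of_real (x * t)))"
        by (rule continuous_on_compose2[OF holomorphic_on_imp_continuous_on[OF hol]])
          (use s in \<open>auto intro!: continuous_intros\<close>)
      then have "norm (?G s) \<le> M"
        using s by (intro norm_jackson_integral_le borel_measurable_continuous_onI M) auto
      ultimately show ?thesis by simp
    qed
    have "((\<lambda>e. ?P (of_real e + \<i> * of_real t)) \<longlongrightarrow> ?P (of_real 0 + \<i> * of_real t)) (at_right 0)"
      by (intro continuous_on_tendsto_compose[OF dpoly_continuous[of UNIV]] tendsto_intros) auto
    then have "((\<lambda>e. norm (?P (of_real e + \<i> * of_real t))) \<longlongrightarrow> norm (?P (\<i> * of_real t))) (at_right 0)"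
      using tendsto_norm by force
    then show ?thesis
      by (rule tendsto_upperbound) (auto intro!: eventually_at_right_less[THEN eventually_mono] bound)
  qed
  have "\<exists>L\<ge>j. \<forall>n\<ge>L. 4 \<le> lam n * inverse (real (Suc j))" for j
  proof -
    have "\<forall>\<^sub>F n in sequentially. 4 * real (Suc j) \<le> lam n"
      using frequency_at_top[OF fr] unfolding filterlim_at_top by blast
    then obtain L where "\<forall>n\<ge>L. 4 * real (Suc j) \<le> lam n" unfolding eventually_sequentially by blast
    then have "\<forall>n\<ge>max L j. 4 \<le> lam n * inverse (real (Suc j))"
      by (auto simp: field_simps)
    then show ?thesis using max.cobounded2 by blast
  qed
  then obtain L where L: "\<And>j. j \<le> L j" "\<And>j n. L j \<le> n \<Longrightarrow> 4 \<le> lam n * inverse (real (Suc j))" by metis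
  show ?thesis
    unfolding poly_approx_def
  proof (intro exI conjI allI)
    show "j \<le> L j" for j by (rule L)
    show "norm (dpoly lam (\<lambda>n. a n * jackson_hat (lam n * inverse (real (Suc j)))) (L j) (\<i> * of_real t)) \<le> M" for j t
      by (rule key) (use L in auto)
    fix n
    have "(\<lambda>j. lam n * inverse (real (Suc j))) \<longlonglongrightarrow> lam n * 0"
      by (intro tendsto_intros LIMSEQ_inverse_real_of_nat)
    then have "(\<lambda>j. a n * jackson_hat (lam n * inverse (real (Suc j)))) \<longlonglongrightarrow> a n * 1"
      by (intro tendsto_intros jackson_hat_tendsto_1) simp
    then show "(\<lambda>j. a n * jackson_hat (lam n * inverse (real (Suc j)))) \<longlonglongrightarrow> a n" by simp
  qed
qed

section \<open>Uniformly bounded partial sums\<close>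

text \<open>
  This is the quantitative statement behind Bohr's theorem: cutting off a Dirichlet polynomial
  costs at most a constant factor if one moves to the right by \<open>\<sigma>\<close>, and the
  constant depends on \<open>\<sigma>\<close> only. It is enough to look at the point
  \<open>\<sigma>\<close> because vertical translations preserve the bound on the imaginary axis.
\<close>

definition partial_sums_bounded :: "(nat \<Rightarrow> real) \<Rightarrow> bool" where
  "partial_sums_bounded lam \<longleftrightarrow>
     (\<forall>\<sigma>>0. \<exists>C. \<forall>b L M N. (\<forall>t. norm (dpoly lam b L (\<i> * of_real t)) \<le> M) \<longrightarrow> N \<le> L
                 \<longrightarrow> norm (dpoly lam b N (of_real \<sigma>)) \<le> C * M)"

lemma dpoly_vertical_translate:
  "dpoly lam (\<lambda>n. a n * exp (- (\<i> * of_real (lam n * t)))) N s = dpoly lam a N (s + \<i> * of_real t)"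
  unfolding dpoly_def dterm_def by (intro sum.cong) (auto simp: exp_add[symmetric] algebra_simps)

text \<open>
  A vertical translation leads from the point \<open>\<sigma>\<close> to the line \<open>Re s =
  \<sigma>\<close>, and Abel summation from this line to the half-plane to its right.
\<close>

lemma partial_sums_bounded_halfplane:
  assumes fr: "frequency lam" and "partial_sums_bounded lam" and "0 < \<sigma>"
  obtains C where "\<And>b L M N s. (\<And>t. norm (dpoly lam b L (\<i> * of_real t)) \<le> M) \<Longrightarrow> N \<le> L \<Longrightarrow> \<sigma> \<le> Re s
      \<Longrightarrow> norm (dpoly lam b N s) \<le> C * M"
proof -
  obtain C where C: "\<And>b L M N. (\<And>t. norm (dpoly lam b L (\<i> * of_real t)) \<le> M) \<Longrightarrow> N \<le> L
      \<Longrightarrow> norm (dpoly lam b N (of_real \<sigma>)) \<le> C * M"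
    using assms(2,3) unfolding partial_sums_bounded_def by metis
  have "norm (dpoly lam b N s) \<le> C * M"
    if M: "\<And>t. norm (dpoly lam b L (\<i> * of_real t)) \<le> M" and N: "N \<le> L" and s: "\<sigma> \<le> Re s" for b L M N s
  proof -
    let ?b = "\<lambda>n. b n * exp (- (\<i> * of_real (lam n * Im s)))"
    have line: "norm (dpoly lam ?b L (\<i> * of_real t)) \<le> M" for t
      unfolding dpoly_vertical_translate using M[of "t + Im s"] by (simp add: algebra_simps)
    have K: "norm (\<Sum>n=0..<k. dterm lam ?b (of_real \<sigma>) n) \<le> C * M" if "k \<le> N" for k
      using C[OF line, of k] that N by (simp add: dpoly_def lessThan_atLeast0)
    have "norm (dpoly lam ?b N (of_real \<sigma> + of_real (Re s - \<sigma>))) \<le> C * M * exp (- (lam 0 * (Re s - \<sigma>)))"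
      unfolding dpoly_def lessThan_atLeast0
      by (rule dirichlet_abel_bound_horizontal[OF fr _ _ K]) (use s in auto)
    also have "\<dots> \<le> C * M * 1"
      using frequency_nonneg[OF fr, of 0] s order_trans[OF norm_ge_zero K[of 0]]
      by (intro mult_left_mono) (auto intro!: mult_nonneg_nonneg)
    finally show ?thesis
      unfolding dpoly_vertical_translate by (simp add: complex_eq[of s, symmetric] mult.commute)
  qed
  then show ?thesis using that by blast
qed

lemma dpoly_tendsto:
  assumes "\<And>n. (\<lambda>j. b j n) \<longlonglongrightarrow> a n"
  shows "(\<lambda>j. dpoly lam (b j) N s) \<longlonglongrightarrow> dpoly lam a N s"
  unfolding dpoly_def dterm_def by (intro tendsto_intros assms)

text \<open>
  Partial sums depend on finitely many coefficients, so bounds that are uniform in the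
  approximating polynomials pass to the limit. The second bound compares a partial sum with the
  whole polynomial, which is bounded by \<open>M\<close> itself; it gives the sharp constant for
  the limit function.
\<close>

lemma poly_approx_partial_sum_bounds:
  assumes fr: "frequency lam" and Q: "partial_sums_bounded lam" and "poly_approx lam M a" and "0 < \<sigma>"
  obtains B where "\<And>N s. \<sigma> \<le> Re s \<Longrightarrow> norm (dpoly lam a N s) \<le> B"
    and "\<And>N s. 2 * \<sigma> \<le> Re s \<Longrightarrow> norm (dpoly lam a N s) \<le> M + B * exp (- (lam N * \<sigma>))"
proof -
  obtain b L where bL: "\<And>j. j \<le> L j" "\<And>j t. norm (dpoly lam (b j) (L j) (\<i> * of_real t)) \<le> M"
      "\<And>n. (\<lambda>j. b j n) \<longlonglongrightarrow> a n"
    using assms(3) unfolding poly_approx_def by blast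
  obtain C where C: "\<And>b L M N s. (\<And>t. norm (dpoly lam b L (\<i> * of_real t)) \<le> M) \<Longrightarrow> N \<le> L \<Longrightarrow> \<sigma> \<le> Re s
      \<Longrightarrow> norm (dpoly lam b N s) \<le> C * M"
    using partial_sums_bounded_halfplane[OF fr Q assms(4)] by blast
  define B where "B = 2 * (C * M)"
  have CM: "0 \<le> C * M" using order_trans[OF norm_ge_zero C[OF bL(2), of 0 0 "of_real \<sigma>"]] by simp
  have lim: "(\<lambda>j. norm (dpoly lam (b j) N s)) \<longlonglongrightarrow> norm (dpoly lam a N s)" for N s
    by (intro tendsto_norm dpoly_tendsto bL)
  show ?thesis
  proof (rule that[of B])
    fix N s assume s: "\<sigma> \<le> Re s"
    have "norm (dpoly lam (b j) N s) \<le> C * M" if "N \<le> j" for j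
      using C[OF bL(2)] s that bL(1)[of j] le_trans by blast
    then have "norm (dpoly lam a N s) \<le> C * M"
      by (intro tendsto_upperbound[OF lim] eventually_sequentiallyI[of N]) auto
    then show "norm (dpoly lam a N s) \<le> B" using CM by (simp add: B_def)
  next
    fix N s assume s: "2 * \<sigma> \<le> Re s"
    have "norm (dpoly lam (b j) N s) \<le> M + B * exp (- (lam N * \<sigma>))" if "N \<le> j" for j
    proof -
      have NL: "N \<le> L j" using that bL(1)[of j] by simp
      define s' where "s' = s - of_real \<sigma>"
      have s': "\<sigma> \<le> Re s'" using s by (simp add: s'_def)
      have Q: "norm (dpoly lam (b j) k s') \<le> C * M" if "k \<le> L j" for k
        using C[OF bL(2) that s'] .
      have "norm (\<Sum>n=N..<k. dterm lam (b j) s' n) \<le> B" if k: "k \<le> L j" for k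
      proof (cases "N \<le> k")
        case True
        then show ?thesis
          using Q[OF k] Q[OF NL] norm_triangle_ineq4[of "dpoly lam (b j) k s'" "dpoly lam (b j) N s'"]
          by (simp add: dpoly_diff_eq[symmetric] B_def)
      qed (use CM in \<open>simp add: B_def\<close>)
      then have tail: "norm (\<Sum>n=N..<L j. dterm lam (b j) (s' + of_real \<sigma>) n) \<le> B * exp (- (lam N * \<sigma>))"
        by (intro dirichlet_abel_bound_horizontal[OF fr NL]) (use assms(4) in auto)
      have "norm (dpoly lam (b j) (L j) s) \<le> M"
        by (rule dpoly_halfplane_bound[OF fr bL(2)]) (use s assms(4) in auto)
      moreover have "norm (dpoly lam (b j) (L j) s - dpoly lam (b j) N s) \<le> B * exp (- (lam N * \<sigma>))"
        using tail by (simp add: dpoly_diff_eq[OF NL] s'_def)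
      ultimately show ?thesis
        using norm_triangle_sub[of "dpoly lam (b j) N s" "dpoly lam (b j) (L j) s"]
        by (simp add: norm_minus_commute)
    qed
    then show "norm (dpoly lam a N s) \<le> M + B * exp (- (lam N * \<sigma>))"
      by (intro tendsto_upperbound[OF lim] eventually_sequentiallyI[of N]) auto
  qed
qed

lemma poly_approx_uniformly_convergent:
  assumes fr: "frequency lam" and Q: "partial_sums_bounded lam" and P: "poly_approx lam M a" and \<sigma>: "0 < \<sigma>"
  shows "uniformly_convergent_on {s. \<sigma> \<le> Re s} (\<lambda>N s. dpoly lam a N s)"
proof -
  define d where "d = \<sigma> / 2"
  have d: "0 < d" using \<sigma> by (simp add: d_def)
  obtain B where B: "\<And>N s. d \<le> Re s \<Longrightarrow> norm (dpoly lam a N s) \<le> B"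
    using poly_approx_partial_sum_bounds[OF fr Q P d] by metis
  have B0: "0 \<le> B" using order_trans[OF norm_ge_zero B[of "of_real d" 0]] by simp
  have tail: "norm (dpoly lam a N s - dpoly lam a m s) \<le> 2 * B * exp (- (d * lam m))" if "m \<le> N" "\<sigma> \<le> Re s" for m N s
  proof -
    define s' where "s' = s - of_real d"
    have s': "d \<le> Re s'" using that by (simp add: s'_def d_def)
    have "norm (\<Sum>n=m..<k. dterm lam a s' n) \<le> 2 * B" for k
    proof (cases "m \<le> k")
      case True
      then show ?thesis
        using B[OF s', of k] B[OF s', of m] norm_triangle_ineq4[of "dpoly lam a k s'" "dpoly lam a m s'"]
        by (simp add: dpoly_diff_eq[symmetric])
    qed (use B0 in simp)
    then have "norm (\<Sum>n=m..<N. dterm lam a (s' + of_real d) n) \<le> 2 * B * exp (- (lam m * d))"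
      by (intro dirichlet_abel_bound_horizontal[OF fr that(1)]) (use d in auto)
    then show ?thesis by (simp add: dpoly_diff_eq[OF that(1)] s'_def mult.commute)
  qed
  show ?thesis
    unfolding uniformly_convergent_eq_Cauchy uniformly_Cauchy_on_def
  proof (intro allI impI)
    fix e :: real assume e: "0 < e"
    have "(\<lambda>m. 2 * B * exp (- (d * lam m))) \<longlonglongrightarrow> 2 * B * 0"
      by (intro tendsto_intros exp_frequency_tendsto_0[OF fr d])
    then have "\<forall>\<^sub>F m in sequentially. 2 * B * exp (- (d * lam m)) < e / 2"
      using e by (intro order_tendstoD) auto
    then obtain m where m: "2 * B * exp (- (d * lam m)) < e / 2" unfolding eventually_sequentially by blast
    show "\<exists>M. \<forall>s\<in>{s. \<sigma> \<le> Re s}. \<forall>i\<ge>M. \<forall>j\<ge>M. dist (dpoly lam a i s) (dpoly lam a j s) < e"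
    proof (intro exI ballI allI impI)
      fix s i j assume s: "s \<in> {s. \<sigma> \<le> Re s}" and ij: "m \<le> i" "m \<le> j"
      have "dist (dpoly lam a i s) (dpoly lam a j s)
          \<le> dist (dpoly lam a i s) (dpoly lam a m s) + dist (dpoly lam a j s) (dpoly lam a m s)"
        by (rule dist_triangle2)
      also have "\<dots> < e / 2 + e / 2"
        using tail[OF ij(1), of s] tail[OF ij(2), of s] s m
        unfolding dist_norm by (intro add_strict_mono) (auto intro: order.strict_trans1)
      finally show "dist (dpoly lam a i s) (dpoly lam a j s) < e" by simp
    qed
  qed
qed

lemma poly_approx_dconv:
  assumes fr: "frequency lam" and Q: "partial_sums_bounded lam" and P: "poly_approx lam M a" and s: "0 < Re s"
  shows "dconv lam a s"
proof -
  have "uniformly_convergent_on {z. Re s \<le> Re z} (\<lambda>N z. dpoly lam a N z)"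
    by (rule poly_approx_uniformly_convergent[OF fr Q P s])
  then show ?thesis
    unfolding dconv_iff_convergent by (rule uniformly_convergent_imp_convergent) simp
qed

lemma poly_approx_norm_dlim_le:
  assumes fr: "frequency lam" and Q: "partial_sums_bounded lam" and P: "poly_approx lam M a" and s: "0 < Re s"
  shows "norm (dlim lam a s) \<le> M"
proof -
  have d: "0 < Re s / 2" using s by simp
  obtain B where B: "\<And>N. norm (dpoly lam a N s) \<le> M + B * exp (- (lam N * (Re s / 2)))"
    using poly_approx_partial_sum_bounds[OF fr Q P d] by (metis mult_2 field_sum_of_halves order_refl)
  have "(\<lambda>N. M + B * exp (- (Re s / 2 * lam N))) \<longlonglongrightarrow> M + B * 0"
    by (intro tendsto_intros exp_frequency_tendsto_0[OF fr d])
  then have lim: "(\<lambda>N. M + B * exp (- (lam N * (Re s / 2)))) \<longlonglongrightarrow> M" by (simp add: mult.commute)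
  have "(\<lambda>N. norm (dpoly lam a N s)) \<longlonglongrightarrow> norm (dlim lam a s)"
    by (intro tendsto_norm dconv_imp_tendsto poly_approx_dconv[OF fr Q P s])
  then show ?thesis by (rule LIMSEQ_le[OF _ lim]) (use B in blast)
qed

section \<open>A gliding hump\<close>

lemma dpoly_scale: "dpoly lam (\<lambda>n. c * a n) N s = c * dpoly lam a N s"
  by (simp add: dpoly_def dterm_def sum_distrib_left mult.assoc)

text \<open>
  The terms below a fixed index \<open>m\<close> contribute at most \<open>m M\<close> to any
  partial sum, since each coefficient is bounded by \<open>M\<close>. Hence removing them costs a
  factor that depends on \<open>m\<close> only, and arbitrarily large partial sums remain.
\<close>

lemma high_frequency_hump:
  assumes fr: "frequency lam"
    and unb: "\<And>C. \<exists>b L M N. (\<forall>t. norm (dpoly lam b L (\<i> * of_real t)) \<le> M) \<and> N \<le> L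
                 \<and> C * M < norm (dpoly lam b N (of_real \<sigma>))"
    and \<sigma>: "0 < \<sigma>"
  shows "\<exists>b L N. (\<forall>n<m. b n = 0) \<and> (\<forall>t. norm (dpoly lam b L (\<i> * of_real t)) \<le> 1) \<and> N \<le> L \<and> m < L
                 \<and> real K < norm (dpoly lam b N (of_real \<sigma>))"
proof -
  \<comment> \<open>A bound that still exceeds \<open>K\<close> after the terms below \<open>m\<close> are removed and the rest is normalised.\<close>
  define C where "C = real K * real (Suc m) + real m"
  obtain b L M N where b: "\<And>t. norm (dpoly lam b L (\<i> * of_real t)) \<le> M" "N \<le> L"
      "C * M < norm (dpoly lam b N (of_real \<sigma>))"
    using unb by blast
  have cb: "norm (b n) \<le> M" if "n < L" for n using dpoly_coeff_bound[OF fr b(1) that] .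
  have partial: "norm (dpoly lam b k s) \<le> real k * M" if "k \<le> L" "0 \<le> Re s" for k s
  proof -
    have "norm (dpoly lam b k s) \<le> (\<Sum>n<k. norm (b n))" by (rule norm_dpoly_le[OF fr that(2)])
    also have "\<dots> \<le> of_nat (card {..<k}) * M" using cb that(1) by (intro sum_bounded_above) auto
    finally show ?thesis by simp
  qed
  have M0: "0 \<le> M" using order_trans[OF norm_ge_zero b(1)] .
  have mN: "m < N"
  proof (rule ccontr)
    assume "\<not> m < N"
    then have "norm (dpoly lam b N (of_real \<sigma>)) \<le> real m * M"
      using order_trans[OF partial[OF b(2), of "of_real \<sigma>"] mult_right_mono[OF _ M0, of "real N" "real m"]] \<sigma> by simp
    moreover have "real m * M \<le> C * M" unfolding C_def using M0 by (intro mult_right_mono) auto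
    ultimately show False using b(3) by simp
  qed
  have Mpos: "0 < M"
  proof (rule ccontr)
    assume "\<not> 0 < M"
    then have "M = 0" using M0 by simp
    then show False using partial[OF b(2), of "of_real \<sigma>"] b(3) \<sigma> by simp
  qed
  define c where "c = inverse (complex_of_real (real (Suc m) * M))"
  have nc: "norm c = inverse (real (Suc m) * M)"
    unfolding c_def norm_inverse norm_of_real using Mpos by (simp add: abs_mult)
  have c1: "norm c * (real (Suc m) * M) = 1" unfolding nc by (rule left_inverse) (use Mpos in simp)
  define b' where "b' n = c * (if n < m then 0 else b n)" for n
  have b': "dpoly lam b' k s = c * (dpoly lam b k s - dpoly lam b m s)" if "m \<le> k" for k s
  proof -
    let ?b = "\<lambda>n. if n < m then 0 else b n"
    have "dpoly lam ?b m s = 0" by (simp add: dpoly_def dterm_def)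
    moreover have "dpoly lam ?b k s - dpoly lam ?b m s = dpoly lam b k s - dpoly lam b m s"
      unfolding dpoly_diff_eq[OF that] by (intro sum.cong) (auto simp: dterm_def)
    ultimately show ?thesis unfolding b'_def dpoly_scale by simp
  qed
  show ?thesis
  proof (rule exI[of _ b'], rule exI[of _ L], rule exI[of _ N], intro conjI allI impI)
    show "b' n = 0" if "n < m" for n using that by (simp add: b'_def)
    show "norm (dpoly lam b' L (\<i> * of_real t)) \<le> 1" for t
    proof -
      have "norm (dpoly lam b L (\<i> * of_real t) - dpoly lam b m (\<i> * of_real t)) \<le> M + real m * M"
        using norm_triangle_ineq4 b(1) partial[of m "\<i> * of_real t"] mN b(2)
        by (smt (verit) Re_i_times Im_complex_of_real less_imp_le_nat order_trans)
      then have "norm (dpoly lam b L (\<i> * of_real t) - dpoly lam b m (\<i> * of_real t)) \<le> real (Suc m) * M"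
        by (simp add: algebra_simps)
      then have "norm c * norm (dpoly lam b L (\<i> * of_real t) - dpoly lam b m (\<i> * of_real t)) \<le> norm c * (real (Suc m) * M)"
        by (rule mult_left_mono) simp
      then show ?thesis unfolding c1 using mN b(2) by (simp only: b'[of L] norm_mult less_imp_le order.strict_trans2)
    qed
    have "norm (dpoly lam b N (of_real \<sigma>)) - norm (dpoly lam b m (of_real \<sigma>))
        \<le> norm (dpoly lam b N (of_real \<sigma>) - dpoly lam b m (of_real \<sigma>))"
      by (rule norm_triangle_ineq2)
    moreover have "norm (dpoly lam b m (of_real \<sigma>)) \<le> real m * M" using mN b(2) \<sigma> by (intro partial) auto
    moreover have "real K * (real (Suc m) * M) + real m * M = C * M" by (simp add: C_def algebra_simps)
    ultimately have "real K * (real (Suc m) * M) < norm (dpoly lam b N (of_real \<sigma>) - dpoly lam b m (of_real \<sigma>))"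
      using b(3) by linarith
    then have "norm c * (real K * (real (Suc m) * M)) < norm c * norm (dpoly lam b N (of_real \<sigma>) - dpoly lam b m (of_real \<sigma>))"
      by (rule mult_strict_left_mono) (use c1 in auto)
    moreover have "norm c * (real K * (real (Suc m) * M)) = real K"
      using c1 by (metis mult.left_commute mult.right_neutral)
    ultimately show "real K < norm (dpoly lam b' N (of_real \<sigma>))"
      by (simp only: b'[OF less_imp_le[OF mN]] norm_mult)
  qed (use mN b(2) in auto)
qed

text \<open>
  The counterexample is a sum of polynomials that occupy disjoint blocks of frequencies, each
  divided by its largest partial sum at \<open>\<sigma>\<close>. These maxima grow at least
  geometrically, so the sum converges uniformly along the ends of the blocks. At
  \<open>\<sigma>\<close> each block contains a partial sum of modulus \<open>1\<close>, so the
  series diverges. At \<open>\<sigma> + 1\<close> Abel summation bounds the partial sums of a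
  block by \<open>exp (- lam m)\<close>, where \<open>m\<close> is the start of the block, so the
  oscillations tend to \<open>0\<close> and the series converges.
\<close>

lemma gliding_hump:
  assumes fr: "frequency lam" and nQ: "\<not> partial_sums_bounded lam"
  obtains a \<sigma> m where "0 < \<sigma>" "strict_mono m"
    "uniformly_convergent_on {s. 0 \<le> Re s} (\<lambda>j s. dpoly lam a (m j) s)"
    "dconv lam a (of_real (\<sigma> + 1))" "\<not> dconv lam a (of_real \<sigma>)"
proof -
  obtain \<sigma> where \<sigma>: "0 < \<sigma>" and unb: "\<And>C. \<exists>b L M N. (\<forall>t. norm (dpoly lam b L (\<i> * of_real t)) \<le> M) \<and> N \<le> L
                 \<and> C * M < norm (dpoly lam b N (of_real \<sigma>))"
    using nQ unfolding partial_sums_bounded_def not_all not_ex not_imp not_le by metis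
  have "\<forall>m K. \<exists>b L N. (\<forall>n<m. b n = 0) \<and> (\<forall>t. norm (dpoly lam b L (\<i> * of_real t)) \<le> 1) \<and> N \<le> L \<and> m < L
                 \<and> real K < norm (dpoly lam b N (of_real \<sigma>))"
    using high_frequency_hump[OF fr unb \<sigma>] by blast
  then obtain bb LL NN where H: "\<And>m K n. n < m \<Longrightarrow> bb m K n = 0"
      "\<And>m K t. norm (dpoly lam (bb m K) (LL m K) (\<i> * of_real t)) \<le> 1"
      "\<And>m K. NN m K \<le> LL m K" "\<And>m K. m < LL m K"
      "\<And>m K. real K < norm (dpoly lam (bb m K) (NN m K) (of_real \<sigma>))"
    by metis
  define m where "m = rec_nat 0 (\<lambda>j mj. LL mj (2 ^ j))"
  have m0: "m 0 = 0" and mS: "m (Suc j) = LL (m j) (2 ^ j)" for j by (auto simp: m_def)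
  define b where "b j = bb (m j) (2 ^ j)" for j
  have sm: "strict_mono m" unfolding strict_mono_Suc_iff using H(4) mS by simp
  have b0: "b j n = 0" if "n < m j" for j n using H(1) that by (simp add: b_def)
  have b1: "norm (dpoly lam (b j) (m (Suc j)) (\<i> * of_real t)) \<le> 1" for j t
    using H(2) by (simp add: b_def mS)
  \<comment> \<open>The normalising constant: the largest partial sum of the block at \<open>\<sigma>\<close>.\<close>
  define Mx where "Mx j = Max ((\<lambda>N. norm (dpoly lam (b j) N (of_real \<sigma>))) ` {..m (Suc j)})" for j
  have Mx_ge: "norm (dpoly lam (b j) N (of_real \<sigma>)) \<le> Mx j" if "N \<le> m (Suc j)" for j N
    unfolding Mx_def using that by (intro Max_ge) auto
  have Mx_big: "2 ^ j < Mx j" for j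
  proof -
    have "NN (m j) (2 ^ j) \<le> m (Suc j)" using H(3) by (simp add: mS)
    then show ?thesis using Mx_ge[of "NN (m j) (2 ^ j)" j] H(5)[of "2 ^ j" "m j"] by (simp add: b_def)
  qed
  have Mx_pos: "0 < Mx j" for j using Mx_big[of j] by (smt (verit) zero_less_power)
  have "\<exists>N. N \<le> m (Suc j) \<and> norm (dpoly lam (b j) N (of_real \<sigma>)) = Mx j" for j
  proof -
    have "Mx j \<in> (\<lambda>N. norm (dpoly lam (b j) N (of_real \<sigma>))) ` {..m (Suc j)}"
      unfolding Mx_def by (rule Max_in) auto
    then obtain N where "Mx j = norm (dpoly lam (b j) N (of_real \<sigma>))" "N \<in> {..m (Suc j)}" by (rule imageE)
    then show ?thesis by (intro exI[of _ N]) simp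
  qed
  then obtain NM where NM: "\<And>j. NM j \<le> m (Suc j)" "\<And>j. norm (dpoly lam (b j) (NM j) (of_real \<sigma>)) = Mx j" by metis
  define \<epsilon> where "\<epsilon> j = 1 / Mx j" for j
  have \<epsilon>: "0 < \<epsilon> j" "\<epsilon> j \<le> (1/2) ^ j" "\<epsilon> j * Mx j = 1" for j
    using Mx_pos[of j] Mx_big[of j] by (auto simp: \<epsilon>_def power_one_over intro!: divide_left_mono)
  \<comment> \<open>The index of the block that contains \<open>n\<close>.\<close>
  define blk where "blk n = (LEAST j. n < m (Suc j))" for n
  have blk: "blk n = j" if "m j \<le> n" "n < m (Suc j)" for n j
    unfolding blk_def
  proof (rule Least_equality)
    fix i assume "n < m (Suc i)"
    then have "m j < m (Suc i)" using that by simp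
    then show "j \<le> i" using sm by (simp add: strict_mono_less)
  qed (rule that)
  define a where "a n = of_real (\<epsilon> (blk n)) * b (blk n) n" for n
  have block: "dpoly lam a N s = dpoly lam a (m j) s + of_real (\<epsilon> j) * dpoly lam (b j) N s"
    if N: "m j \<le> N" "N \<le> m (Suc j)" for N j s
  proof -
    have "dpoly lam a N s - dpoly lam a (m j) s = (\<Sum>n=m j..<N. of_real (\<epsilon> j) * dterm lam (b j) s n)"
      unfolding dpoly_diff_eq[OF N(1)] using N(2) by (intro sum.cong) (auto simp: dterm_def a_def blk)
    also have "\<dots> = of_real (\<epsilon> j) * (dpoly lam (b j) N s - dpoly lam (b j) (m j) s)"
      unfolding dpoly_diff_eq[OF N(1)] sum_distrib_left ..
    also have "dpoly lam (b j) (m j) s = 0" using b0 by (simp add: dpoly_def dterm_def)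
    finally show ?thesis by (simp add: algebra_simps)
  qed
  have blocks: "dpoly lam a (m J) s = (\<Sum>j<J. of_real (\<epsilon> j) * dpoly lam (b j) (m (Suc j)) s)" for J s
  proof (induction J)
    case 0
    then show ?case by (simp add: m0 dpoly_def)
  next
    case (Suc J)
    then show ?case using block[of J "m (Suc J)" s] sm by (simp add: strict_mono_less_eq)
  qed
  have unif: "uniformly_convergent_on {s. 0 \<le> Re s} (\<lambda>j s. dpoly lam a (m j) s)"
    unfolding blocks
  proof (rule Weierstrass_m_test')
    show "norm (of_real (\<epsilon> j) * dpoly lam (b j) (m (Suc j)) s) \<le> (1/2) ^ j" if "s \<in> {s. 0 \<le> Re s}" for j s
    proof -
      have "norm (dpoly lam (b j) (m (Suc j)) s) \<le> 1"
        using dpoly_halfplane_bound[OF fr b1] that by simp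
      then have "\<epsilon> j * norm (dpoly lam (b j) (m (Suc j)) s) \<le> (1/2) ^ j * 1"
        using \<epsilon>(1,2)[of j] by (intro mult_mono) (auto intro: less_imp_le)
      then show ?thesis using \<epsilon>(1)[of j] by (simp add: norm_mult)
    qed
    show "summable (\<lambda>j. (1/2 :: real) ^ j)" by (rule summable_geometric) simp
  qed
  have not_conv: "\<not> dconv lam a (of_real \<sigma>)"
  proof
    assume "dconv lam a (of_real \<sigma>)"
    then have "Cauchy (\<lambda>N. dpoly lam a N (of_real \<sigma>))"
      unfolding dconv_iff_convergent by (rule convergent_Cauchy)
    then obtain k where k: "\<And>p q. k \<le> p \<Longrightarrow> k \<le> q \<Longrightarrow> norm (dpoly lam a p (of_real \<sigma>) - dpoly lam a q (of_real \<sigma>)) < 1"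
      unfolding Cauchy_iff by (metis zero_less_one)
    have kk: "k \<le> m k" by (rule strict_mono_imp_increasing[OF sm])
    have "m k \<le> NM k"
    proof (rule ccontr)
      assume "\<not> m k \<le> NM k"
      then have "dpoly lam (b k) (NM k) (of_real \<sigma>) = 0" using b0 by (simp add: dpoly_def dterm_def)
      then show False using NM(2)[of k] Mx_pos[of k] by simp
    qed
    then have "norm (dpoly lam a (NM k) (of_real \<sigma>) - dpoly lam a (m k) (of_real \<sigma>)) = 1"
      using block[of k "NM k" "of_real \<sigma>"] NM \<epsilon>(1,3)[of k] by (simp add: norm_mult)
    then show False using k[of "NM k" "m k"] kk \<open>m k \<le> NM k\<close> by simp
  qed
  have conv: "dconv lam a (of_real (\<sigma> + 1))"
  proof -
    define s where "s = complex_of_real (\<sigma> + 1)"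
    have tail: "norm (dpoly lam a N s - dpoly lam a (m j) s) \<le> exp (- (1 * lam (m j)))"
      if N: "m j \<le> N" "N \<le> m (Suc j)" for j N
    proof -
      have "norm (\<Sum>n=m j..<N. dterm lam (b j) (of_real \<sigma> + of_real 1) n) \<le> Mx j * exp (- (lam (m j) * 1))"
      proof (rule dirichlet_abel_bound_horizontal[OF fr N(1)])
        fix k assume k: "k \<le> N"
        have z: "dpoly lam (b j) (m j) (of_real \<sigma>) = 0" using b0 by (simp add: dpoly_def dterm_def)
        show "norm (\<Sum>n=m j..<k. dterm lam (b j) (of_real \<sigma>) n) \<le> Mx j"
        proof (cases "m j \<le> k")
          case True
          then show ?thesis using dpoly_diff_eq[OF True, of lam "b j" "of_real \<sigma>"] z Mx_ge[of k j] k N(2) by simp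
        qed (use Mx_pos[of j] in simp)
      qed simp
      also have "(\<Sum>n=m j..<N. dterm lam (b j) (of_real \<sigma> + of_real 1) n) = dpoly lam (b j) N s"
        using dpoly_diff_eq[OF N(1), of lam "b j" s] b0 by (simp add: dpoly_def dterm_def s_def)
      finally have "\<epsilon> j * norm (dpoly lam (b j) N s) \<le> \<epsilon> j * (Mx j * exp (- (lam (m j) * 1)))"
        using \<epsilon>(1)[of j] by (intro mult_left_mono) auto
      also have "\<dots> = exp (- (1 * lam (m j)))" using \<epsilon>(3)[of j] by (simp add: mult.assoc[symmetric])
      finally show ?thesis using block[OF N, of s] \<epsilon>(1)[of j] by (simp add: norm_mult)
    qed
    have "convergent (\<lambda>j. dpoly lam a (m j) s)"
      by (rule uniformly_convergent_imp_convergent[OF unif]) (use \<sigma> in \<open>simp add: s_def\<close>)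
    then obtain l where l: "(\<lambda>j. dpoly lam a (m j) s) \<longlonglongrightarrow> l" unfolding convergent_def by blast
    have small: "(\<lambda>j. exp (- (1 * lam (m j)))) \<longlonglongrightarrow> 0"
      using LIMSEQ_subseq_LIMSEQ[OF exp_frequency_tendsto_0[OF fr zero_less_one] sm] by (simp add: o_def)
    have "(\<lambda>N. dpoly lam a N s) \<longlonglongrightarrow> l"
    proof (rule metric_LIMSEQ_I)
      fix e :: real assume e: "0 < e"
      have "\<forall>\<^sub>F j in sequentially. dist (dpoly lam a (m j) s) l < e / 2"
        using e by (intro tendstoD[OF l]) simp
      moreover have "\<forall>\<^sub>F j in sequentially. exp (- (1 * lam (m j))) < e / 2"
        using small e by (intro order_tendstoD) auto
      ultimately have "\<forall>\<^sub>F j in sequentially. dist (dpoly lam a (m j) s) l < e / 2 \<and> exp (- (1 * lam (m j))) < e / 2"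
        by (rule eventually_conj)
      then obtain k where k: "\<And>j. k \<le> j \<Longrightarrow> dist (dpoly lam a (m j) s) l < e / 2 \<and> exp (- (1 * lam (m j))) < e / 2"
        unfolding eventually_sequentially by blast
      have "dist (dpoly lam a N s) l < e" if N: "m k \<le> N" for N
      proof -
        define j where "j = blk N"
        have "N < m (Suc N)" using strict_mono_imp_increasing[OF sm, of "Suc N"] by simp
        then have j1: "N < m (Suc j)" unfolding j_def blk_def by (rule LeastI)
        have j2: "m j \<le> N"
        proof (cases j)
          case 0
          then show ?thesis by (simp add: m0)
        next
          case (Suc i)
          then have "\<not> N < m (Suc i)" unfolding j_def blk_def by (intro not_less_Least) simp
          then show ?thesis using Suc by simp
        qed
        have "m k < m (Suc j)" using N j1 by simp
        then have "k \<le> j" using sm by (simp add: strict_mono_less)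
        have "dist (dpoly lam a N s) l \<le> dist (dpoly lam a N s) (dpoly lam a (m j) s) + dist (dpoly lam a (m j) s) l"
          by (rule dist_triangle)
        also have "\<dots> < e / 2 + e / 2"
          using tail[OF j2 less_imp_le[OF j1]] k[OF \<open>k \<le> j\<close>] by (simp add: dist_norm)
        finally show ?thesis by simp
      qed
      then show "\<exists>no. \<forall>n\<ge>no. dist (dpoly lam a n s) l < e" by blast
    qed
    then show ?thesis unfolding dconv_iff_convergent convergent_def s_def by blast
  qed
  show ?thesis using that[OF \<sigma> sm unif conv not_conv] .
qed

section \<open>Haar measure\<close>

lemma norm_integral_le_integral:
  fixes f :: "'a \<Rightarrow> 'b::{banach, second_countable_topology}"
  assumes "integrable M f" "integrable M g" "\<And>x. norm (f x) \<le> g x"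
  shows "norm (LINT x|M. f x) \<le> (LINT x|M. g x)"
  using order_trans[OF integral_norm_bound integral_mono[OF integrable_norm[OF assms(1)] assms(2,3)]] .

lemma haar_space: "haar_measure \<mu> \<Longrightarrow> space \<mu> = UNIV"
  unfolding haar_measure_def using sets_eq_imp_space_eq[of \<mu> borel] by simp

lemma haar_measurable_eq: "haar_measure \<mu> \<Longrightarrow> borel_measurable \<mu> = borel_measurable borel"
  unfolding haar_measure_def by (intro measurable_cong_sets) auto

lemma haar_measurable_continuous:
  "haar_measure \<mu> \<Longrightarrow> continuous_on UNIV f \<Longrightarrow> f \<in> borel_measurable \<mu>"
  by (simp add: haar_measurable_eq borel_measurable_continuous_onI)

lemma haar_prob: "haar_measure \<mu> \<Longrightarrow> prob_space \<mu>"
  by (simp add: haar_measure_def)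

lemma haar_integrable_continuous:
  fixes f :: "'g::{topological_ab_group_add, t2_space} \<Rightarrow> 'b::{banach, second_countable_topology}"
  assumes hm: "haar_measure \<mu>" and cpt: "compact (UNIV :: 'g set)" and f: "continuous_on UNIV f"
  shows "integrable \<mu> f"
proof -
  interpret prob_space \<mu> by (rule haar_prob[OF hm])
  have "bounded (range f)" using compact_continuous_image[OF f cpt] by (rule compact_imp_bounded)
  then obtain B where "\<And>x. norm (f x) \<le> B" unfolding bounded_iff by blast
  then show ?thesis
    by (intro integrable_const_bound[where B = B] AE_I2 haar_measurable_continuous[OF hm f])
qed

lemma haar_translate_measurable:
  assumes hm: "haar_measure \<mu>"
  shows "(+) x \<in> measurable \<mu> \<mu>"
proof -
  have "(+) x \<in> measurable borel borel"
    by (intro borel_measurable_continuous_onI continuous_intros)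
  then show ?thesis using hm unfolding haar_measure_def by (metis measurable_cong_sets)
qed

lemma haar_integral_translate:
  fixes f :: "'g::{topological_ab_group_add, t2_space} \<Rightarrow> complex"
  assumes hm: "haar_measure \<mu>" and f: "continuous_on UNIV f"
  shows "(LINT y|\<mu>. f (x + y)) = (LINT y|\<mu>. f y)"
proof -
  have "(LINT y|\<mu>. f (x + y)) = (LINT y|distr \<mu> \<mu> ((+) x). f y)"
    by (rule integral_distr[symmetric, OF haar_translate_measurable[OF hm] haar_measurable_continuous[OF hm f]])
  also have "distr \<mu> \<mu> ((+) x) = \<mu>" using hm by (simp add: haar_measure_def)
  finally show ?thesis .
qed

text \<open>
  Finitely many translates of \<open>U\<close> cover the compact group, and they all have the same
  measure.
\<close>

lemma haar_open_pos:
  fixes U :: "'g::{topological_ab_group_add, t2_space} set"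
  assumes hm: "haar_measure \<mu>" and cpt: "compact (UNIV :: 'g set)" and U: "open U" "U \<noteq> {}"
  shows "0 < measure \<mu> U"
proof -
  interpret prob_space \<mu> by (rule haar_prob[OF hm])
  obtain u where u: "u \<in> U" using U by blast
  define T where "T y = {z. (u - y) + z \<in> U}" for y
  have T_open: "open (T y)" for y
  proof -
    have "open ((+) (u - y) -` U)" by (intro open_vimage U continuous_intros)
    then show ?thesis by (simp add: T_def vimage_def)
  qed
  have sets: "A \<in> sets \<mu>" if "open A" for A using that hm by (simp add: haar_measure_def)
  have T_meas: "measure \<mu> (T y) = measure \<mu> U" for y
  proof -
    have "measure \<mu> U = measure (distr \<mu> \<mu> ((+) (u - y))) U" using hm by (simp add: haar_measure_def)
    also have "\<dots> = measure \<mu> (T y)"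
      unfolding T_def
      by (subst measure_distr[OF haar_translate_measurable[OF hm] sets[OF U(1)]]) (simp add: haar_space[OF hm] vimage_def)
    finally show ?thesis by simp
  qed
  have "UNIV \<subseteq> (\<Union>y\<in>UNIV. T y)" using u by (auto simp: T_def)
  then obtain C where C: "finite C" "UNIV \<subseteq> (\<Union>y\<in>C. T y)"
    using compactE_image[OF cpt, of UNIV T] T_open by metis
  have "1 = measure \<mu> (\<Union>y\<in>C. T y)"
    using C(2) prob_space haar_space[OF hm] by (simp add: top.extremum_unique)
  also have "\<dots> \<le> (\<Sum>y\<in>C. measure \<mu> (T y))"
    by (rule finite_measure_subadditive_finite[OF C(1)]) (use T_open sets in blast)
  also have "\<dots> = real (card C) * measure \<mu> U" by (simp add: T_meas)
  finally have "measure \<mu> U \<noteq> 0" by auto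
  then show ?thesis by (simp add: less_le)
qed

section \<open>Characters\<close>

lemma character_0: "group_character \<xi> \<Longrightarrow> \<xi> 0 = 1"
  unfolding group_character_def
  by (metis add_0_left mult_cancel_right2 norm_zero zero_neq_one)

lemma character_minus: "group_character \<xi> \<Longrightarrow> \<xi> (- x) = cnj (\<xi> x)"
proof -
  assume \<xi>: "group_character \<xi>"
  have "\<xi> x * \<xi> (- x) = 1"
    using \<xi> character_0[OF \<xi>] unfolding group_character_def by (metis add.right_inverse)
  moreover have "\<xi> x * cnj (\<xi> x) = 1"
    using \<xi> unfolding group_character_def complex_norm_square[symmetric] by simp
  ultimately show ?thesis by (metis mult_cancel_left mult_zero_left zero_neq_one)
qed

lemma character_diff: "group_character \<xi> \<Longrightarrow> \<xi> (x - y) = \<xi> x * cnj (\<xi> y)"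
  using character_minus[of \<xi> y] unfolding group_character_def by (metis diff_conv_add_uminus)

lemma character_1: "group_character (\<lambda>x. 1)"
  by (simp add: group_character_def)

lemma character_cnj: "group_character \<xi> \<Longrightarrow> group_character (\<lambda>x. cnj (\<xi> x))"
  unfolding group_character_def by (auto intro!: continuous_intros)

lemma character_mult: "group_character \<xi> \<Longrightarrow> group_character \<psi> \<Longrightarrow> group_character (\<lambda>x. \<xi> x * \<psi> x)"
  unfolding group_character_def by (auto intro!: continuous_intros simp: norm_mult)

lemma character_continuous: "group_character \<xi> \<Longrightarrow> continuous_on UNIV \<xi>"
  by (simp add: group_character_def)

lemma norm_character: "group_character \<xi> \<Longrightarrow> norm (\<xi> x) = 1"
  by (simp add: group_character_def)

text \<open>
  The integral of a character is multiplied by its value at \<open>x\<close> when the variable is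
  translated by \<open>x\<close>, so it vanishes if the character is not constant.
\<close>

lemma character_orthogonal:
  fixes \<xi> :: "'g::{topological_ab_group_add, t2_space} \<Rightarrow> complex"
  assumes hm: "haar_measure \<mu>" and \<xi>: "group_character \<xi>" and \<psi>: "group_character \<psi>"
  shows "fourier_coeff \<mu> \<xi> \<psi> = (if \<xi> = \<psi> then 1 else 0)"
proof (cases "\<xi> = \<psi>")
  case True
  interpret prob_space \<mu> by (rule haar_prob[OF hm])
  have "\<psi> x * cnj (\<psi> x) = 1" for x
    using norm_character[OF \<psi>] by (simp add: complex_norm_square[symmetric])
  then show ?thesis using True by (simp add: fourier_coeff_def prob_space)
next
  case False
  define \<theta> where "\<theta> x = \<xi> x * cnj (\<psi> x)" for x
  have \<theta>: "group_character \<theta>" unfolding \<theta>_def by (intro character_mult character_cnj \<xi> \<psi>)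
  obtain x where "\<xi> x \<noteq> \<psi> x" using False by blast
  have "\<theta> x \<noteq> 1"
  proof
    assume "\<theta> x = 1"
    moreover have "\<psi> x * cnj (\<psi> x) = 1"
      using norm_character[OF \<psi>] by (simp add: complex_norm_square[symmetric])
    ultimately show False using \<open>\<xi> x \<noteq> \<psi> x\<close> unfolding \<theta>_def
      by (metis mult_cancel_right mult_zero_right zero_neq_one)
  qed
  have "(LINT y|\<mu>. \<theta> y) = (LINT y|\<mu>. \<theta> (x + y))"
    by (rule haar_integral_translate[symmetric, OF hm character_continuous[OF \<theta>]])
  also have "\<dots> = \<theta> x * (LINT y|\<mu>. \<theta> y)" using \<theta> by (simp add: group_character_def)
  finally have "(LINT y|\<mu>. \<theta> y) = 0" using \<open>\<theta> x \<noteq> 1\<close> by simp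
  then show ?thesis using False by (simp add: fourier_coeff_def \<theta>_def)
qed

lemma freq_character:
  assumes "dirichlet_group lam \<beta>"
  shows "group_character (freq_character \<beta> (lam n))"
    and "freq_character \<beta> (lam n) (\<beta> t) = exp (- (\<i> * of_real (lam n * t)))"
  using freq_character_represents[OF assms, of n] unfolding represents_freq_def by auto

lemma freq_character_inj:
  assumes fr: "frequency lam" and dg: "dirichlet_group lam \<beta>"
    and eq: "freq_character \<beta> (lam m) = freq_character \<beta> (lam n)"
  shows "m = n"
proof (rule ccontr)
  assume "m \<noteq> n"
  then have "lam m \<noteq> lam n" using fr unfolding frequency_def by (metis strict_mono_eq)
  define t where "t = pi / (lam m - lam n)"
  have "exp (- (\<i> * of_real (lam m * t))) = exp (- (\<i> * of_real (lam n * t)))"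
    using freq_character(2)[OF dg, of m t] freq_character(2)[OF dg, of n t] eq by simp
  then have "exp (- (\<i> * of_real (lam m * t)) - (- (\<i> * of_real (lam n * t)))) = 1"
    unfolding exp_diff by simp
  moreover have "- (\<i> * of_real (lam m * t)) - (- (\<i> * of_real (lam n * t))) = - (\<i> * of_real ((lam m - lam n) * t))"
    by (simp add: algebra_simps)
  moreover have "(lam m - lam n) * t = pi" using \<open>lam m \<noteq> lam n\<close> by (simp add: t_def)
  ultimately have "exp (- (\<i> * of_real pi)) = 1" by simp
  then show False by (simp add: exp_minus)
qed

text \<open>
  The trigonometric polynomial on the group that corresponds to a Dirichlet polynomial. Along
  \<open>\<beta>\<close> it agrees with the Dirichlet polynomial on the imaginary axis, so by
  density both have the same supremum.
\<close>

definition group_poly :: "(nat \<Rightarrow> real) \<Rightarrow> (real \<Rightarrow> 'g::topological_ab_group_add) \<Rightarrow> (nat \<Rightarrow> complex) \<Rightarrow> nat \<Rightarrow> 'g \<Rightarrow> complex" where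
  "group_poly lam \<beta> b L x = (\<Sum>n<L. b n * freq_character \<beta> (lam n) x)"

lemma group_poly_on_line:
  assumes "dirichlet_group lam \<beta>"
  shows "group_poly lam \<beta> b L (\<beta> t) = dpoly lam b L (\<i> * of_real t)"
  unfolding group_poly_def dpoly_def dterm_def freq_character(2)[OF assms]
  by (intro sum.cong) (auto simp: algebra_simps)

lemma group_poly_continuous:
  assumes "dirichlet_group lam \<beta>"
  shows "continuous_on UNIV (group_poly lam \<beta> b L)"
  unfolding group_poly_def by (intro continuous_intros character_continuous freq_character(1)[OF assms])

lemma dirichlet_group_dense:
  fixes g :: "'g::{topological_ab_group_add, t2_space} \<Rightarrow> real"
  assumes dg: "dirichlet_group lam \<beta>" and g: "continuous_on UNIV g" and le: "\<And>t. g (\<beta> t) \<le> M"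
  shows "g x \<le> M"
proof -
  have "closed {x. g x \<le> M}" by (rule closed_Collect_le[OF g]) (rule continuous_on_const)
  then have "closure (range \<beta>) \<subseteq> {x. g x \<le> M}" by (intro closure_minimal) (use le in auto)
  then show ?thesis using dg unfolding dirichlet_group_def by blast
qed

section \<open>Trigonometric polynomials on the group\<close>

text \<open>
  An inductive definition, because the facts needed below are linear in the polynomial and can be
  checked on characters.
\<close>

inductive trig_poly :: "('g::topological_ab_group_add \<Rightarrow> complex) \<Rightarrow> bool" where
  char: "group_character \<xi> \<Longrightarrow> trig_poly \<xi>"
| scale: "trig_poly \<phi> \<Longrightarrow> trig_poly (\<lambda>x. c * \<phi> x)"
| add: "trig_poly \<phi> \<Longrightarrow> trig_poly \<psi> \<Longrightarrow> trig_poly (\<lambda>x. \<phi> x + \<psi> x)"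

lemma trig_poly_continuous: "trig_poly \<phi> \<Longrightarrow> continuous_on UNIV \<phi>"
  by (induction rule: trig_poly.induct)
    (auto intro: character_continuous continuous_on_mult continuous_on_add continuous_on_const)

lemma trig_poly_mult_character: "trig_poly \<phi> \<Longrightarrow> group_character \<xi> \<Longrightarrow> trig_poly (\<lambda>x. \<phi> x * \<xi> x)"
proof (induction rule: trig_poly.induct)
  case (char \<psi>)
  then show ?case by (intro trig_poly.char character_mult)
next
  case (scale \<phi> c)
  then show ?case using trig_poly.scale[of "\<lambda>x. \<phi> x * \<xi> x" c] by (simp add: mult.assoc)
next
  case (add \<phi> \<psi>)
  then show ?case using trig_poly.add[of "\<lambda>x. \<phi> x * \<xi> x" "\<lambda>x. \<psi> x * \<xi> x"] by (simp add: ring_distribs)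
qed

lemma trig_poly_mult:
  assumes "trig_poly \<psi>" "trig_poly \<phi>" shows "trig_poly (\<lambda>x. \<phi> x * \<psi> x)"
  using assms
proof (induction rule: trig_poly.induct)
  case (char \<xi>)
  then show ?case by (intro trig_poly_mult_character)
next
  case (scale \<psi> c)
  then show ?case using trig_poly.scale[of "\<lambda>x. \<phi> x * \<psi> x" c] by (simp add: mult.left_commute)
next
  case (add \<psi> \<theta>)
  then show ?case using trig_poly.add[of "\<lambda>x. \<phi> x * \<psi> x" "\<lambda>x. \<phi> x * \<theta> x"] by (simp add: ring_distribs)
qed

lemma trig_poly_prod:
  fixes m :: nat
  assumes "\<And>i. i < m \<Longrightarrow> trig_poly (\<phi> i)"
  shows "trig_poly (\<lambda>x. \<Prod>i<m. \<phi> i x)"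
  using assms
proof (induction m)
  case 0
  then show ?case by (simp add: trig_poly.char character_1)
next
  case (Suc m)
  then show ?case using trig_poly_mult[of "\<phi> m" "\<lambda>x. \<Prod>i<m. \<phi> i x"] by simp
qed

lemma trig_poly_power: "trig_poly \<phi> \<Longrightarrow> trig_poly (\<lambda>x. \<phi> x ^ k)"
  using trig_poly_prod[of k "\<lambda>_. \<phi>"] by simp

lemma trig_poly_reflect_integral:
  fixes \<phi> :: "'g::{topological_ab_group_add, t2_space} \<Rightarrow> complex"
  assumes hm: "haar_measure \<mu>" and cpt: "compact (UNIV :: 'g set)"
  assumes "trig_poly \<phi>"
  shows "(LINT z|\<mu>. \<phi> (y - z)) = (LINT z|\<mu>. \<phi> z)"
  using assms(3)
proof (induction rule: trig_poly.induct)
  case (char \<xi>)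
  have "(LINT z|\<mu>. \<xi> (y - z)) = \<xi> y * fourier_coeff \<mu> (\<lambda>x. 1) \<xi>"
    by (simp add: character_diff[OF char] fourier_coeff_def)
  also have "\<dots> = fourier_coeff \<mu> \<xi> (\<lambda>x. 1)"
    unfolding character_orthogonal[OF hm char character_1] character_orthogonal[OF hm character_1 char]
    by auto
  finally show ?case by (simp add: fourier_coeff_def)
next
  case (scale \<phi> c)
  then show ?case by simp
next
  case (add \<phi> \<psi>)
  have int: "integrable \<mu> \<theta>" "integrable \<mu> (\<lambda>z. \<theta> (y - z))" if "trig_poly \<theta>" for \<theta>
    by (intro haar_integrable_continuous[OF hm cpt] trig_poly_continuous[OF that]
        continuous_on_compose2[OF trig_poly_continuous[OF that]] continuous_intros; simp)+
  show ?case using add int by simp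
qed

lemma
  assumes "prob_space \<mu>" "f \<in> Linf \<mu>"
  shows Linf_AE_bound: "AE x in \<mu>. norm (f x) \<le> Linf_norm \<mu> f"
    and Linf_norm_nonneg: "0 \<le> Linf_norm \<mu> f"
proof -
  interpret prob_space \<mu> by fact
  have nz: "emeasure \<mu> (space \<mu>) \<noteq> 0" by (simp add: emeasure_space_1)
  have fin: "esssup \<mu> (\<lambda>x. ereal (norm (f x))) < \<infinity>" using assms(2) by (simp add: Linf_def)
  have "esssup \<mu> (\<lambda>x. 0::ereal) \<le> esssup \<mu> (\<lambda>x. ereal (norm (f x)))" by (rule esssup_mono) auto
  then have ge: "0 \<le> esssup \<mu> (\<lambda>x. ereal (norm (f x)))" using esssup_const[OF nz, of "0::ereal"] by simp
  then have eq: "ereal (Linf_norm \<mu> f) = esssup \<mu> (\<lambda>x. ereal (norm (f x)))"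
    using fin unfolding Linf_norm_def by (intro ereal_real') auto
  show "AE x in \<mu>. norm (f x) \<le> Linf_norm \<mu> f"
    using esssup_AE[of "\<lambda>x. ereal (norm (f x))" \<mu>] unfolding eq[symmetric] by simp
  show "0 \<le> Linf_norm \<mu> f" using ge by (simp add: Linf_norm_def real_of_ereal_pos)
qed

lemma Linf_integrable:
  assumes "prob_space \<mu>" "f \<in> Linf \<mu>"
  shows "integrable \<mu> f"
proof -
  interpret prob_space \<mu> by fact
  show ?thesis
    by (rule integrable_const_bound[OF Linf_AE_bound[OF assms]]) (use assms in \<open>simp add: Linf_def\<close>)
qed

text \<open>
  Convolution with a trigonometric polynomial keeps only finitely many Fourier coefficients, and
  those outside the frequency vanish already for \<open>f\<close>. The identity is stated for all
  large \<open>L\<close> so that those of two polynomials can be added.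
\<close>

lemma trig_poly_convolution:
  fixes \<beta> :: "real \<Rightarrow> 'g::{topological_ab_group_add, t2_space}"
  assumes fr: "frequency lam" and dg: "dirichlet_group lam \<beta>" and hm: "haar_measure \<mu>"
    and f: "f \<in> series_functions lam \<beta> \<mu> a" and "trig_poly \<phi>"
  shows "\<exists>L0. \<forall>L\<ge>L0. \<forall>y. (LINT z|\<mu>. f z * \<phi> (y - z))
      = group_poly lam \<beta> (\<lambda>n. a n * fourier_coeff \<mu> \<phi> (freq_character \<beta> (lam n))) L y"
proof -
  let ?h = "\<lambda>n. freq_character \<beta> (lam n)"
  have cpt: "compact (UNIV :: 'g set)" using dg by (simp add: dirichlet_group_def)
  have fL: "f \<in> Linf \<mu>" and f0: "\<And>h. group_character h \<Longrightarrow> h \<notin> range ?h \<Longrightarrow> fourier_coeff \<mu> f h = 0"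
    and fa: "\<And>n. a n = fourier_coeff \<mu> f (?h n)"
    using f by (auto simp: series_functions_def Hinf_group_def)
  have fint: "integrable \<mu> f" by (rule Linf_integrable[OF haar_prob[OF hm] fL])
  have int: "integrable \<mu> (\<lambda>z. f z * \<theta> (y - z))" if "trig_poly \<theta>" for \<theta> y
  proof -
    have c: "continuous_on UNIV (\<lambda>z. \<theta> (y - z))"
      by (intro continuous_on_compose2[OF trig_poly_continuous[OF that]] continuous_intros; simp)
    have "bounded (range (\<lambda>z. \<theta> (y - z)))" using compact_continuous_image[OF c cpt] by (rule compact_imp_bounded)
    then obtain B where B: "\<And>z. norm (\<theta> (y - z)) \<le> B" unfolding bounded_iff by blast
    show ?thesis
    proof (rule Bochner_Integration.integrable_bound)
      show "integrable \<mu> (\<lambda>z. B * norm (f z))" using fint by simp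
      show "(\<lambda>z. f z * \<theta> (y - z)) \<in> borel_measurable \<mu>"
        by (intro borel_measurable_times haar_measurable_continuous[OF hm c] borel_measurable_integrable fint)
      show "AE z in \<mu>. norm (f z * \<theta> (y - z)) \<le> norm (B * norm (f z))"
        using order_trans[OF B abs_ge_self]
        by (intro AE_I2) (simp add: norm_mult abs_mult mult.commute[of "norm (f _)"] mult_right_mono)
    qed
  qed
  have fc_add: "fourier_coeff \<mu> (\<lambda>x. \<phi> x + \<psi> x) (?h n) = fourier_coeff \<mu> \<phi> (?h n) + fourier_coeff \<mu> \<psi> (?h n)"
    if "trig_poly \<phi>" "trig_poly \<psi>" for \<phi> \<psi> n
  proof -
    have "integrable \<mu> (\<lambda>x. \<theta> x * cnj (?h n x))" if "trig_poly \<theta>" for \<theta>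
      by (intro haar_integrable_continuous[OF hm cpt] continuous_intros trig_poly_continuous that
          character_continuous freq_character(1)[OF dg])
    then show ?thesis using that by (simp add: fourier_coeff_def ring_distribs)
  qed
  show ?thesis
    using assms(5)
  proof (induction rule: trig_poly.induct)
    case (char \<xi>)
    have lhs: "(LINT z|\<mu>. f z * \<xi> (y - z)) = \<xi> y * fourier_coeff \<mu> f \<xi>" for y
      unfolding fourier_coeff_def character_diff[OF char] by (simp add: mult.left_commute[of _ "\<xi> y"])
    have rhs: "group_poly lam \<beta> (\<lambda>n. a n * fourier_coeff \<mu> \<xi> (?h n)) L y
        = (\<Sum>n<L. if ?h n = \<xi> then a n * \<xi> y else 0)" for L y
      unfolding group_poly_def character_orthogonal[OF hm char freq_character(1)[OF dg]]
      by (intro sum.cong) auto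
    show ?case
    proof (cases "\<xi> \<in> range ?h")
      case True
      then obtain k where k: "\<xi> = ?h k" by blast
      have "(?h n = \<xi>) = (n = k)" for n using freq_character_inj[OF fr dg] k by blast
      then have "\<forall>L\<ge>Suc k. \<forall>y. (LINT z|\<mu>. f z * \<xi> (y - z)) = group_poly lam \<beta> (\<lambda>n. a n * fourier_coeff \<mu> \<xi> (?h n)) L y"
        unfolding lhs rhs by (auto simp: k fa)
      then show ?thesis by blast
    next
      case False
      then have "?h n \<noteq> \<xi>" for n by blast
      then show ?thesis unfolding lhs rhs using f0[OF char False] by simp
    qed
  next
    case (scale \<phi> c)
    have "fourier_coeff \<mu> (\<lambda>x. c * \<phi> x) (?h n) = c * fourier_coeff \<mu> \<phi> (?h n)" for n
      by (simp add: fourier_coeff_def mult.assoc)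
    then have "group_poly lam \<beta> (\<lambda>n. a n * fourier_coeff \<mu> (\<lambda>x. c * \<phi> x) (?h n)) L y
        = c * group_poly lam \<beta> (\<lambda>n. a n * fourier_coeff \<mu> \<phi> (?h n)) L y" for L y
      by (simp add: group_poly_def sum_distrib_left mult_ac)
    moreover have "(LINT z|\<mu>. f z * (c * \<phi> (y - z))) = c * (LINT z|\<mu>. f z * \<phi> (y - z))" for y
      by (simp add: mult.left_commute[of _ c])
    ultimately show ?case using scale.IH by metis
  next
    case (add \<phi> \<psi>)
    then obtain L1 L2 where L: "\<And>L y. L1 \<le> L \<Longrightarrow> (LINT z|\<mu>. f z * \<phi> (y - z)) = group_poly lam \<beta> (\<lambda>n. a n * fourier_coeff \<mu> \<phi> (?h n)) L y"
      "\<And>L y. L2 \<le> L \<Longrightarrow> (LINT z|\<mu>. f z * \<psi> (y - z)) = group_poly lam \<beta> (\<lambda>n. a n * fourier_coeff \<mu> \<psi> (?h n)) L y"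
      by blast
    have "(LINT z|\<mu>. f z * (\<phi> (y - z) + \<psi> (y - z)))
        = group_poly lam \<beta> (\<lambda>n. a n * fourier_coeff \<mu> (\<lambda>x. \<phi> x + \<psi> x) (?h n)) L y" if "max L1 L2 \<le> L" for L y
      using L[of L y] that int[OF add.hyps(1)] int[OF add.hyps(2)]
      by (simp add: fc_add[OF add.hyps] ring_distribs group_poly_def sum.distrib)
    then show ?case by blast
  qed
qed

section \<open>An approximate identity on the group\<close>

text \<open>
  Powers of a peak function concentrate near its peak. If all quotients of consecutive integrals
  were smaller than \<open>1 - \<delta>\<close>, then the integrals would decay like \<open>(1 -
  \<delta>)\<^sup>N\<close>, but they are at least \<open>(1 - \<delta>/2)\<^sup>N\<close> times
  the measure of the non-empty open set \<open>{x. 1 - \<delta>/2 < w x}\<close>.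
\<close>

lemma peak_function_ratio:
  fixes w :: "'g::{topological_ab_group_add, t2_space} \<Rightarrow> real"
  assumes hm: "haar_measure \<mu>" and cpt: "compact (UNIV :: 'g set)"
    and w: "continuous_on UNIV w" "\<And>x. 0 \<le> w x" "\<And>x. w x \<le> 1" "w 0 = 1" and \<delta>: "0 < \<delta>"
  shows "\<exists>N. (1 - \<delta>) * (LINT x|\<mu>. w x ^ N) \<le> (LINT x|\<mu>. w x ^ Suc N) \<and> 0 < (LINT x|\<mu>. w x ^ N)"
proof -
  interpret prob_space \<mu> by (rule haar_prob[OF hm])
  define I where "I N = (LINT x|\<mu>. w x ^ N)" for N
  have int: "integrable \<mu> (\<lambda>x. w x ^ N)" for N
    by (intro haar_integrable_continuous[OF hm cpt] continuous_intros w)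
  have lower: "c ^ N * measure \<mu> {x. c < w x} \<le> I N" if c: "0 \<le> c" for c N
  proof -
    have opn: "open {x. c < w x}" by (intro open_Collect_less continuous_intros w)
    then have s: "{x. c < w x} \<in> sets \<mu>" using hm by (simp add: haar_measure_def)
    have "c ^ N * measure \<mu> {x. c < w x} = (LINT x|\<mu>. c ^ N * indicator {x. c < w x} x)"
      using s by simp
    also have "\<dots> \<le> I N" unfolding I_def
    proof (rule integral_mono)
      show "integrable \<mu> (\<lambda>x. c ^ N * indicator {x. c < w x} x)" using s by (simp add: emeasure_eq_measure)
      show "c ^ N * indicator {x. c < w x} x \<le> w x ^ N" for x
        using c w(2) by (auto simp: indicator_def intro!: power_mono)
    qed (rule int)
    finally show ?thesis .
  qed
  have pos: "0 < measure \<mu> {x. c < w x}" if "c < 1" for c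
  proof (rule haar_open_pos[OF hm cpt])
    show "open {x. c < w x}" by (intro open_Collect_less continuous_intros w)
    have "0 \<in> {x. c < w x}" using w(4) that by simp
    then show "{x. c < w x} \<noteq> {}" by blast
  qed
  have Ipos: "0 < I N" for N
  proof -
    have "0 < (1/2) ^ N * measure \<mu> {x. 1/2 < w x}" using pos[of "1/2"] by simp
    then show ?thesis using lower[of "1/2" N] by simp
  qed
  have "\<exists>N. (1 - \<delta>) * I N \<le> I (Suc N)"
  proof (rule ccontr)
    assume neg: "\<not> (\<exists>N. (1 - \<delta>) * I N \<le> I (Suc N))"
    then have step: "I (Suc N) < (1 - \<delta>) * I N" for N by (simp add: not_le)
    have \<delta>1: "\<delta> < 1" using step[of 0] Ipos[of 0] Ipos[of 1] by (smt (verit) One_nat_def mult_nonneg_nonneg zero_less_mult_iff)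
    have up: "I N \<le> (1 - \<delta>) ^ N" for N
    proof (induction N)
      case 0
      then show ?case by (simp add: I_def prob_space)
    next
      case (Suc N)
      have "I (Suc N) \<le> (1 - \<delta>) * I N" using step[of N] by simp
      also have "\<dots> \<le> (1 - \<delta>) * (1 - \<delta>) ^ N" using Suc \<delta>1 by (intro mult_left_mono) auto
      finally show ?case by simp
    qed
    define c where "c = 1 - \<delta> / 2"
    have c: "0 < c" "c < 1" "(1 - \<delta>) / c < 1" "0 \<le> (1 - \<delta>) / c" using \<delta> \<delta>1 by (auto simp: c_def field_simps)
    have "measure \<mu> {x. c < w x} \<le> ((1 - \<delta>) / c) ^ N" for N
      using lower[of c N] up[of N] c(1) by (simp add: power_divide field_simps)
    moreover have "(\<lambda>N. ((1 - \<delta>) / c) ^ N) \<longlonglongrightarrow> 0" using c by (intro LIMSEQ_realpow_zero) auto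
    ultimately have "measure \<mu> {x. c < w x} \<le> 0"
      by (intro tendsto_lowerbound[of _ 0]) auto
    then show False using pos[OF c(2)] by simp
  qed
  then show ?thesis using Ipos unfolding I_def by blast
qed

text \<open>
  The kernel is a normalised power of \<open>w = (\<Prod>n<m. (1 + Re (\<xi> n)) / 2)\<close>, a
  trigonometric polynomial that peaks exactly where the finitely many given characters are
  \<open>1\<close>. Its coefficients at these characters differ from \<open>1\<close> by at most
  the mean of \<open>\<bar>\<xi> n - 1\<bar>\<close>, and \<open>\<bar>\<xi> n -
  1\<bar>\<^sup>2\<close> is at most \<open>4 (1 - w)\<close>, whose mean is controlled by the
  quotient of two consecutive integrals.
\<close>

lemma approximate_identity:
  fixes \<beta> :: "real \<Rightarrow> 'g::{topological_ab_group_add, t2_space}" and \<xi> :: "nat \<Rightarrow> 'g \<Rightarrow> complex"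
  assumes hm: "haar_measure \<mu>" and cpt: "compact (UNIV :: 'g set)"
    and \<xi>: "\<And>n. group_character (\<xi> n)" and \<epsilon>: "0 < \<epsilon>"
  shows "\<exists>\<phi> :: 'g \<Rightarrow> real. (\<forall>x. 0 \<le> \<phi> x) \<and> trig_poly (\<lambda>x. of_real (\<phi> x)) \<and> (LINT x|\<mu>. \<phi> x) = 1
           \<and> (\<forall>n<m. norm (fourier_coeff \<mu> (\<lambda>x. of_real (\<phi> x)) (\<xi> n) - 1) \<le> 2 * \<epsilon>)"
proof -
  define v where "v n x = (1 + Re (\<xi> n x)) / 2" for n x
  define w where "w x = (\<Prod>n<m. v n x)" for x
  have v: "0 \<le> v n x" "v n x \<le> 1" for n x
    using abs_Re_le_cmod[of "\<xi> n x"] norm_character[OF \<xi>, of n x] by (auto simp: v_def)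
  have w: "0 \<le> w x" "w x \<le> 1" for x unfolding w_def using v by (auto intro!: prod_nonneg prod_le_1)
  have w0: "w 0 = 1" by (simp add: w_def v_def character_0[OF \<xi>])
  have wv: "w x \<le> v n x" if "n < m" for n x
  proof -
    have "w x = v n x * (\<Prod>i\<in>{..<m} - {n}. v i x)"
      unfolding w_def using that by (intro prod.remove) auto
    also have "\<dots> \<le> v n x * 1" using v by (intro mult_left_mono prod_le_1) auto
    finally show ?thesis by simp
  qed
  have w_cont: "continuous_on UNIV w"
    unfolding w_def v_def by (intro continuous_intros character_continuous \<xi>) auto
  have w_trig: "trig_poly (\<lambda>x. complex_of_real (w x))"
  proof -
    have v_trig: "trig_poly (\<lambda>x. complex_of_real (v n x))" for n
    proof -
      have "complex_of_real (v n x) = 1 / 2 * 1 + (1 / 4 * \<xi> n x + 1 / 4 * cnj (\<xi> n x))" for x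
        by (simp add: v_def complex_eq_iff)
      moreover have "trig_poly (\<lambda>x. 1 / 2 * 1 + (1 / 4 * \<xi> n x + 1 / 4 * cnj (\<xi> n x)))"
        by (intro trig_poly.add trig_poly.scale trig_poly.char character_1 character_cnj \<xi>)
      ultimately show ?thesis by simp
    qed
    show ?thesis unfolding w_def of_real_prod by (intro trig_poly_prod v_trig)
  qed
  obtain N where N: "(1 - \<epsilon>\<^sup>2) * (LINT x|\<mu>. w x ^ N) \<le> (LINT x|\<mu>. w x ^ Suc N)" "0 < (LINT x|\<mu>. w x ^ N)"
    using peak_function_ratio[OF hm cpt w_cont w w0, of "\<epsilon>\<^sup>2"] \<epsilon> by auto
  define I where "I = (LINT x|\<mu>. w x ^ N)"
  define \<phi> where "\<phi> x = w x ^ N / I" for x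
  have I: "0 < I" using N by (simp add: I_def)
  have \<phi>0: "0 \<le> \<phi> x" for x using w I by (simp add: \<phi>_def)
  have \<phi>_cont: "continuous_on UNIV \<phi>" unfolding \<phi>_def using I by (intro continuous_intros w_cont) auto
  have \<phi>_trig: "trig_poly (\<lambda>x. complex_of_real (\<phi> x))"
    using trig_poly.scale[OF trig_poly_power[OF w_trig, of N], of "of_real (1 / I)"]
    by (simp add: \<phi>_def)
  have \<phi>1: "(LINT x|\<mu>. \<phi> x) = 1" using I by (simp add: \<phi>_def I_def[symmetric])
  note int = haar_integrable_continuous[OF hm cpt]
  have \<phi>w: "(LINT x|\<mu>. \<phi> x * (1 - w x)) \<le> \<epsilon>\<^sup>2"
  proof -
    have "(LINT x|\<mu>. \<phi> x * (1 - w x)) = (LINT x|\<mu>. \<phi> x - w x ^ Suc N / I)"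
      by (simp add: \<phi>_def algebra_simps diff_divide_distrib)
    also have "\<dots> = (LINT x|\<mu>. \<phi> x) - (LINT x|\<mu>. w x ^ Suc N / I)"
    proof (rule Bochner_Integration.integral_diff)
      show "integrable \<mu> \<phi>" by (rule int[OF \<phi>_cont])
      show "integrable \<mu> (\<lambda>x. w x ^ Suc N / I)" using I by (intro int continuous_intros w_cont) auto
    qed
    also have "\<dots> \<le> \<epsilon>\<^sup>2" using N(1) I unfolding \<phi>1 by (simp add: I_def[symmetric] field_simps)
    finally show ?thesis .
  qed
  have "norm (fourier_coeff \<mu> (\<lambda>x. of_real (\<phi> x)) (\<xi> n) - 1) \<le> 2 * \<epsilon>" if n: "n < m" for n
  proof -
    have c: "continuous_on UNIV (\<lambda>x. of_real (\<phi> x) * cnj (\<xi> n x))" "continuous_on UNIV (\<lambda>x. complex_of_real (\<phi> x))"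
      by (intro continuous_intros \<phi>_cont character_continuous \<xi>)+
    have "fourier_coeff \<mu> (\<lambda>x. of_real (\<phi> x)) (\<xi> n) - 1
        = (LINT x|\<mu>. of_real (\<phi> x) * cnj (\<xi> n x)) - (LINT x|\<mu>. complex_of_real (\<phi> x))"
      by (simp add: fourier_coeff_def \<phi>1)
    also have "\<dots> = (LINT x|\<mu>. of_real (\<phi> x) * cnj (\<xi> n x) - complex_of_real (\<phi> x))"
      by (rule Bochner_Integration.integral_diff[symmetric]) (intro int c)+
    also have "norm \<dots> \<le> (LINT x|\<mu>. \<epsilon> * \<phi> x + 1 / \<epsilon> * (\<phi> x * (1 - w x)))"
    proof (rule norm_integral_le_integral)
      show "integrable \<mu> (\<lambda>x. of_real (\<phi> x) * cnj (\<xi> n x) - complex_of_real (\<phi> x))"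
        by (intro Bochner_Integration.integrable_diff int c)
      show "integrable \<mu> (\<lambda>x. \<epsilon> * \<phi> x + 1 / \<epsilon> * (\<phi> x * (1 - w x)))"
        by (intro int continuous_intros \<phi>_cont w_cont)
      fix x
      define r where "r = norm (\<xi> n x - 1)"
      have "r\<^sup>2 = (norm (\<xi> n x))\<^sup>2 + 1 - 2 * Re (\<xi> n x)"
        unfolding r_def cmod_power2 by (simp add: power2_eq_square algebra_simps)
      then have r2: "r\<^sup>2 = 4 * (1 - v n x)"
        by (simp add: norm_character[OF \<xi>] v_def field_simps)
      \<comment> \<open>Linearise \<open>r = 2 sqrt (1 - v n x)\<close> so that only the mean of \<open>1 - w\<close> is needed.\<close>
      have "0 \<le> (r - 2 * \<epsilon>)\<^sup>2" by simp
      then have "4 * \<epsilon> * r \<le> r\<^sup>2 + 4 * \<epsilon>\<^sup>2" by (simp add: power2_eq_square algebra_simps)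
      also have "\<dots> \<le> 4 * (1 - w x) + 4 * \<epsilon>\<^sup>2" using r2 wv[OF n, of x] by simp
      finally have "r \<le> \<epsilon> + 1 / \<epsilon> * (1 - w x)" using \<epsilon> by (simp add: field_simps power2_eq_square)
      then have "\<phi> x * r \<le> \<phi> x * (\<epsilon> + 1 / \<epsilon> * (1 - w x))" by (rule mult_left_mono) (rule \<phi>0)
      moreover have "norm (of_real (\<phi> x) * cnj (\<xi> n x) - complex_of_real (\<phi> x)) = \<phi> x * r"
      proof -
        have "of_real (\<phi> x) * cnj (\<xi> n x) - complex_of_real (\<phi> x) = of_real (\<phi> x) * cnj (\<xi> n x - 1)"
          by (simp add: algebra_simps)
        then show ?thesis using \<phi>0 by (simp only: norm_mult complex_mod_cnj r_def) simp
      qed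
      ultimately show "norm (of_real (\<phi> x) * cnj (\<xi> n x) - complex_of_real (\<phi> x)) \<le> \<epsilon> * \<phi> x + 1 / \<epsilon> * (\<phi> x * (1 - w x))"
        by (simp add: algebra_simps)
    qed
    also have "\<dots> = \<epsilon> * (LINT x|\<mu>. \<phi> x) + 1 / \<epsilon> * (LINT x|\<mu>. \<phi> x * (1 - w x))"
    proof (subst Bochner_Integration.integral_add)
      show "integrable \<mu> (\<lambda>x. \<epsilon> * \<phi> x)" "integrable \<mu> (\<lambda>x. 1 / \<epsilon> * (\<phi> x * (1 - w x)))"
        by (intro int continuous_intros \<phi>_cont w_cont)+
    qed simp
    also have "\<dots> \<le> \<epsilon> * 1 + 1 / \<epsilon> * \<epsilon>\<^sup>2" unfolding \<phi>1 using \<phi>w \<epsilon> by (intro add_mono mult_left_mono) auto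
    also have "\<dots> = 2 * \<epsilon>" using \<epsilon> by (simp add: power2_eq_square)
    finally show ?thesis .
  qed
  then show ?thesis using \<phi>0 \<phi>_trig \<phi>1 by blast
qed

text \<open>
  Convolution of \<open>f\<close> with the approximate identities of the first \<open>j\<close>
  characters. Since these kernels are non-negative with mean \<open>1\<close>, the convolutions
  are bounded by the norm of \<open>f\<close> everywhere, not only almost everywhere.
\<close>

lemma series_function_imp_poly_approx:
  fixes \<beta> :: "real \<Rightarrow> 'g::{topological_ab_group_add, t2_space}"
  assumes fr: "frequency lam" and dg: "dirichlet_group lam \<beta>" and hm: "haar_measure \<mu>"
    and f: "f \<in> series_functions lam \<beta> \<mu> a"
  shows "poly_approx lam (Linf_norm \<mu> f) a"
proof -
  let ?h = "\<lambda>n. freq_character \<beta> (lam n)"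
  have cpt: "compact (UNIV :: 'g set)" using dg by (simp add: dirichlet_group_def)
  have fL: "f \<in> Linf \<mu>" using f by (simp add: series_functions_def Hinf_group_def)
  have "\<forall>j. \<exists>\<phi> :: 'g \<Rightarrow> real. (\<forall>x. 0 \<le> \<phi> x) \<and> trig_poly (\<lambda>x. of_real (\<phi> x)) \<and> (LINT x|\<mu>. \<phi> x) = 1
           \<and> (\<forall>n<j. norm (fourier_coeff \<mu> (\<lambda>x. of_real (\<phi> x)) (?h n) - 1) \<le> 2 * inverse (real (Suc j)))"
    by (intro allI approximate_identity[OF hm cpt] freq_character(1)[OF dg]) simp
  then obtain \<phi> :: "nat \<Rightarrow> 'g \<Rightarrow> real" where \<phi>: "\<And>j x. 0 \<le> \<phi> j x" "\<And>j. trig_poly (\<lambda>x. of_real (\<phi> j x))" "\<And>j. (LINT x|\<mu>. \<phi> j x) = 1"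
      "\<And>j n. n < j \<Longrightarrow> norm (fourier_coeff \<mu> (\<lambda>x. of_real (\<phi> j x)) (?h n) - 1) \<le> 2 * inverse (real (Suc j))"
    by metis
  define b where "b j n = a n * fourier_coeff \<mu> (\<lambda>x. of_real (\<phi> j x)) (?h n)" for j n
  have "\<exists>L\<ge>j. \<forall>y. (LINT z|\<mu>. f z * of_real (\<phi> j (y - z))) = group_poly lam \<beta> (b j) L y" for j
    using trig_poly_convolution[OF fr dg hm f \<phi>(2)[of j]] unfolding b_def by (metis max.cobounded1 max.cobounded2)
  then obtain L where L: "\<And>j. j \<le> L j" "\<And>j y. (LINT z|\<mu>. f z * of_real (\<phi> j (y - z))) = group_poly lam \<beta> (b j) (L j) y"
    by metis
  have bound: "norm (group_poly lam \<beta> (b j) (L j) y) \<le> Linf_norm \<mu> f" for j y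
  proof -
    have "continuous_on UNIV (\<lambda>x. Re (of_real (\<phi> j x)))"
      by (intro continuous_intros trig_poly_continuous \<phi>(2))
    then have \<phi>c: "continuous_on UNIV (\<phi> j)" by simp
    have c: "continuous_on UNIV (\<lambda>z. \<phi> j (y - z))"
      by (intro continuous_on_compose2[OF \<phi>c] continuous_intros) simp
    have i: "integrable \<mu> (\<lambda>z. \<phi> j (y - z))" by (rule haar_integrable_continuous[OF hm cpt c])
    have "norm (LINT z|\<mu>. f z * of_real (\<phi> j (y - z))) \<le> (LINT z|\<mu>. norm (f z * of_real (\<phi> j (y - z))))"
      by (rule integral_norm_bound)
    also have "\<dots> \<le> (LINT z|\<mu>. Linf_norm \<mu> f * \<phi> j (y - z))"
    proof (rule integral_mono_AE')
      show "integrable \<mu> (\<lambda>z. Linf_norm \<mu> f * \<phi> j (y - z))" using i by simp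
      show "AE z in \<mu>. norm (f z * of_real (\<phi> j (y - z))) \<le> Linf_norm \<mu> f * \<phi> j (y - z)"
        using Linf_AE_bound[OF haar_prob[OF hm] fL]
        by eventually_elim (auto simp: norm_mult \<phi>(1) intro!: mult_right_mono)
    qed (use \<phi>(1) Linf_norm_nonneg[OF haar_prob[OF hm] fL] in auto)
    also have "\<dots> = Linf_norm \<mu> f * (LINT z|\<mu>. \<phi> j (y - z))" by simp
    also have "complex_of_real (LINT z|\<mu>. \<phi> j (y - z)) = complex_of_real (LINT z|\<mu>. \<phi> j z)"
      using trig_poly_reflect_integral[OF hm cpt \<phi>(2)[of j], of y] by simp
    then have "(LINT z|\<mu>. \<phi> j (y - z)) = 1" using \<phi>(3) by simp
    finally show ?thesis unfolding L(2) by simp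
  qed
  show ?thesis
    unfolding poly_approx_def
  proof (intro exI conjI allI)
    show "j \<le> L j" for j by (rule L)
    show "norm (dpoly lam (b j) (L j) (\<i> * of_real t)) \<le> Linf_norm \<mu> f" for j t
      using bound[of j "\<beta> t"] by (simp add: group_poly_on_line[OF dg])
    fix n
    have "(\<lambda>j. fourier_coeff \<mu> (\<lambda>x. of_real (\<phi> j x)) (?h n) - 1) \<longlonglongrightarrow> 0"
    proof (rule Lim_null_comparison)
      show "\<forall>\<^sub>F j in sequentially. norm (fourier_coeff \<mu> (\<lambda>x. of_real (\<phi> j x)) (?h n) - 1) \<le> 2 * inverse (real (Suc j))"
        using \<phi>(4) by (intro eventually_sequentiallyI[of "Suc n"]) auto
      have "(\<lambda>j. 2 * inverse (real (Suc j))) \<longlonglongrightarrow> 2 * 0" by (intro tendsto_intros LIMSEQ_inverse_real_of_nat)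
      then show "(\<lambda>j. 2 * inverse (real (Suc j))) \<longlonglongrightarrow> 0" by simp
    qed
    then have "(\<lambda>j. fourier_coeff \<mu> (\<lambda>x. of_real (\<phi> j x)) (?h n)) \<longlonglongrightarrow> 1"
      by (simp add: LIM_zero_cancel)
    then have "(\<lambda>j. b j n) \<longlonglongrightarrow> a n * 1" unfolding b_def by (intro tendsto_intros)
    then show "(\<lambda>j. b j n) \<longlonglongrightarrow> a n" by simp
  qed
qed

section \<open>Uniform limits of polynomials on the group\<close>

lemma bounded_imp_Linf:
  assumes hm: "haar_measure \<mu>" and f: "continuous_on UNIV f" and B: "\<And>x. norm (f x) \<le> B"
  shows "f \<in> Linf \<mu>" and "Linf_norm \<mu> f \<le> B"
proof -
  interpret prob_space \<mu> by (rule haar_prob[OF hm])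
  have m: "f \<in> borel_measurable \<mu>" by (rule haar_measurable_continuous[OF hm f])
  have le: "esssup \<mu> (\<lambda>x. ereal (norm (f x))) \<le> ereal B"
    by (rule esssup_I) (use m B in auto)
  then show L: "f \<in> Linf \<mu>" using m by (auto simp: Linf_def)
  have "0 \<le> B" using order_trans[OF norm_ge_zero B] .
  then show "Linf_norm \<mu> f \<le> B" unfolding Linf_norm_def using le by (cases "esssup \<mu> (\<lambda>x. ereal (norm (f x)))") auto
qed

text \<open>
  Uniform convergence on the imaginary axis transfers to the group because \<open>\<beta>\<close>
  has dense range. Allowing a subsequence \<open>m\<close> of the partial sums covers the series
  from the gliding hump, for which only the sums over complete blocks converge uniformly.
\<close>

lemma uniform_limit_series_function:
  fixes \<beta> :: "real \<Rightarrow> 'g::{topological_ab_group_add, t2_space}"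
  assumes fr: "frequency lam" and dg: "dirichlet_group lam \<beta>" and hm: "haar_measure \<mu>"
    and m: "strict_mono m" and unif: "uniformly_convergent_on {s. 0 \<le> Re s} (\<lambda>j s. dpoly lam a (m j) s)"
  obtains f where "continuous_on UNIV f" "f \<in> series_functions lam \<beta> \<mu> a"
    "\<And>t. (\<lambda>j. dpoly lam a (m j) (\<i> * of_real t)) \<longlonglongrightarrow> f (\<beta> t)"
proof -
  let ?h = "\<lambda>n. freq_character \<beta> (lam n)"
  let ?T = "\<lambda>j. group_poly lam \<beta> a (m j)"
  interpret prob_space \<mu> by (rule haar_prob[OF hm])
  have cpt: "compact (UNIV :: 'g set)" using dg by (simp add: dirichlet_group_def)
  have "uniformly_convergent_on UNIV ?T"
    unfolding uniformly_convergent_eq_Cauchy uniformly_Cauchy_on_def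
  proof (intro allI impI)
    fix e :: real assume "0 < e"
    then have "0 < e / 2" by simp
    then obtain M where M: "\<And>s i j. 0 \<le> Re s \<Longrightarrow> M \<le> i \<Longrightarrow> M \<le> j \<Longrightarrow> dist (dpoly lam a (m i) s) (dpoly lam a (m j) s) < e / 2"
      using unif unfolding uniformly_convergent_eq_Cauchy uniformly_Cauchy_on_def by blast
    have "dist (?T i x) (?T j x) < e" if "M \<le> i" "M \<le> j" for i j x
    proof -
      have "dist (?T i x) (?T j x) \<le> e / 2"
      proof (rule dirichlet_group_dense[OF dg])
        show "continuous_on UNIV (\<lambda>x. dist (?T i x) (?T j x))"
          by (intro continuous_intros group_poly_continuous[OF dg])
        show "dist (?T i (\<beta> t)) (?T j (\<beta> t)) \<le> e / 2" for t
          unfolding group_poly_on_line[OF dg] using M[of "\<i> * of_real t"] that by (intro less_imp_le) simp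
      qed
      then show ?thesis using \<open>0 < e\<close> by simp
    qed
    then show "\<exists>M. \<forall>x\<in>UNIV. \<forall>i\<ge>M. \<forall>j\<ge>M. dist (?T i x) (?T j x) < e" by blast
  qed
  then obtain f where f: "uniform_limit UNIV ?T f sequentially" unfolding uniformly_convergent_on_def by blast
  have fc: "continuous_on UNIV f"
    by (rule uniform_limit_theorem[OF _ f]) (auto intro!: group_poly_continuous[OF dg] always_eventually)
  have "bounded (range f)" using compact_continuous_image[OF fc cpt] by (rule compact_imp_bounded)
  then obtain B where B: "\<And>x. norm (f x) \<le> B" unfolding bounded_iff by blast
  have coeff: "(\<lambda>j. fourier_coeff \<mu> (?T j) \<xi>) \<longlonglongrightarrow> fourier_coeff \<mu> f \<xi>" if \<xi>: "group_character \<xi>" for \<xi>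
  proof (rule LIMSEQ_I)
    fix e :: real assume e: "0 < e"
    then have "\<forall>\<^sub>F j in sequentially. \<forall>x\<in>UNIV. dist (?T j x) (f x) < e / 2"
      using f by (intro uniform_limitD) auto
    then obtain M where M: "\<And>j x. M \<le> j \<Longrightarrow> dist (?T j x) (f x) < e / 2" unfolding eventually_sequentially by blast
    have int: "integrable \<mu> (\<lambda>x. g x * cnj (\<xi> x))" if "continuous_on UNIV g" for g
      by (intro haar_integrable_continuous[OF hm cpt] continuous_intros that character_continuous \<xi>)
    have "norm (fourier_coeff \<mu> (?T j) \<xi> - fourier_coeff \<mu> f \<xi>) < e" if "M \<le> j" for j
    proof -
      have "fourier_coeff \<mu> (?T j) \<xi> - fourier_coeff \<mu> f \<xi> = (LINT x|\<mu>. ?T j x * cnj (\<xi> x) - f x * cnj (\<xi> x))"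
        unfolding fourier_coeff_def
        by (rule Bochner_Integration.integral_diff[symmetric]) (intro int group_poly_continuous[OF dg] fc)+
      also have "norm \<dots> \<le> (LINT x|\<mu>. e / 2)"
      proof (rule norm_integral_le_integral)
        show "norm (?T j x * cnj (\<xi> x) - f x * cnj (\<xi> x)) \<le> e / 2" for x
          using M[OF that, of x] norm_character[OF \<xi>, of x]
          by (simp add: left_diff_distrib[symmetric] norm_mult dist_norm)
      qed (auto intro!: Bochner_Integration.integrable_diff int group_poly_continuous[OF dg] fc)
      also have "\<dots> < e" using e by (simp add: prob_space)
      finally show ?thesis .
    qed
    then show "\<exists>no. \<forall>n\<ge>no. norm (fourier_coeff \<mu> (?T n) \<xi> - fourier_coeff \<mu> f \<xi>) < e" by blast
  qed
  have Tcoeff: "fourier_coeff \<mu> (?T j) \<xi> = (\<Sum>n<m j. if ?h n = \<xi> then a n else 0)" if \<xi>: "group_character \<xi>" for \<xi> j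
  proof -
    have "fourier_coeff \<mu> (?T j) \<xi> = (LINT x|\<mu>. (\<Sum>n<m j. a n * (?h n x * cnj (\<xi> x))))"
      by (simp add: fourier_coeff_def group_poly_def sum_distrib_right mult.assoc)
    also have "\<dots> = (\<Sum>n<m j. a n * fourier_coeff \<mu> (?h n) \<xi>)"
      unfolding fourier_coeff_def
    proof (subst Bochner_Integration.integral_sum)
      show "integrable \<mu> (\<lambda>x. a n * (?h n x * cnj (\<xi> x)))" for n
        by (intro haar_integrable_continuous[OF hm cpt] continuous_intros character_continuous \<xi> freq_character(1)[OF dg])
    qed simp
    also have "\<dots> = (\<Sum>n<m j. if ?h n = \<xi> then a n else 0)"
      unfolding character_orthogonal[OF hm freq_character(1)[OF dg] \<xi>] by (intro sum.cong) auto
    finally show ?thesis .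
  qed
  show ?thesis
  proof (rule that[OF fc])
    show "(\<lambda>j. dpoly lam a (m j) (\<i> * of_real t)) \<longlonglongrightarrow> f (\<beta> t)" for t
      using tendsto_uniform_limitI[OF f, of "\<beta> t"] by (simp add: group_poly_on_line[OF dg])
    have "fourier_coeff \<mu> f \<xi> = 0" if "group_character \<xi>" "\<xi> \<notin> range ?h" for \<xi>
    proof -
      have "?h n \<noteq> \<xi>" for n using that(2) by blast
      then have "fourier_coeff \<mu> (?T j) \<xi> = 0" for j by (simp add: Tcoeff[OF that(1)])
      then show ?thesis using coeff[OF that(1)] by (simp add: LIMSEQ_const_iff)
    qed
    moreover have "a k = fourier_coeff \<mu> f (?h k)" for k
    proof -
      have "(?h n = ?h k) = (n = k)" for n using freq_character_inj[OF fr dg] by blast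
      then have eq: "fourier_coeff \<mu> (?T j) (?h k) = (if k < m j then a k else 0)" for j
        unfolding Tcoeff[OF freq_character(1)[OF dg]] by simp
      have "fourier_coeff \<mu> (?T j) (?h k) = a k" if "Suc k \<le> j" for j
        using that strict_mono_imp_increasing[OF m, of j] unfolding eq by simp
      then have "(\<lambda>j. fourier_coeff \<mu> (?T j) (?h k)) \<longlonglongrightarrow> a k"
        by (intro tendsto_eventually eventually_sequentiallyI[of "Suc k"])
      then show ?thesis using coeff[OF freq_character(1)[OF dg]] LIMSEQ_unique by blast
    qed
    ultimately show "f \<in> series_functions lam \<beta> \<mu> a"
      using bounded_imp_Linf(1)[OF hm fc B] by (auto simp: series_functions_def Hinf_group_def)
  qed
qed

section \<open>Bohr's theorem and bounded partial sums\<close>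

text \<open>
  A bounded extension makes the series approximable, and then bounded partial sums give uniform
  convergence.
\<close>

lemma partial_sums_bounded_imp_bohr:
  assumes fr: "frequency lam" and Q: "partial_sums_bounded lam"
  shows "bohr_theorem_holds lam"
  unfolding bohr_theorem_holds_def
proof (intro allI impI, elim conjE exE)
  fix a s0 F
  assume conv: "dconv lam a s0" and hol: "F holomorphic_on halfplane 0"
    and bdd: "bounded (F ` halfplane 0)" and F: "\<forall>s\<in>halfplane 0. dconv lam a s \<longrightarrow> F s = dlim lam a s"
  obtain M where M: "\<And>s. 0 < Re s \<Longrightarrow> norm (F s) \<le> M"
    using bdd unfolding bounded_iff by auto
  have P: "poly_approx lam M a"
    by (rule bounded_extension_imp_poly_approx[OF fr conv hol M]) (use F in auto)
  show "sigma_u lam a \<le> 0"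
  proof (rule ereal_le_epsilon2)
    fix \<sigma> :: real assume \<sigma>: "0 < \<sigma>"
    have "uniformly_convergent_on (halfplane \<sigma>) (\<lambda>N s. \<Sum>n<N. dterm lam a s n)"
      by (rule uniformly_convergent_on_subset[OF poly_approx_uniformly_convergent[OF fr Q P \<sigma>, unfolded dpoly_def]]) auto
    then have "sigma_u lam a \<le> ereal \<sigma>"
      unfolding sigma_u_def by (intro Inf_lower) blast
    then show "sigma_u lam a \<le> 0 + ereal \<sigma>" by simp
  qed
qed

text \<open>
  The series from the gliding hump converges somewhere, and its limit function extends to the
  uniform limit of the block sums, which is bounded and holomorphic. Yet it diverges at a point of
  the open right half-plane.
\<close>

lemma bohr_imp_partial_sums_bounded:
  assumes fr: "frequency lam" and bohr: "bohr_theorem_holds lam"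
  shows "partial_sums_bounded lam"
proof (rule ccontr)
  assume "\<not> partial_sums_bounded lam"
  then obtain a \<sigma> m where \<sigma>: "0 < \<sigma>" and m: "strict_mono m"
    and unif: "uniformly_convergent_on {s. 0 \<le> Re s} (\<lambda>j s. dpoly lam a (m j) s)"
    and conv: "dconv lam a (of_real (\<sigma> + 1))" and nconv: "\<not> dconv lam a (of_real \<sigma>)"
    using gliding_hump[OF fr] by metis
  obtain F where F: "uniform_limit {s. 0 \<le> Re s} (\<lambda>j s. dpoly lam a (m j) s) F sequentially"
    using unif unfolding uniformly_convergent_on_def by blast
  have hol: "F holomorphic_on halfplane 0"
  proof (rule holomorphic_uniform_sequence[where f = "\<lambda>j s. dpoly lam a (m j) s"])
    show opn: "open (halfplane 0)" by (rule open_halfspace_Re_gt)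
    fix z assume "z \<in> halfplane 0"
    then obtain d where d: "0 < d" "cball z d \<subseteq> halfplane 0" using opn open_contains_cball by blast
    have "uniform_limit (cball z d) (\<lambda>j s. dpoly lam a (m j) s) F sequentially"
      by (rule uniform_limit_on_subset[OF F]) (use d(2) in force)
    then show "\<exists>d>0. cball z d \<subseteq> halfplane 0 \<and> uniform_limit (cball z d) (\<lambda>j s. dpoly lam a (m j) s) F sequentially"
      using d by blast
  qed (rule dpoly_holomorphic)
  have bdd: "bounded (F ` halfplane 0)"
  proof -
    have "\<forall>\<^sub>F j in sequentially. \<forall>s\<in>{s. 0 \<le> Re s}. dist (dpoly lam a (m j) s) (F s) < 1"
      by (rule uniform_limitD[OF F]) simp
    then obtain j where j: "\<And>s. 0 \<le> Re s \<Longrightarrow> dist (dpoly lam a (m j) s) (F s) < 1"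
      unfolding eventually_sequentially by blast
    have "norm (F s) \<le> (\<Sum>n<m j. norm (a n)) + 1" if "0 < Re s" for s
      using j[of s] norm_dpoly_le[OF fr, of s a "m j"] that norm_triangle_sub[of "F s" "dpoly lam a (m j) s"]
      by (simp add: dist_norm norm_minus_commute)
    then show ?thesis unfolding bounded_iff by auto
  qed
  have "F s = dlim lam a s" if s: "s \<in> halfplane 0" "dconv lam a s" for s
  proof (rule LIMSEQ_unique)
    show "(\<lambda>j. dpoly lam a (m j) s) \<longlonglongrightarrow> F s" by (rule tendsto_uniform_limitI[OF F]) (use s in simp)
    show "(\<lambda>j. dpoly lam a (m j) s) \<longlonglongrightarrow> dlim lam a s"
      using LIMSEQ_subseq_LIMSEQ[OF dconv_imp_tendsto[OF s(2)] m] by (simp add: o_def)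
  qed
  then have "sigma_u lam a \<le> 0"
    using bohr conv hol bdd unfolding bohr_theorem_holds_def by blast
  also have "0 < ereal \<sigma>" using \<sigma> by simp
  finally obtain \<sigma>' where \<sigma>': "\<sigma>' < \<sigma>" "uniformly_convergent_on (halfplane \<sigma>') (\<lambda>N s. \<Sum>n<N. dterm lam a s n)"
    unfolding sigma_u_def Inf_less_iff by auto
  have "convergent (\<lambda>N. dpoly lam a N (of_real \<sigma>))"
    unfolding dpoly_def by (rule uniformly_convergent_imp_convergent[OF \<sigma>'(2)]) (use \<sigma>'(1) in simp)
  then show False using nconv by (simp add: dconv_iff_convergent)
qed

section \<open>Comparison of the two spaces of series\<close>

lemma uniformly_convergent_dshift:
  assumes "uniformly_convergent_on {s. d \<le> Re s} (\<lambda>j s. dpoly lam a (m j) s)"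
  shows "uniformly_convergent_on {s. 0 \<le> Re s} (\<lambda>j s. dpoly lam (dshift lam d a) (m j) s)"
  unfolding uniformly_convergent_eq_Cauchy uniformly_Cauchy_on_def dpoly_shift
proof (intro allI impI)
  fix e :: real assume "0 < e"
  then obtain M where M: "\<And>s i j. d \<le> Re s \<Longrightarrow> M \<le> i \<Longrightarrow> M \<le> j \<Longrightarrow> dist (dpoly lam a (m i) s) (dpoly lam a (m j) s) < e"
    using assms unfolding uniformly_convergent_eq_Cauchy uniformly_Cauchy_on_def by blast
  have "dist (dpoly lam a (m i) (s + of_real d)) (dpoly lam a (m j) (s + of_real d)) < e"
    if "s \<in> {s. 0 \<le> Re s}" "M \<le> i" "M \<le> j" for s i j
    using that by (intro M) auto
  then show "\<exists>M. \<forall>s\<in>{s. 0 \<le> Re s}. \<forall>i\<ge>M. \<forall>j\<ge>M.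
      dist (dpoly lam a (m i) (s + of_real d)) (dpoly lam a (m j) (s + of_real d)) < e" by blast
qed

text \<open>
  The uniform limit of the block sums in the gliding hump also lives on the group as a continuous
  function, so the series belongs to the space defined on the group although it diverges at a
  point of the open right half-plane.
\<close>

lemma equal_spaces_imp_partial_sums_bounded:
  fixes \<beta> :: "real \<Rightarrow> 'g::{topological_ab_group_add, t2_space}"
  assumes fr: "frequency lam" and dg: "dirichlet_group lam \<beta>" and hm: "haar_measure \<mu>"
    and sub: "Hinf_plus_set lam \<beta> \<mu> \<subseteq> Dinf_plus_set lam"
  shows "partial_sums_bounded lam"
proof (rule ccontr)
  assume "\<not> partial_sums_bounded lam"
  then obtain a \<sigma> m where \<sigma>: "0 < \<sigma>" and m: "strict_mono m"
    and unif: "uniformly_convergent_on {s. 0 \<le> Re s} (\<lambda>j s. dpoly lam a (m j) s)"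
    and nconv: "\<not> dconv lam a (of_real \<sigma>)"
    using gliding_hump[OF fr] by metis
  have "dshift lam d a \<in> Hinf_set lam \<beta> \<mu>" if d: "0 < d" for d
  proof -
    have "uniformly_convergent_on {s. d \<le> Re s} (\<lambda>j s. dpoly lam a (m j) s)"
      by (rule uniformly_convergent_on_subset[OF unif]) (use d in auto)
    from uniform_limit_series_function[OF fr dg hm m uniformly_convergent_dshift[OF this]]
    show ?thesis unfolding Hinf_set_def by blast
  qed
  then have "a \<in> Dinf_plus_set lam" using sub unfolding Hinf_plus_set_def by blast
  then show False using nconv \<sigma> unfolding Dinf_plus_set_def by simp
qed

lemma Dinf_plus_poly_approx:
  assumes fr: "frequency lam" and a: "a \<in> Dinf_plus_set lam" and \<sigma>: "0 < \<sigma>"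
    and M: "\<And>s. \<sigma> < Re s \<Longrightarrow> norm (dlim lam a s) \<le> M"
  shows "poly_approx lam M (dshift lam \<sigma> a)"
proof (rule bounded_extension_imp_poly_approx[OF fr])
  show conv: "dconv lam (dshift lam \<sigma> a) 0"
    using a \<sigma> unfolding dconv_shift Dinf_plus_set_def by simp
  show "dlim lam (dshift lam \<sigma> a) holomorphic_on halfplane 0"
    using dlim_holomorphic(1)[OF fr conv] by simp
  show "norm (dlim lam (dshift lam \<sigma> a) s) \<le> M" if "0 < Re s" for s
    unfolding dlim_shift using that by (intro M) simp
qed (rule refl)

text \<open>
  With bounded partial sums, a series in \<open>Dinf_plus_set lam\<close> converges uniformly on
  \<open>Re s \<ge> \<sigma>\<close>, hence its restriction to the line \<open>Re s =
  \<sigma>\<close> extends continuously to the group. The bound \<open>M\<close> on the open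
  half-plane carries over to this line by continuity.
\<close>

lemma Dinf_plus_imp_series_function:
  fixes \<beta> :: "real \<Rightarrow> 'g::{topological_ab_group_add, t2_space}"
  assumes fr: "frequency lam" and dg: "dirichlet_group lam \<beta>" and hm: "haar_measure \<mu>"
    and Q: "partial_sums_bounded lam" and a: "a \<in> Dinf_plus_set lam" and \<sigma>: "0 < \<sigma>"
    and M: "\<And>s. \<sigma> < Re s \<Longrightarrow> norm (dlim lam a s) \<le> M"
  shows "\<exists>f\<in>series_functions lam \<beta> \<mu> (dshift lam \<sigma> a). Linf_norm \<mu> f \<le> M"
proof -
  \<comment> \<open>Half of the shift gives boundedness, the other half uniform convergence.\<close>
  define d where "d = \<sigma> / 2"
  have d: "0 < d" using \<sigma> by (simp add: d_def)
  obtain B where B: "\<And>s. d < Re s \<Longrightarrow> norm (dlim lam a s) \<le> B"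
    using a d unfolding Dinf_plus_set_def bounded_iff by force
  have "uniformly_convergent_on {s. d \<le> Re s} (\<lambda>j s. dpoly lam (dshift lam d a) j s)"
    by (rule poly_approx_uniformly_convergent[OF fr Q Dinf_plus_poly_approx[OF fr a d B] d])
  from uniformly_convergent_dshift[where m = "\<lambda>j. j", OF this]
  have "uniformly_convergent_on {s. 0 \<le> Re s} (\<lambda>j s. dpoly lam (dshift lam \<sigma> a) j s)"
    unfolding dpoly_shift by (simp add: d_def add.assoc flip: of_real_add)
  then obtain f where f: "continuous_on UNIV f" "f \<in> series_functions lam \<beta> \<mu> (dshift lam \<sigma> a)"
      "\<And>t. (\<lambda>j. dpoly lam (dshift lam \<sigma> a) j (\<i> * of_real t)) \<longlonglongrightarrow> f (\<beta> t)"
    using uniform_limit_series_function[OF fr dg hm, of "\<lambda>j. j" "dshift lam \<sigma> a"]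
    unfolding strict_mono_def by metis
  have line: "norm (f (\<beta> t)) \<le> M" for t
  proof -
    have conv: "dconv lam a (of_real d)" using a d unfolding Dinf_plus_set_def by simp
    have cont: "continuous_on (halfplane d) (dlim lam a)"
      using holomorphic_on_imp_continuous_on[OF dlim_holomorphic(1)[OF fr conv]] by simp
    let ?z = "\<lambda>e. of_real \<sigma> + \<i> * of_real t + complex_of_real e"
    have "dconv lam (dshift lam \<sigma> a) (\<i> * of_real t)"
      using a \<sigma> unfolding dconv_shift Dinf_plus_set_def by simp
    then have eq: "f (\<beta> t) = dlim lam a (?z 0)"
      using LIMSEQ_unique[OF f(3) dconv_imp_tendsto] by (simp add: dlim_shift add.commute)
    have "((\<lambda>e. dlim lam a (?z e)) \<longlongrightarrow> dlim lam a (?z 0)) (at_right 0)"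
    proof (rule continuous_on_tendsto_compose[OF cont])
      show "(?z \<longlongrightarrow> ?z 0) (at_right 0)" by (intro tendsto_intros)
      show "\<forall>\<^sub>F e in at_right 0. ?z e \<in> halfplane d"
        using \<sigma> by (intro eventually_at_right_less[THEN eventually_mono]) (auto simp: d_def)
    qed (use \<sigma> in \<open>simp add: d_def\<close>)
    then have "((\<lambda>e. norm (dlim lam a (?z e))) \<longlongrightarrow> norm (f (\<beta> t))) (at_right 0)"
      unfolding eq by (rule tendsto_norm)
    then show ?thesis
      by (rule tendsto_upperbound) (auto intro!: eventually_at_right_less[THEN eventually_mono] M)
  qed
  have "norm (f x) \<le> M" for x
    by (rule dirichlet_group_dense[OF dg, of "\<lambda>x. norm (f x)"]) (intro continuous_intros f, rule line)
  then show ?thesis using bounded_imp_Linf(2)[OF hm f(1)] f(2) by blast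
qed

lemma series_function_bounds_dlim:
  fixes \<beta> :: "real \<Rightarrow> 'g::{topological_ab_group_add, t2_space}"
  assumes fr: "frequency lam" and dg: "dirichlet_group lam \<beta>" and hm: "haar_measure \<mu>"
    and Q: "partial_sums_bounded lam" and f: "f \<in> series_functions lam \<beta> \<mu> (dshift lam \<sigma> a)"
    and s: "\<sigma> < Re s"
  shows "dconv lam a s" and "norm (dlim lam a s) \<le> Linf_norm \<mu> f"
proof -
  note P = series_function_imp_poly_approx[OF fr dg hm f]
  have s': "0 < Re (s - of_real \<sigma>)" using s by simp
  show "dconv lam a s" using poly_approx_dconv[OF fr Q P s'] by (simp add: dconv_shift)
  show "norm (dlim lam a s) \<le> Linf_norm \<mu> f"
    using poly_approx_norm_dlim_le[OF fr Q P s'] by (simp add: dlim_shift)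
qed

lemma Hinf_plus_set_eq_Dinf_plus_set:
  fixes \<beta> :: "real \<Rightarrow> 'g::{topological_ab_group_add, t2_space}"
  assumes fr: "frequency lam" and dg: "dirichlet_group lam \<beta>" and hm: "haar_measure \<mu>"
    and Q: "partial_sums_bounded lam"
  shows "Hinf_plus_set lam \<beta> \<mu> = Dinf_plus_set lam"
proof (intro subset_antisym subsetI)
  fix a assume a: "a \<in> Hinf_plus_set lam \<beta> \<mu>"
  have ex: "\<exists>f. f \<in> series_functions lam \<beta> \<mu> (dshift lam \<sigma> a)" if "0 < \<sigma>" for \<sigma>
    using a that unfolding Hinf_plus_set_def Hinf_set_def by blast
  have "dconv lam a s" if s: "s \<in> halfplane 0" for s
  proof -
    obtain f where "f \<in> series_functions lam \<beta> \<mu> (dshift lam (Re s / 2) a)" using ex[of "Re s / 2"] s by auto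
    from series_function_bounds_dlim(1)[OF fr dg hm Q this] show ?thesis using s by simp
  qed
  moreover have "bounded (dlim lam a ` halfplane \<sigma>)" if \<sigma>: "0 < \<sigma>" for \<sigma>
  proof -
    obtain f where f: "f \<in> series_functions lam \<beta> \<mu> (dshift lam \<sigma> a)" using ex[OF \<sigma>] by blast
    show ?thesis unfolding bounded_iff using series_function_bounds_dlim(2)[OF fr dg hm Q f] by auto
  qed
  ultimately show "a \<in> Dinf_plus_set lam" unfolding Dinf_plus_set_def by blast
next
  fix a assume a: "a \<in> Dinf_plus_set lam"
  have "dshift lam \<sigma> a \<in> Hinf_set lam \<beta> \<mu>" if \<sigma>: "0 < \<sigma>" for \<sigma>
  proof -
    obtain M where "\<And>s. \<sigma> < Re s \<Longrightarrow> norm (dlim lam a s) \<le> M"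
      using a \<sigma> unfolding Dinf_plus_set_def bounded_iff by force
    from Dinf_plus_imp_series_function[OF fr dg hm Q a \<sigma> this] show ?thesis unfolding Hinf_set_def by blast
  qed
  then show "a \<in> Hinf_plus_set lam \<beta> \<mu>" unfolding Hinf_plus_set_def by blast
qed

text \<open>
  The function on the group has at least the norm of the limit function because it makes the
  series approximable, and at most this norm because it can be chosen as the continuous extension
  of the values on the line. Since the norms agree one by one, both topologies have the same
  subbase of balls.
\<close>

lemma Hinf_plus_norm_eq_Dinf_plus_norm:
  fixes \<beta> :: "real \<Rightarrow> 'g::{topological_ab_group_add, t2_space}"
  assumes fr: "frequency lam" and dg: "dirichlet_group lam \<beta>" and hm: "haar_measure \<mu>"
    and Q: "partial_sums_bounded lam" and a: "a \<in> Dinf_plus_set lam"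
  shows "Hinf_plus_norm lam \<beta> \<mu> k a = Dinf_plus_norm lam k a"
proof -
  define \<sigma> where "\<sigma> = 1 / real (Suc k)"
  have \<sigma>: "0 < \<sigma>" by (simp add: \<sigma>_def)
  let ?S = "series_functions lam \<beta> \<mu> (dshift lam \<sigma> a)"
  have bdd: "bdd_above ((\<lambda>s. norm (dlim lam a s)) ` halfplane \<sigma>)"
    using a \<sigma> unfolding Dinf_plus_set_def bounded_iff bdd_above_def by fastforce
  have le: "norm (dlim lam a s) \<le> Dinf_plus_norm lam k a" if "\<sigma> < Re s" for s
    unfolding Dinf_plus_norm_def \<sigma>_def[symmetric] by (rule cSUP_upper[OF _ bdd]) (use that in simp)
  obtain f where f: "f \<in> ?S" "Linf_norm \<mu> f \<le> Dinf_plus_norm lam k a"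
    using Dinf_plus_imp_series_function[OF fr dg hm Q a \<sigma> le] by blast
  have nonneg: "0 \<le> Linf_norm \<mu> g" if "g \<in> ?S" for g
    using that by (intro Linf_norm_nonneg[OF haar_prob[OF hm]]) (simp add: series_functions_def Hinf_group_def)
  have "Hinf_norm lam \<beta> \<mu> (dshift lam \<sigma> a) \<le> Linf_norm \<mu> f"
    unfolding Hinf_norm_def by (rule cINF_lower[OF bdd_belowI2 f(1)]) (rule nonneg)
  moreover have "Dinf_plus_norm lam k a \<le> Hinf_norm lam \<beta> \<mu> (dshift lam \<sigma> a)"
    unfolding Hinf_norm_def
  proof (rule cINF_greatest)
    show "?S \<noteq> {}" using f(1) by blast
    fix g assume g: "g \<in> ?S"
    have "of_real (\<sigma> + 1) \<in> halfplane \<sigma>" by simp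
    then have "halfplane \<sigma> \<noteq> {}" by blast
    then show "Dinf_plus_norm lam k a \<le> Linf_norm \<mu> g"
      unfolding Dinf_plus_norm_def \<sigma>_def[symmetric]
      by (rule cSUP_least) (use series_function_bounds_dlim(2)[OF fr dg hm Q g] in simp)
  qed
  ultimately show ?thesis using f(2) unfolding Hinf_plus_norm_def \<sigma>_def[symmetric] by simp
qed

lemma Dinf_plus_set_diff:
  assumes "a \<in> Dinf_plus_set lam" "b \<in> Dinf_plus_set lam"
  shows "(\<lambda>n. b n - a n) \<in> Dinf_plus_set lam"
proof -
  have t: "dterm lam (\<lambda>n. b n - a n) s = (\<lambda>n. dterm lam b s n - dterm lam a s n)" for s
    by (rule ext) (simp add: dterm_def ring_distribs)
  have conv: "dconv lam (\<lambda>n. b n - a n) s" and lim: "dlim lam (\<lambda>n. b n - a n) s = dlim lam b s - dlim lam a s"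
    if "0 < Re s" for s
    using assms that unfolding Dinf_plus_set_def dconv_def dlim_def t
    by (auto intro: summable_diff suminf_diff[symmetric])
  have "bounded (dlim lam (\<lambda>n. b n - a n) ` halfplane \<sigma>)" if \<sigma>: "0 < \<sigma>" for \<sigma>
  proof -
    have "bounded (dlim lam b ` halfplane \<sigma>)" "bounded (dlim lam a ` halfplane \<sigma>)"
      using assms \<sigma> unfolding Dinf_plus_set_def by auto
    then have "bounded ((\<lambda>s. dlim lam b s - dlim lam a s) ` halfplane \<sigma>)" by (rule bounded_minus_comp)
    moreover have "dlim lam (\<lambda>n. b n - a n) ` halfplane \<sigma> = (\<lambda>s. dlim lam b s - dlim lam a s) ` halfplane \<sigma>"
      using lim \<sigma> by (intro image_cong) auto
    ultimately show ?thesis by simp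
  qed
  then show ?thesis using conv unfolding Dinf_plus_set_def by simp
qed

lemma seminorm_topology_cong:
  assumes diff: "\<And>a b. a \<in> V \<Longrightarrow> b \<in> V \<Longrightarrow> (\<lambda>n. b n - a n) \<in> V"
    and eq: "\<And>k a. a \<in> V \<Longrightarrow> p k a = q k a"
  shows "seminorm_topology V p = seminorm_topology V q"
proof -
  let ?ball = "\<lambda>r (a, k :: nat, e :: real). {b\<in>V. r k (\<lambda>n. b n - a n) < e}"
  have balls: "{{b\<in>V. r k (\<lambda>n. b n - a n) < e} | a k e. a \<in> V \<and> 0 < e} = ?ball r ` (V \<times> UNIV \<times> {0<..})"
    for r :: "nat \<Rightarrow> (nat \<Rightarrow> complex) \<Rightarrow> real"
    by (auto simp: image_def)
  have "?ball p ` (V \<times> UNIV \<times> {0<..}) = ?ball q ` (V \<times> UNIV \<times> {0<..})"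
    by (rule image_cong) (use eq[OF diff] in auto)
  then show ?thesis unfolding seminorm_topology_def balls by simp
qed

theorem theorem5p10:
  fixes lam :: "nat \<Rightarrow> real"
    and \<beta> :: "real \<Rightarrow> 'g::{topological_ab_group_add, t2_space}"
    and \<mu> :: "'g measure"
  assumes "frequency lam"
    and "dirichlet_group lam \<beta>"
    and "haar_measure \<mu>"
  shows "Dinf_plus lam = Hinf_plus lam \<beta> \<mu> \<longleftrightarrow> bohr_theorem_holds lam"
proof
  assume "Dinf_plus lam = Hinf_plus lam \<beta> \<mu>"
  then have "Hinf_plus_set lam \<beta> \<mu> \<subseteq> Dinf_plus_set lam"
    using topspace_Dinf_plus[of lam] topspace_Hinf_plus[OF assms(3), of lam \<beta>] by simp
  then show "bohr_theorem_holds lam"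
    by (intro partial_sums_bounded_imp_bohr equal_spaces_imp_partial_sums_bounded[OF assms]) (rule assms(1))
next
  assume "bohr_theorem_holds lam"
  then have Q: "partial_sums_bounded lam" by (rule bohr_imp_partial_sums_bounded[OF assms(1)])
  have "seminorm_topology (Dinf_plus_set lam) (Dinf_plus_norm lam)
      = seminorm_topology (Dinf_plus_set lam) (Hinf_plus_norm lam \<beta> \<mu>)"
    by (rule seminorm_topology_cong[OF Dinf_plus_set_diff Hinf_plus_norm_eq_Dinf_plus_norm[OF assms Q, symmetric]])
  then show "Dinf_plus lam = Hinf_plus lam \<beta> \<mu>"
    unfolding Dinf_plus_def Hinf_plus_def Hinf_plus_set_eq_Dinf_plus_set[OF assms Q] .
qed

end
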